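(* Let $x = T^{1/(\log\log T)^2}$. Then, uniformly in $\Delta = o(\sqrt{\log\log T})$, as $T \to \infty$, $$ \frac{1}{T} \, \mathrm{meas}\left\{ t \in [T, 2T] : \Re \sum_{p \leq x} \frac{1}{p^{\frac12 + i t}} \geq \Delta \cdot \sqrt{\tfrac12 \sum_{p \leq x} \frac1p} \right\} \sim \int_{\Delta}^{\infty} e^{-u^2/2} \, \frac{du}{\sqrt{2\pi}}. $$ That is, for every real-valued function $\Delta = \Delta(T)$ with $\Delta(T)/\sqrt{\log\log T} \to 0$ as $T \to \infty$, the ratio of the two sides tends to $1$ as $T \to \infty$.
   Context: Sums over $p$ run over prime numbers. $\mathrm{meas}$ denotes Lebesgue measure on $\mathbb{R}$, and $\Re$ denotes the real part. *)

theory Defs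
  imports
    "HOL-Analysis.Analysis"
    "HOL-Computational_Algebra.Primes"
    "HOL-Library.Landau_Symbols"
begin

definition cutoff :: "real \<Rightarrow> real" where
  "cutoff T = T powr (1 / (ln (ln T))\<^sup>2)"

definition primes_upto :: "real \<Rightarrow> nat set" where
  "primes_upto x = {p. prime p \<and> real p \<le> x}"

definition prime_dirichlet_poly :: "real \<Rightarrow> real \<Rightarrow> complex" where
  "prime_dirichlet_poly x t =
     (\<Sum>p\<in>primes_upto x. 1 / (of_nat p :: complex) powr (1/2 + \<i> * complex_of_real t))"

lemma finite_primes_upto: "finite (primes_upto x)"
proof (rule finite_subset)
  show "primes_upto x \<subseteq> {..nat \<lfloor>x\<rfloor>}"
    by (auto simp: primes_upto_def le_nat_floor)
qed simp

end

theory Submission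
  imports
    Defs
    "HOL-Probability.Probability"
    "HOL-Probability.Hoeffding"
    "HOL-Computational_Algebra.Squarefree"
    "HOL-Real_Asymp.Real_Asymp"
begin

text \<open>For \<open>t\<close> uniform in \<open>[T, 2T]\<close> let \<open>X\<close> be the real part of the Dirichlet polynomial, and put
  \<open>L = ln (ln T)\<close>.  The model for \<open>X\<close> is \<open>Y = \<Sum> cos(\<theta>\<^sub>p) / sqrt p\<close> with independent uniform angles
  \<open>\<theta>\<^sub>p\<close>; it has variance \<open>c = 1/2 \<Sum> 1/p\<close>, which has the order of \<open>L\<close>.  Let \<open>Z\<close> be a standard normal
  variable independent of everything else.  The proof compares \<open>X + Z\<close> with \<open>Y + Z\<close>, finds the
  density of \<open>Y + Z\<close> by the saddle point method, and then removes \<open>Z\<close>.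

  From \<open>X\<close> to \<open>Y\<close>.  By unique factorisation a product of \<open>k\<close> factors \<open>p powr (\<plusminus> i t)\<close> is either constant or
  oscillates with a frequency of at least \<open>1 / x ^ k\<close>, so the \<open>k\<close>-th moments of \<open>X\<close> and \<open>Y\<close> differ by at most
  \<open>2 x ^ (2 k) / T\<close> (\<open>moments_close\<close>).  As \<open>x\<close> is \<open>T\<close> to the power \<open>1 / L\<^sup>2\<close>, this is negligible for \<open>k\<close>
  up to a small multiple of \<open>L\<^sup>2\<close>.  Since \<open>Y\<close> is subgaussian with variance of order \<open>L\<close>, a Taylor
  polynomial of that degree determines the characteristic function for all frequencies up to a small
  multiple of \<open>sqrt L\<close>, with an error \<open>exp (- a L\<^sup>2)\<close> (\<open>char_close\<close>).  Adding \<open>Z\<close> suppresses the larger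
  frequencies at the price of an error \<open>exp (- a L)\<close>, so the tails of \<open>X + Z\<close> and of \<open>Y + Z\<close> agree
  up to \<open>exp (- a L)\<close> (\<open>smooth_tail_transfer\<close>).  By the hypothesis on \<open>\<Delta>\<close> the tail of the normal
  law at \<open>\<Delta>\<close> is at least \<open>exp (- o(L))\<close>, hence this absolute error is also small relative to the tail.

  The model.  The moment generating function of \<open>Y\<close> is a product of Bessel functions and equals
  \<open>exp (z\<^sup>2 c / 2) H(z)\<close>, where \<open>H\<close> tends to 1 at the origin uniformly in \<open>x\<close>, because \<open>\<Sum> 1/p\<^sup>2\<close>
  converges.  Fourier inversion for \<open>Y + Z\<close> on the vertical line through \<open>s = u / (1 + c)\<close> gives
  the density at \<open>u\<close> as \<open>exp (- u\<^sup>2 / (2 (1 + c)))\<close> times a Gaussian average of \<open>H(s - i\<tau>)\<close>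
  (\<open>smooth_density_saddle\<close>).  In the relevant range \<open>s\<close> is small and the average
  is concentrated on small \<open>\<tau>\<close>, so the density is asymptotic to that of a normal law of variance \<open>1 + c\<close>;
  integration gives the tail (\<open>smooth_tail_gaussian\<close>).

  Removing \<open>Z\<close>.  For a constant \<open>w\<close>, \<open>P(X \<ge> v) P(Z \<ge> -w) \<le> P(X + Z \<ge> v - w)\<close>, and in the other
  direction \<open>P(X + Z \<ge> v + w) \<le> P(X \<ge> v) + exp (- w\<^sup>2 / 2) P(X + Z \<ge> v)\<close>.  A shift of \<open>v\<close> by \<open>w\<close>, like the
  replacement of \<open>c\<close> by \<open>1 + c\<close>, moves \<open>\<Delta>\<close> by \<open>o(1 / (1 + \<bar>\<Delta>\<bar>))\<close>, which does not change the
  asymptotics of the normal tail.  It remains to let \<open>w\<close> tend to infinity.\<close>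

section \<open>Sums of reciprocals of primes\<close>

lemma sum_inverse_squares_le:
  assumes "1 \<le> a" "a \<le> b"
  shows "(\<Sum>n\<in>{a<..b}. 1 / (real n)\<^sup>2) \<le> 1 / real a - 1 / real b"
  using assms(2)
proof (induction b rule: dec_induct)
  case (step b)
  have "1 / (real (Suc b))\<^sup>2 \<le> 1 / real b - 1 / real (Suc b)"
  proof -
    have b: "0 < real b" using assms(1) step by simp
    have "1 / (real (Suc b))\<^sup>2 \<le> 1 / (real b * real (Suc b))"
      using b by (intro divide_left_mono) (auto simp: power2_eq_square)
    also have "\<dots> = 1 / real b - 1 / real (Suc b)" using b by (simp add: field_simps)
    finally show ?thesis .
  qed
  moreover have "{a<..Suc b} = insert (Suc b) {a<..b}" using step by auto
  ultimately show ?case using step by simp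
qed simp

lemma sum_all_inverse_squares_le: "(\<Sum>n=1..N. 1 / (real n)\<^sup>2) \<le> 2"
proof (cases "N = 0")
  case False
  then have "{1..N} = insert 1 {1<..N}" by auto
  moreover have "(\<Sum>n\<in>{1<..N}. 1 / (real n)\<^sup>2) \<le> 1"
    using sum_inverse_squares_le[of 1 N] False by (simp add: order_trans[of _ "1 - 1 / real N"])
  ultimately show ?thesis by simp
qed simp

text \<open>Over a set of primes, with \<open>f p\<close> a power of \<open>p\<close>, the right-hand side is a sum over squarefree
  numbers.\<close>

lemma prod_one_plus_eq_sum_subsets:
  fixes f :: "nat \<Rightarrow> real"
  assumes "finite S"
  shows "(\<Prod>p\<in>S. 1 + f p) = (\<Sum>A\<in>Pow S. \<Prod>p\<in>A. f p)"
proof -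
  have "(\<Prod>p\<in>S. f p + 1) = (\<Sum>A\<in>Pow S. (\<Prod>p\<in>A. f p) * (\<Prod>p\<in>S - A. 1))"
    by (rule prod_add[OF assms])
  then show ?thesis by (simp add: add.commute)
qed

text \<open>A squarefree number determines the set of its prime divisors.\<close>

lemma inj_on_prod_primes:
  assumes "finite S" "\<And>p. p \<in> S \<Longrightarrow> prime (p::nat)"
  shows "inj_on (\<lambda>A. \<Prod>p\<in>A. p) (Pow S)"
proof (rule inj_onI)
  fix A B assume AB: "A \<in> Pow S" "B \<in> Pow S" "\<Prod>A = \<Prod>B"
  have "prime_factors (\<Prod>A) = A" if "A \<in> Pow S" for A
  proof -
    have fin: "finite A" using that assms finite_subset by auto
    have pr: "prime p" if "p \<in> A" for p using that \<open>A \<in> Pow S\<close> assms by auto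
    then have "0 \<notin> A" using not_prime_0 by blast
    then show ?thesis using fin pr
      by (subst prime_factors_prod) (auto simp: prime_prime_factors)
  qed
  then show "A = B" using AB by metis
qed

text \<open>Every \<open>n \<le> x\<close> is a square times a squarefree number composed of primes up to \<open>x\<close>.  Hence the
  harmonic sum up to \<open>x\<close> is at most \<open>\<Sum> 1/m\<^sup>2\<close> times \<open>\<Prod> (1 + 1/p)\<close>.\<close>

lemma ln_le_prime_harmonic_exp:
  assumes "1 \<le> x"
  shows "ln x \<le> 2 * exp (\<Sum>p\<in>primes_upto x. 1 / real p)"
proof -
  define N where "N = nat \<lfloor>x\<rfloor>"
  define S where "S = primes_upto x"
  have fin: "finite S" by (simp add: S_def finite_primes_upto)
  \<comment> \<open>A number is recovered from its largest square divisor and the primes dividing the squarefree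
     cofactor.\<close>
  define h where "h n = (square_part n, prime_factors (squarefree_part n))" for n :: nat
  define g where "g = (\<lambda>(m, A). 1 / (real m)\<^sup>2 * (\<Prod>p\<in>A. 1 / real p))"
  have rec: "n = (\<Prod>p\<in>snd (h n). p) * (fst (h n))\<^sup>2" for n
  proof -
    have "(\<Prod>p\<in>prime_factors (squarefree_part n). p) =
        (\<Prod>p\<in>prime_factors (squarefree_part n). p ^ multiplicity p (squarefree_part n))"
      using squarefree_factorial_semiring'[of "squarefree_part n"]
      by (intro prod.cong) auto
    also have "\<dots> = squarefree_part n" by (subst prod_prime_factors) auto
    finally show ?thesis using squarefree_decompose[of n] by (simp add: h_def)
  qed
  have inj: "inj_on h {1..N}" by (rule inj_onI) (metis rec)
  have gh: "g (h n) = 1 / real n" for n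
    by (subst (2) rec[of n]) (simp add: g_def case_prod_unfold prod_dividef)
  have sub: "h ` {1..N} \<subseteq> {1..N} \<times> Pow S"
  proof (intro image_subsetI)
    fix n assume n: "n \<in> {1..N}"
    have "square_part n \<le> (square_part n)\<^sup>2" by (simp add: power2_eq_square)
    also have "\<dots> \<le> n" using n by (intro dvd_imp_le square_part_square_dvd) auto
    finally have "square_part n \<le> N" using n by simp
    moreover have "square_part n \<noteq> 0" using n by simp
    then have "1 \<le> square_part n" by linarith
    ultimately have 1: "fst (h n) \<in> {1..N}" by (simp add: h_def)
    have "p \<in> S" if "p \<in> prime_factors (squarefree_part n)" for p
    proof -
      have "p dvd n" using that squarefree_decompose[of n]
        by (metis dvd_mult2 in_prime_factors_imp_dvd)
      then have "p \<le> n" using n by (intro dvd_imp_le) auto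
      then have "p \<le> N" using n by simp
      then have "real p \<le> x" unfolding N_def using assms by linarith
      then show ?thesis using that by (auto simp: S_def primes_upto_def)
    qed
    then have "snd (h n) \<in> Pow S" by (auto simp: h_def)
    with 1 show "h n \<in> {1..N} \<times> Pow S" by (simp add: mem_Times_iff)
  qed
  have "ln x \<le> ln (real N + 1)"
    using assms unfolding N_def by (subst ln_le_cancel_iff) linarith+
  also have "\<dots> \<le> harm N" by (rule ln_le_harm)
  also have "\<dots> = (\<Sum>n=1..N. g (h n))"
    by (simp add: harm_def gh inverse_eq_divide)
  also have "\<dots> = sum g (h ` {1..N})"
    by (simp only: sum.reindex[OF inj] o_def)
  also have "\<dots> \<le> sum g ({1..N} \<times> Pow S)"
    using fin by (intro sum_mono2 sub) (auto simp: g_def intro!: prod_nonneg divide_nonneg_nonneg)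
  also have "\<dots> = (\<Sum>m=1..N. 1 / (real m)\<^sup>2) * (\<Sum>A\<in>Pow S. \<Prod>p\<in>A. 1 / real p)"
    unfolding g_def by (simp add: sum_product sum.cartesian_product)
  also have "\<dots> = (\<Sum>m=1..N. 1 / (real m)\<^sup>2) * (\<Prod>p\<in>S. 1 + 1 / real p)"
    by (subst prod_one_plus_eq_sum_subsets[OF fin]) simp
  also have "\<dots> \<le> 2 * (\<Prod>p\<in>S. exp (1 / real p))"
    by (intro mult_mono sum_all_inverse_squares_le prod_mono prod_nonneg)
      (auto simp: exp_ge_add_one_self)
  also have "\<dots> = 2 * exp (\<Sum>p\<in>S. 1 / real p)"
    using fin by (simp add: exp_sum)
  finally show ?thesis by (simp add: S_def)
qed

lemma prime_harmonic_lower: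
  assumes "exp 1 \<le> x"
  shows "ln (ln x) - ln 2 \<le> (\<Sum>p\<in>primes_upto x. 1 / real p)"
proof -
  have "0 < x" by (rule less_le_trans[OF exp_gt_zero assms])
  then have l1: "1 \<le> ln x" using assms by (subst ln_ge_iff) auto
  have "1 \<le> exp (1::real)" by simp
  then have "1 \<le> x" using assms by linarith
  have "ln x / 2 \<le> exp (\<Sum>p\<in>primes_upto x. 1 / real p)"
    using ln_le_prime_harmonic_exp[OF \<open>1 \<le> x\<close>] by simp
  then have "ln (ln x / 2) \<le> (\<Sum>p\<in>primes_upto x. 1 / real p)"
    using l1 by (metis ln_exp ln_mono divide_pos_pos less_le_trans zero_less_one zero_less_numeral)
  then show ?thesis using l1 by (simp add: ln_div)
qed

lemma sum_powr_le:
  assumes "1 < s" "1 \<le> K"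
  shows "(\<Sum>n=1..K. real n powr (- s)) \<le> 1 + (1 - real K powr (1 - s)) / (s - 1)"
  using assms(2)
proof (induction K rule: nat_induct_at_least)
  case (Suc K)
  have "\<exists>z>real K. z < real (Suc K) \<and> real (Suc K) powr (1 - s) - real K powr (1 - s) =
      (real (Suc K) - real K) * ((1 - s) * z powr (1 - s - 1))"
    using Suc by (intro MVT2) (auto intro!: derivative_eq_intros)
  then obtain z where z: "real K < z" "z < real (Suc K)"
    "real (Suc K) powr (1 - s) - real K powr (1 - s) = (1 - s) * z powr (- s)" by auto
  have "real (Suc K) powr (- s) \<le> z powr (- s)"
    using z Suc assms by (intro powr_mono2') auto
  then have "(s - 1) * real (Suc K) powr (- s) \<le> (s - 1) * z powr (- s)"
    using assms by (intro mult_left_mono) auto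
  also have "\<dots> = real K powr (1 - s) - real (Suc K) powr (1 - s)"
    using z(3) by (simp add: algebra_simps)
  finally have "real (Suc K) powr (- s) \<le> (real K powr (1 - s) - real (Suc K) powr (1 - s)) / (s - 1)"
    using assms by (simp add: field_simps)
  then show ?case using Suc by (simp add: diff_divide_distrib)
qed simp

text \<open>The same expansion in the other direction: \<open>\<Prod> (1 + p powr (-s))\<close> is a subsum of the
  Dirichlet series of the zeta function, whose partial sums are at most \<open>1 + 1 / (s - 1)\<close>.\<close>

lemma prime_harmonic_upper:
  assumes "exp 1 \<le> x"
  shows "(\<Sum>p\<in>primes_upto x. 1 / real p) \<le> 6 * ln (1 + ln x)"
proof -
  have "0 < x" by (rule less_le_trans[OF exp_gt_zero assms])
  then have l1: "1 \<le> ln x" using assms by (subst ln_ge_iff) auto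
  \<comment> \<open>With this exponent \<open>p powr (- s)\<close> is at least \<open>1 / (3 p)\<close> for \<open>p \<le> x\<close>, while \<open>1 + 1 / (s - 1) = 1 + ln x\<close>.\<close>
  define s where "s = 1 + 1 / ln x"
  have s: "1 < s" using l1 by (simp add: s_def)
  define S where "S = primes_upto x"
  have fin: "finite S" by (simp add: S_def finite_primes_upto)
  have pr: "prime p" if "p \<in> S" for p using that by (auto simp: S_def primes_upto_def)
  have pos: "0 < p" if "p \<in> S" for p using pr[OF that] by (rule prime_gt_0_nat)
  define K where "K = \<Prod>S"
  have "0 < K" unfolding K_def using pos by (intro prod_pos) auto
  have img: "(\<lambda>A. \<Prod>A) ` Pow S \<subseteq> {1..K}"
  proof (intro image_subsetI)
    fix A assume A: "A \<in> Pow S"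
    have "\<Prod>A dvd K" unfolding K_def using A fin by (intro prod_dvd_prod_subset) auto
    then have "\<Prod>A \<le> K" using \<open>0 < K\<close> by (rule dvd_imp_le)
    moreover have "0 < \<Prod>A" using pos A by (intro prod_pos) auto
    ultimately show "\<Prod>A \<in> {1..K}" by auto
  qed
  have "(\<Prod>p\<in>S. 1 + real p powr (- s)) = (\<Sum>A\<in>Pow S. \<Prod>p\<in>A. real p powr (- s))"
    by (rule prod_one_plus_eq_sum_subsets[OF fin])
  also have "\<dots> = (\<Sum>A\<in>Pow S. real (\<Prod>A) powr (- s))"
    by (simp add: prod_powr_distrib)
  also have "\<dots> = (\<Sum>n\<in>(\<lambda>A. \<Prod>A) ` Pow S. real n powr (- s))"
    by (subst sum.reindex[OF inj_on_prod_primes[OF fin pr]]) (auto simp: o_def)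
  also have "\<dots> \<le> (\<Sum>n=1..K. real n powr (- s))"
    by (intro sum_mono2 img) auto
  also have "\<dots> \<le> 1 + (1 - real K powr (1 - s)) / (s - 1)"
    using s \<open>0 < K\<close> by (intro sum_powr_le) auto
  also have "\<dots> \<le> 1 + 1 / (s - 1)"
    using s by (intro add_mono divide_right_mono) auto
  also have "\<dots> = 1 + ln x" by (simp add: s_def)
  finally have prod: "(\<Prod>p\<in>S. 1 + real p powr (- s)) \<le> 1 + ln x" .
  have summand: "1 / real p \<le> 6 * ln (1 + real p powr (- s))" if "p \<in> S" for p
  proof -
    have p2: "2 \<le> p" using pr[OF that] by (rule prime_ge_2_nat)
    have px: "ln p \<le> ln x" using that p2 by (simp add: S_def primes_upto_def)
    define y where "y = real p powr (- s)"
    have "y \<le> real p powr (- 1)" unfolding y_def using s p2 by (intro powr_mono) auto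
    also have "\<dots> \<le> 1 / 2" using p2 by (simp add: powr_minus_divide)
    finally have y: "0 \<le> y" "y \<le> 1/2" by (auto simp: y_def)
    have "y\<^sup>2 \<le> 1/2 * y" unfolding power2_eq_square using y by (intro mult_right_mono) auto
    then have "y / 2 \<le> ln (1 + y)" using ln_one_plus_pos_lower_bound[of y] y by simp
    moreover have "1 / real p \<le> 3 * y"
    proof -
      have "exp (- 1) \<le> exp (- (ln p / ln x))"
        using px l1 by simp
      also have "\<dots> = real p powr (- (1 / ln x))" using p2 by (simp add: powr_def)
      finally have "exp (- 1) * (1 / real p) \<le> real p powr (- (1 / ln x)) * (1 / real p)"
        by (intro mult_right_mono) auto
      also have "\<dots> = real p powr (- (1 / ln x) + - 1)"
        using p2 by (simp only: powr_add) (simp add: powr_minus_divide)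
      also have "\<dots> = y" by (simp add: y_def s_def add.commute)
      finally have "exp 1 * (exp (- 1) * (1 / real p)) \<le> exp 1 * y"
        by (intro mult_left_mono) auto
      also have "exp 1 * (exp (- 1) * (1 / real p)) = 1 / real p"
        by (simp add: exp_minus)
      also have "exp 1 * y \<le> 3 * y" using exp_le y by (intro mult_right_mono) auto
      finally show ?thesis .
    qed
    ultimately show ?thesis by (simp add: y_def)
  qed
  have "(\<Sum>p\<in>S. 1 / real p) \<le> (\<Sum>p\<in>S. 6 * ln (1 + real p powr (- s)))"
    by (intro sum_mono summand)
  also have "\<dots> = 6 * ln (\<Prod>p\<in>S. 1 + real p powr (- s))"
  proof -
    have "1 + real p powr (- s) \<noteq> 0" for p
      using powr_ge_zero[of "real p" "- s"] by linarith
    then show ?thesis using fin by (subst ln_prod) (auto simp: sum_distrib_left add_pos_nonneg)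
  qed
  also have "\<dots> \<le> 6 * ln (1 + ln x)"
    using prod by (intro mult_left_mono ln_mono prod_pos) (auto simp: add_pos_nonneg)
  finally show ?thesis by (simp add: S_def)
qed

lemma sum_inverse_prime_squares_tail:
  assumes "1 \<le> y"
  shows "(\<Sum>p\<in>{p\<in>primes_upto x. y < real p}. 1 / (real p)\<^sup>2) \<le> 2 / y"
proof -
  define a where "a = nat \<lfloor>y\<rfloor>"
  define b where "b = max a (nat \<lfloor>x\<rfloor>)"
  have "real a = of_int \<lfloor>y\<rfloor>" unfolding a_def using assms by simp
  moreover have "1 \<le> \<lfloor>y\<rfloor>" using assms by simp
  then have "1 \<le> real_of_int \<lfloor>y\<rfloor>" by linarith
  ultimately have a: "1 \<le> a" "y / 2 \<le> real a" by linarith+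
  have "a < p" if "y < real p" for p unfolding a_def using that assms by linarith
  moreover have "p \<le> b" if "real p \<le> x" for p
    unfolding b_def using that by (simp add: le_nat_floor max.coboundedI2)
  ultimately have "{p\<in>primes_upto x. y < real p} \<subseteq> {a<..b}"
    by (auto simp: primes_upto_def)
  then have "(\<Sum>p\<in>{p\<in>primes_upto x. y < real p}. 1 / (real p)\<^sup>2) \<le> (\<Sum>n\<in>{a<..b}. 1 / (real n)\<^sup>2)"
    by (intro sum_mono2) auto
  also have "\<dots> \<le> 1 / real a - 1 / real b"
    by (rule sum_inverse_squares_le[OF a(1)]) (simp add: b_def)
  also have "\<dots> \<le> 1 / real a" by simp
  also have "\<dots> \<le> 1 / (y / 2)" using a assms by (intro divide_left_mono) auto
  finally show ?thesis by simp
qed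

text \<open>This crude bound will be applied with \<open>ln y\<close> equal to a quarter of the sum over all primes up
  to \<open>x\<close>, so that the primes beyond \<open>y\<close> still carry most of that sum.\<close>

lemma prime_harmonic_initial:
  assumes "1 \<le> y"
  shows "(\<Sum>p\<in>{p\<in>primes_upto x. real p \<le> y}. 1 / real p) \<le> 1 + ln y"
proof -
  define N where "N = nat \<lfloor>y\<rfloor>"
  have N: "1 \<le> N" "real N \<le> y" unfolding N_def using assms by linarith+
  have "{p\<in>primes_upto x. real p \<le> y} \<subseteq> {1..N}"
    using prime_ge_1_nat by (auto simp: primes_upto_def N_def le_nat_floor)
  then have "(\<Sum>p\<in>{p\<in>primes_upto x. real p \<le> y}. 1 / real p) \<le> (\<Sum>n=1..N. 1 / real n)"
    by (intro sum_mono2) auto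
  also have "\<dots> \<le> 1 + ln N"
    using N(1)
  proof (induction N rule: nat_induct_at_least)
    case (Suc n)
    have "ln (real n / real (Suc n)) \<le> real n / real (Suc n) - 1"
      using Suc by (intro ln_le_minus_one) auto
    also have "\<dots> = - (1 / real (Suc n))" by (simp add: field_simps)
    finally have "1 / real (Suc n) \<le> ln (real (Suc n)) - ln (real n)"
      using Suc by (simp add: ln_div)
    then show ?case using Suc by simp
  qed simp
  also have "\<dots> \<le> 1 + ln y" using N by simp
  finally show ?thesis .
qed

section \<open>Tails of the standard normal law\<close>

abbreviation std_normal_phi ("\<phi>") where
  "\<phi> \<equiv> std_normal_density"

definition normal_tail :: "real \<Rightarrow> real" where
  "normal_tail a = (LBINT u:{a..}. \<phi> u)"

lemma set_integrable_std_normal [intro]: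
  "A \<in> sets borel \<Longrightarrow> set_integrable lborel A \<phi>"
  unfolding set_integrable_def by (rule integrable_mult_indicator) auto

lemma set_integrable_const_Ico: "set_integrable lborel {a..<b::real} (\<lambda>_. c :: real)"
  by (rule set_integrable_subset[OF borel_integrable_atLeastAtMost'[of a b]]) auto

lemma normal_tail_diff:
  assumes "a \<le> b"
  shows "normal_tail a - normal_tail b = (LBINT u:{a..<b}. \<phi> u)"
proof -
  have eq: "{a..} = {a..<b} \<union> {b..}" using assms by auto
  have "normal_tail a = (LBINT u:{a..<b}. \<phi> u) + normal_tail b"
    unfolding normal_tail_def eq by (rule set_integral_Un) auto
  then show ?thesis by simp
qed

lemma normal_tail_antimono: "a \<le> b \<Longrightarrow> normal_tail b \<le> normal_tail a"
  proof -
  assume "a \<le> b"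
  moreover have "0 \<le> (LBINT u:{a..<b}. \<phi> u)"
    unfolding set_lebesgue_integral_def by (rule Bochner_Integration.integral_nonneg) simp
  ultimately show ?thesis using normal_tail_diff[of a b] by simp
qed

lemma normal_tail_nonneg: "0 \<le> normal_tail a"
  unfolding normal_tail_def by (simp add: set_lebesgue_integral_def integral_nonneg_AE)

lemma normal_tail_le_1: "normal_tail a \<le> 1"
proof -
  have "normal_tail a \<le> (\<integral>u. \<phi> u \<partial>lborel)"
    unfolding normal_tail_def set_lebesgue_integral_def
    using set_integrable_std_normal[of "{a..}"]
    by (intro integral_mono) (auto simp: set_integrable_def indicator_def)
  then show ?thesis by simp
qed

lemma borel_measurable_normal_tail [measurable]: "normal_tail \<in> borel_measurable borel"
proof -
  have "mono (\<lambda>a. - normal_tail a)"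
    by (auto simp: mono_def normal_tail_antimono)
  then have "(\<lambda>a. - (- normal_tail a)) \<in> borel_measurable borel"
    by (intro borel_measurable_uminus borel_measurable_mono)
  then show ?thesis by simp
qed

text \<open>The normal density varies by a bounded factor on the scale \<open>1 / (1 + \<bar>a\<bar>)\<close> around \<open>a\<close>.  The
  next lemmas derive from this that the tail at \<open>a\<close> has at least the order \<open>\<phi>(a) / (1 + \<bar>a\<bar>)\<close> and is stable under
  shifts that are small on that scale.\<close>

lemma std_normal_density_le_shift:
  assumes "\<bar>t - a\<bar> \<le> h" "h * (1 + \<bar>a\<bar>) \<le> 1" "0 \<le> h"
  shows "\<phi> t \<le> exp (3/2) * \<phi> a"
    and "exp (- 3/2) * \<phi> a \<le> \<phi> t"
proof -
  have h1: "h \<le> 1" "h * \<bar>a\<bar> \<le> 1"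
    using assms(2,3) mult_nonneg_nonneg[of h "\<bar>a\<bar>"] by (simp_all add: distrib_left del: mult_nonneg_nonneg)
  have "\<bar>(t - a) * (t - a + 2 * a)\<bar> \<le> h * (h + 2 * \<bar>a\<bar>)"
    unfolding abs_mult by (intro mult_mono) (use assms in auto)
  also have "\<dots> \<le> 3"
    using h1 assms(3) mult_left_le[of h h] by (auto simp: algebra_simps)
  finally have "\<bar>t\<^sup>2 - a\<^sup>2\<bar> \<le> 3"
    by (simp add: algebra_simps power2_eq_square)
  then have "exp (- t\<^sup>2 / 2) \<le> exp (3/2 + - a\<^sup>2 / 2)" "exp (- 3/2 + - a\<^sup>2 / 2) \<le> exp (- t\<^sup>2 / 2)"
    by auto
  then show "\<phi> t \<le> exp (3/2) * \<phi> a"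
    "exp (- 3/2) * \<phi> a \<le> \<phi> t"
    unfolding exp_add std_normal_density_def by (auto simp: field_simps)
qed

lemma normal_tail_ge_density:
  "exp (- 3/2) * \<phi> a / (1 + \<bar>a\<bar>) \<le> normal_tail a"
proof -
  define h where "h = 1 / (1 + \<bar>a\<bar>)"
  have h: "0 < h" "h * (1 + \<bar>a\<bar>) \<le> 1" by (auto simp: h_def)
  have "h * (exp (- 3/2) * \<phi> a) =
      (LBINT u:{a..<a + h}. exp (- 3/2) * \<phi> a)"
    using h by (simp add: set_lebesgue_integral_def)
  also have "\<dots> \<le> (LBINT u:{a..<a + h}. \<phi> u)"
    using h by (intro set_integral_mono std_normal_density_le_shift(2)[of _ _ h])
      (auto intro: set_integrable_const_Ico)
  also have "\<dots> = normal_tail a - normal_tail (a + h)"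
    using h by (subst normal_tail_diff) auto
  also have "\<dots> \<le> normal_tail a" using normal_tail_nonneg by simp
  finally show ?thesis by (simp add: h_def)
qed

lemma normal_tail_pos: "0 < normal_tail a"
  by (rule less_le_trans[OF _ normal_tail_ge_density]) (simp add: normal_density_pos)

lemma normal_tail_perturb_aux:
  assumes "a \<le> b" "(b - a) * (1 + \<bar>c\<bar>) \<le> 1" "c = a \<or> c = b"
  shows "normal_tail a - normal_tail b \<le> exp 3 * ((b - a) * (1 + \<bar>c\<bar>)) * normal_tail c"
proof -
  have "normal_tail a - normal_tail b = (LBINT u:{a..<b}. \<phi> u)"
    using assms by (subst normal_tail_diff) auto
  also have "\<dots> \<le> (LBINT u:{a..<b}. exp (3/2) * \<phi> c)"
    using assms by (intro set_integral_mono std_normal_density_le_shift(1)[of _ _ "b - a"])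
      (auto intro: set_integrable_const_Ico)
  also have "\<dots> = (b - a) * (exp (3/2) * \<phi> c)"
    using assms by (simp add: set_lebesgue_integral_def)
  also have "\<dots> \<le> (b - a) * (exp (3/2) * (exp (3/2) * (1 + \<bar>c\<bar>) * normal_tail c))"
  proof (intro mult_left_mono)
    have "0 < 1 + \<bar>c\<bar>" by simp
    then have "exp (3/2) * (exp (- (3/2)) * \<phi> c) \<le> exp (3/2) * (normal_tail c * (1 + \<bar>c\<bar>))"
      using normal_tail_ge_density[of c] by (intro mult_left_mono) (simp_all add: pos_divide_le_eq)
    then show "\<phi> c \<le> exp (3/2) * (1 + \<bar>c\<bar>) * normal_tail c"
      by (simp add: mult.assoc[symmetric] exp_add[symmetric]) (simp add: algebra_simps)
  qed (use assms in auto)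
  also have "\<dots> = exp (3/2 + 3/2) * ((b - a) * (1 + \<bar>c\<bar>)) * normal_tail c"
    unfolding exp_add by simp
  finally show ?thesis by simp
qed

lemma normal_tail_perturb:
  assumes "\<bar>b - a\<bar> * (1 + \<bar>a\<bar>) \<le> 1"
  shows "\<bar>normal_tail b - normal_tail a\<bar> \<le> exp 3 * (\<bar>b - a\<bar> * (1 + \<bar>a\<bar>)) * normal_tail a"
proof (cases "a \<le> b")
  case True
  then show ?thesis
    using normal_tail_perturb_aux[of a b a] normal_tail_antimono[of a b] assms by auto
next
  case False
  then show ?thesis
    using normal_tail_perturb_aux[of b a a] normal_tail_antimono[of b a] assms by auto
qed

lemma normal_tail_shift:
  "normal_tail (a + b) = (LBINT u:{a..}. \<phi> (u + b))"
proof -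
  have "normal_tail (a + b) = (\<integral>u. indicator {a + b..} (b + 1 * u) * \<phi> (b + 1 * u) \<partial>lborel)"
    unfolding normal_tail_def set_lebesgue_integral_def
    by (subst lborel_integral_real_affine[where c = 1 and t = b]) auto
  also have "\<dots> = (LBINT u:{a..}. \<phi> (u + b))"
    unfolding set_lebesgue_integral_def
    by (intro Bochner_Integration.integral_cong) (auto simp: indicator_def add.commute)
  finally show ?thesis .
qed

text \<open>From \<open>\<phi>(u + b) = \<phi>(u) exp (- u b - b\<^sup>2 / 2)\<close>.  This makes the loss caused by smoothing
  a small multiple of a smoothed tail, instead of a small absolute error, which would be useless far out in the tail.\<close>

lemma normal_tail_add_le:
  assumes "0 \<le> a" "0 \<le> b"
  shows "normal_tail (a + b) \<le> exp (- b\<^sup>2 / 2) * normal_tail a"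
proof -
  have "normal_tail (a + b) = (LBINT u:{a..}. \<phi> (u + b))"
    by (rule normal_tail_shift)
  also have "\<dots> \<le> (LBINT u:{a..}. exp (- b\<^sup>2 / 2) * \<phi> u)"
  proof (rule set_integral_mono)
    show "set_integrable lborel {a..} (\<lambda>u. \<phi> (u + b))"
      unfolding set_integrable_def
      using lborel_integrable_real_affine[where c = 1 and t = b, OF integrable_normal_density[of 1 0]]
      by (intro integrable_mult_indicator) (auto simp: add.commute)
    show "set_integrable lborel {a..} (\<lambda>u. exp (- b\<^sup>2 / 2) * \<phi> u)"
      by (intro set_integrable_mult_right) auto
  next
    fix u assume "u \<in> {a..}"
    then have "exp (- (u + b)\<^sup>2 / 2) \<le> exp (- b\<^sup>2 / 2 + - u\<^sup>2 / 2)"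
      using assms by (auto simp: power2_sum field_simps)
    then show "\<phi> (u + b) \<le> exp (- b\<^sup>2 / 2) * \<phi> u"
      unfolding exp_add std_normal_density_def by (auto simp: field_simps)
  qed
  also have "\<dots> = exp (- b\<^sup>2 / 2) * normal_tail a"
    by (simp add: normal_tail_def)
  finally show ?thesis .
qed

lemma normal_tail_minus: "normal_tail (- a) = 1 - normal_tail a"
proof -
  have UN: "(\<integral>u. \<phi> u \<partial>lborel) = 1" by simp
  have "normal_tail (- a) = (LBINT u:{..a}. \<phi> u)"
    unfolding normal_tail_def set_lebesgue_integral_def
    by (subst lborel_integral_real_affine[where c = "-1" and t = 0])
      (auto intro!: Bochner_Integration.integral_cong simp: indicator_def std_normal_density_def)
  also have "\<dots> = (LBINT u:{..<a}. \<phi> u)"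
    unfolding set_lebesgue_integral_def
    by (intro integral_cong_AE) (auto intro!: AE_I[where N = "{a}"] simp: indicator_def)
  finally have 1: "normal_tail (- a) = (LBINT u:{..<a}. \<phi> u)" .
  have "(LBINT u:{..<a} \<union> {a..}. \<phi> u) =
       (LBINT u:{..<a}. \<phi> u) + normal_tail a"
    unfolding normal_tail_def by (rule set_integral_Un) auto
  also have "{..<a} \<union> {a..} = UNIV" by auto
  finally show ?thesis using 1 UN by (simp add: set_lebesgue_integral_def)
qed

lemma normal_tail_chebyshev:
  assumes "0 < w"
  shows "normal_tail w \<le> 1 / w\<^sup>2"
proof -
  have "normal_tail w \<le> (\<integral>u. \<phi> u * u ^ (2*1) / w\<^sup>2 \<partial>lborel)"
    unfolding normal_tail_def set_lebesgue_integral_def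
  proof (rule integral_mono)
    show "integrable lborel (\<lambda>u. indicat_real {w..} u *\<^sub>R \<phi> u)"
      using set_integrable_std_normal[of "{w..}"] by (simp add: set_integrable_def)
    show "integrable lborel (\<lambda>u. \<phi> u * u ^ (2*1) / w\<^sup>2)"
      by (intro integrable_divide integrable_std_normal_moment)
    fix u :: real
    have "1 \<le> u ^ 2 / w\<^sup>2" if "w \<le> u"
      using that assms by (auto intro: power_mono)
    then have "\<phi> u * 1 \<le> \<phi> u * (u ^ 2 / w\<^sup>2)" if "w \<le> u"
      using that by (intro mult_left_mono) auto
    then show "indicat_real {w..} u *\<^sub>R \<phi> u \<le> \<phi> u * u ^ (2*1) / w\<^sup>2"
      by (auto simp: indicator_def)
  qed
  also have "\<dots> = 1 / w\<^sup>2"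
    unfolding Bochner_Integration.integral_divide_zero integral_std_normal_moment_even[of 1]
    by simp
  finally show ?thesis .
qed

lemma normal_tail_chernoff:
  assumes "0 \<le> s"
  shows "normal_tail a \<le> exp (- s * a + s\<^sup>2 / 2)"
proof -
  have int: "integrable lborel (\<lambda>u. \<phi> (- s + 1 * u))"
    using lborel_integrable_real_affine[where c = 1 and t = "- s", OF integrable_normal_density[of 1 0]]
    by simp
  have le: "\<phi> u \<le> exp (- s * a + s\<^sup>2 / 2) * \<phi> (- s + 1 * u)" if "a \<le> u" for u
  proof -
    have "s * a \<le> s * u" using that assms by (rule mult_left_mono)
    moreover have "(- s * a + s\<^sup>2 / 2) + - (u - s)\<^sup>2 / 2 = - u\<^sup>2 / 2 + (s * u - s * a)"
      by (simp add: power2_eq_square field_simps)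
    ultimately have "exp (- u\<^sup>2 / 2) \<le> exp ((- s * a + s\<^sup>2 / 2) + - (u - s)\<^sup>2 / 2)"
      by simp
    then show ?thesis
      unfolding exp_add std_normal_density_def by (auto simp: field_simps)
  qed
  have "normal_tail a \<le> (\<integral>u. exp (- s * a + s\<^sup>2 / 2) * \<phi> (- s + 1 * u) \<partial>lborel)"
    unfolding normal_tail_def set_lebesgue_integral_def
    using set_integrable_std_normal[of "{a..}"] int le
    by (intro integral_mono integrable_mult_right) (auto simp: set_integrable_def indicator_def)
  also have "\<dots> = exp (- s * a + s\<^sup>2 / 2) * (\<integral>u. \<phi> (- s + 1 * u) \<partial>lborel)"
    by simp
  also have "(\<integral>u. \<phi> (- s + 1 * u) \<partial>lborel) = 1"
    using lborel_integral_real_affine[where c = 1 and t = "- s" and f = \<phi>] by simp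
  finally show ?thesis by simp
qed

lemma normal_tail_minus_tendsto: "((\<lambda>w. normal_tail (- w)) \<longlongrightarrow> 1) at_top"
proof (rule tendsto_sandwich)
  show "\<forall>\<^sub>F w in at_top. 1 - 1 / w\<^sup>2 \<le> normal_tail (- w)"
    using eventually_gt_at_top[of 0] by eventually_elim (use normal_tail_chebyshev in \<open>auto simp: normal_tail_minus\<close>)
  show "((\<lambda>w::real. 1 - 1 / w\<^sup>2) \<longlongrightarrow> 1) at_top" by real_asymp
qed (auto simp: normal_tail_le_1)

text \<open>The product is a multiple of another normal density, so its integral and its second moment are
  those of a normal law of variance \<open>1 / (1 + c)\<close>.\<close>

lemma std_normal_times_gaussian:
  assumes "- 1 < c"
  shows "\<phi> t * exp (- c * t\<^sup>2 / 2) =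
     1 / sqrt (1 + c) * normal_density 0 (1 / sqrt (1 + c)) t"
proof -
  have "exp (- t\<^sup>2 / 2 + - c * t\<^sup>2 / 2) = exp (- (t - 0)\<^sup>2 / (2 * (1 / sqrt (1 + c))\<^sup>2))"
    using assms by (simp add: field_simps)
  then show ?thesis
    using assms unfolding exp_add std_normal_density_def normal_density_def
    by (simp add: real_sqrt_divide real_sqrt_mult field_simps)
qed

lemma integrable_std_normal_times_gaussian:
  assumes "- 1 < c"
  shows "integrable lborel (\<lambda>t. \<phi> t * exp (- c * t\<^sup>2 / 2))"
  unfolding std_normal_times_gaussian[OF assms] using assms by auto

lemma integral_std_normal_times_gaussian:
  assumes "- 1 < c"
  shows "(\<integral>t. \<phi> t * exp (- c * t\<^sup>2 / 2) \<partial>lborel) = 1 / sqrt (1 + c)"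
  unfolding std_normal_times_gaussian[OF assms] using assms by simp

lemma second_moment_std_normal_times_gaussian:
  assumes "- 1 < c"
  shows "has_bochner_integral lborel (\<lambda>t. \<phi> t * exp (- c * t\<^sup>2 / 2) * t\<^sup>2)
     (1 / sqrt (1 + c) / (1 + c))"
proof -
  have pos: "0 < 1 / sqrt (1 + c)" using assms by simp
  have "has_bochner_integral lborel (\<lambda>t. 1 / sqrt (1 + c) * (normal_density 0 (1 / sqrt (1 + c)) t * (t - 0) ^ (2 * 1)))
     (1 / sqrt (1 + c) * (fact (2 * 1) / ((2 / (1 / sqrt (1 + c))\<^sup>2) ^ 1 * fact 1)))"
    by (intro has_bochner_integral_mult_right normal_moment_even pos)
  moreover have "1 / sqrt (1 + c) * (fact (2 * 1) / ((2 / (1 / sqrt (1 + c))\<^sup>2) ^ 1 * fact 1)) = 1 / sqrt (1 + c) / (1 + c)"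
  proof -
    have "2 / (2 * (1 + c)) = 1 / (1 + c)" using assms by (subst frac_eq_eq) auto
    then show ?thesis using assms by (simp add: power_divide)
  qed
  ultimately show ?thesis
    unfolding std_normal_times_gaussian[OF assms] by (simp add: mult.assoc)
qed

section \<open>Gaussian smoothing of a random variable\<close>

text \<open>The density and the upper tail of \<open>X + Z\<close>, where \<open>Z\<close> is standard normal and independent of \<open>X\<close>;
  taking the expectation over \<open>Z\<close> first makes a joint probability space unnecessary.\<close>

definition smooth_density :: "'a measure \<Rightarrow> ('a \<Rightarrow> real) \<Rightarrow> real \<Rightarrow> real" where
  "smooth_density M X u = (\<integral>\<omega>. \<phi> (u - X \<omega>) \<partial>M)"

definition smooth_tail :: "'a measure \<Rightarrow> ('a \<Rightarrow> real) \<Rightarrow> real \<Rightarrow> real" where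
  "smooth_tail M X v = (\<integral>\<omega>. normal_tail (v - X \<omega>) \<partial>M)"

lemma std_normal_density_le_1: "\<phi> x \<le> 1"
proof -
  have "1 \<le> sqrt (2 * pi)" using pi_gt3 by simp
  then have "1 / sqrt (2 * pi) * exp (- x\<^sup>2 / 2) \<le> 1 * 1"
    by (intro mult_mono) auto
  then show ?thesis by (simp add: std_normal_density_def)
qed

context prob_space
begin

lemma integrable_normal_tail_shift:
  assumes [measurable]: "X \<in> borel_measurable M"
  shows "integrable M (\<lambda>\<omega>. normal_tail (v - X \<omega>))"
  by (rule integrable_const_bound[where B = 1]) (auto simp: normal_tail_nonneg normal_tail_le_1)

lemma smooth_tail_diff:
  assumes X [measurable]: "X \<in> borel_measurable M" and "v \<le> w"
  shows "smooth_tail M X v - smooth_tail M X w = (LBINT u:{v..<w}. smooth_density M X u)"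
    and "set_integrable lborel {v..<w} (smooth_density M X)"
proof -
  interpret P: pair_sigma_finite M lborel ..
  let ?f = "\<lambda>\<omega> u. indicator {v..<w} u * \<phi> (u - X \<omega>)"
  have inner: "(\<integral>u. ?f \<omega> u \<partial>lborel) = normal_tail (v - X \<omega>) - normal_tail (w - X \<omega>)" for \<omega>
  proof -
    have "(\<integral>u. ?f \<omega> u \<partial>lborel) = (\<integral>u. ?f \<omega> (X \<omega> + 1 * u) \<partial>lborel)"
      using lborel_integral_real_affine[where c = 1 and t = "X \<omega>" and f = "?f \<omega>"] by simp
    also have "\<dots> = (LBINT u:{v - X \<omega>..<w - X \<omega>}. \<phi> u)"
      unfolding set_lebesgue_integral_def
      by (intro Bochner_Integration.integral_cong) (auto simp: indicator_def)
    finally show ?thesis using \<open>v \<le> w\<close> by (simp add: normal_tail_diff)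
  qed
  have intf: "integrable lborel (?f \<omega>)" for \<omega>
  proof -
    have "integrable lborel (\<lambda>u. \<phi> (- X \<omega> + 1 * u))"
      using lborel_integrable_real_affine[where c = 1 and t = "- X \<omega>", OF integrable_normal_density[of 1 0]]
      by simp
    then have "integrable lborel (\<lambda>u. indicator {v..<w} u *\<^sub>R \<phi> (- X \<omega> + 1 * u))"
      by (intro integrable_mult_indicator) auto
    then show ?thesis by simp
  qed
  have int: "integrable (M \<Otimes>\<^sub>M lborel) (\<lambda>(\<omega>, u). ?f \<omega> u)"
  proof (rule P.Fubini_integrable)
    show "(\<lambda>(\<omega>, u). ?f \<omega> u) \<in> borel_measurable (M \<Otimes>\<^sub>M lborel)" by measurable
    have "(\<lambda>\<omega>. \<integral>u. norm (case (\<omega>, u) of (\<omega>, u) \<Rightarrow> ?f \<omega> u) \<partial>lborel) =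
        (\<lambda>\<omega>. normal_tail (v - X \<omega>) - normal_tail (w - X \<omega>))"
      by (simp add: abs_mult inner)
    then show "integrable M (\<lambda>\<omega>. \<integral>u. norm (case (\<omega>, u) of (\<omega>, u) \<Rightarrow> ?f \<omega> u) \<partial>lborel)"
      using integrable_normal_tail_shift[OF X] by simp
  qed (use intf in simp)
  have swap: "(\<integral>u. (\<integral>\<omega>. ?f \<omega> u \<partial>M) \<partial>lborel) = (\<integral>\<omega>. (\<integral>u. ?f \<omega> u \<partial>lborel) \<partial>M)"
    using P.Fubini_integral[OF int] .
  show "smooth_tail M X v - smooth_tail M X w = (LBINT u:{v..<w}. smooth_density M X u)"
    using swap integrable_normal_tail_shift[OF X]
    by (simp add: smooth_tail_def smooth_density_def set_lebesgue_integral_def inner)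
  have "integrable lborel (\<lambda>u. \<integral>\<omega>. ?f \<omega> u \<partial>M)"
    using P.integrable_snd[OF int] by simp
  then show "set_integrable lborel {v..<w} (smooth_density M X)"
    by (simp add: set_integrable_def smooth_density_def)
qed

text \<open>The standard normal density is its own Fourier transform, and Fubini's theorem does the rest.
  The weight allows an exponential change of measure, i.e. inversion along a vertical line other than the imaginary axis.\<close>

lemma weighted_smooth_density_fourier:
  assumes X [measurable]: "X \<in> borel_measurable M" and W [measurable]: "W \<in> borel_measurable M"
    and W_le: "\<And>\<omega>. \<bar>W \<omega>\<bar> \<le> (B :: real)"
  shows "complex_of_real (\<integral>\<omega>. W \<omega> * \<phi> (u - X \<omega>) \<partial>M) =
    1 / sqrt (2 * pi) * (CLINT \<tau>|std_normal_distribution. (CLINT \<omega>|M. W \<omega> * iexp (\<tau> * (u - X \<omega>))))"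
proof -
  interpret N: real_distribution std_normal_distribution by (rule real_dist_normal_dist)
  interpret P: pair_prob_space M std_normal_distribution ..
  have int: "integrable (M \<Otimes>\<^sub>M std_normal_distribution) (\<lambda>(\<omega>, \<tau>). W \<omega> * iexp (\<tau> * (u - X \<omega>)))"
    by (rule P.integrable_const_bound[where B = B]) (use W_le in \<open>auto simp: norm_mult\<close>)
  have inner: "(CLINT \<tau>|std_normal_distribution. W \<omega> * iexp (\<tau> * (u - X \<omega>))) =
      sqrt (2 * pi) * complex_of_real (W \<omega> * \<phi> (u - X \<omega>))" for \<omega>
  proof -
    have "(CLINT \<tau>|std_normal_distribution. iexp (\<tau> * (u - X \<omega>))) = char std_normal_distribution (u - X \<omega>)"
      by (simp add: char_def mult.commute)
    also have "\<dots> = sqrt (2 * pi) * complex_of_real (\<phi> (u - X \<omega>))"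
      unfolding char_std_normal_distribution by (simp add: std_normal_density_def)
    finally show ?thesis by simp
  qed
  have "(CLINT \<tau>|std_normal_distribution. (CLINT \<omega>|M. W \<omega> * iexp (\<tau> * (u - X \<omega>)))) =
     (CLINT \<omega>|M. (CLINT \<tau>|std_normal_distribution. W \<omega> * iexp (\<tau> * (u - X \<omega>))))"
    using P.Fubini_integral[OF int] .
  also have "\<dots> = sqrt (2 * pi) * complex_of_real (\<integral>\<omega>. W \<omega> * \<phi> (u - X \<omega>) \<partial>M)"
    unfolding inner by (subst integral_mult_right_zero) (simp only: integral_complex_of_real)
  finally show ?thesis by simp
qed

lemma smooth_density_fourier:
  assumes X [measurable]: "X \<in> borel_measurable M"
  shows "complex_of_real (smooth_density M X u) =
    1 / sqrt (2 * pi) * (CLINT \<tau>|std_normal_distribution. (CLINT \<omega>|M. iexp (\<tau> * (u - X \<omega>))))"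
  using weighted_smooth_density_fourier[OF X, of "\<lambda>_. 1" 1 u] by (simp add: smooth_density_def)

text \<open>If \<open>X \<ge> v\<close> and \<open>Z \<ge> -w\<close> then \<open>X + Z \<ge> v - w\<close>.\<close>

lemma prob_le_smooth_tail:
  assumes X [measurable]: "X \<in> borel_measurable M"
  shows "prob {\<omega> \<in> space M. X \<omega> \<ge> v} * normal_tail (- w) \<le> smooth_tail M X (v - w)"
proof -
  have "prob {\<omega> \<in> space M. X \<omega> \<ge> v} * normal_tail (- w) =
     expectation (\<lambda>\<omega>. indicator {\<omega> \<in> space M. X \<omega> \<ge> v} \<omega> * normal_tail (- w))"
    by simp
  also have "\<dots> \<le> smooth_tail M X (v - w)"
    unfolding smooth_tail_def
    by (intro integral_mono integrable_normal_tail_shift integrable_mult_left integrable_real_indicator X)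
      (auto simp: indicator_def less_top[symmetric] intro: normal_tail_antimono normal_tail_nonneg)
  finally show ?thesis .
qed

text \<open>If \<open>X < v\<close>, then \<open>X + Z \<ge> v + w\<close> forces \<open>Z\<close> to exceed the positive number \<open>v - X\<close> by a further \<open>w\<close>, and this
  is less likely than \<open>Z \<ge> v - X\<close> by the factor of \<open>normal_tail_add_le\<close>.\<close>

lemma smooth_tail_le_prob:
  assumes X [measurable]: "X \<in> borel_measurable M" and "0 \<le> w"
  shows "smooth_tail M X (v + w) - exp (- w\<^sup>2 / 2) * smooth_tail M X v \<le> prob {\<omega> \<in> space M. X \<omega> \<ge> v}"
proof -
  have "smooth_tail M X (v + w) \<le>
     expectation (\<lambda>\<omega>. indicator {\<omega> \<in> space M. X \<omega> \<ge> v} \<omega> + exp (- w\<^sup>2 / 2) * normal_tail (v - X \<omega>))"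
    unfolding smooth_tail_def
  proof (intro integral_mono integrable_normal_tail_shift Bochner_Integration.integrable_add integrable_mult_right X)
    show "integrable M (indicat_real {\<omega> \<in> space M. X \<omega> \<ge> v})"
      by (intro integrable_real_indicator) (auto simp: less_top[symmetric])
    fix \<omega> assume "\<omega> \<in> space M"
    then show "normal_tail (v + w - X \<omega>) \<le> indicator {\<omega> \<in> space M. X \<omega> \<ge> v} \<omega> + exp (- w\<^sup>2 / 2) * normal_tail (v - X \<omega>)"
      using normal_tail_add_le[of "v - X \<omega>" w] normal_tail_nonneg[of "v - X \<omega>"] normal_tail_le_1[of "v + w - X \<omega>"] assms(2)
      by (cases "X \<omega> \<ge> v") (auto simp: algebra_simps intro: order_trans)
  qed
  also have "\<dots> = prob {\<omega> \<in> space M. X \<omega> \<ge> v} + exp (- w\<^sup>2 / 2) * smooth_tail M X v"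
    unfolding smooth_tail_def using integrable_normal_tail_shift[OF X]
    by (subst Bochner_Integration.integral_add) (auto simp: less_top[symmetric])
  finally show ?thesis by simp
qed

lemma smooth_tail_chebyshev:
  assumes X [measurable]: "X \<in> borel_measurable M" and X2: "integrable M (\<lambda>\<omega>. (X \<omega>)\<^sup>2)" and "0 < w"
  shows "smooth_tail M X w \<le> 4 * (expectation (\<lambda>\<omega>. (X \<omega>)\<^sup>2) + 1) / w\<^sup>2"
proof -
  have "smooth_tail M X w \<le> expectation (\<lambda>\<omega>. 4 / w\<^sup>2 * (X \<omega>)\<^sup>2 + 4 / w\<^sup>2)"
    unfolding smooth_tail_def
  proof (intro integral_mono integrable_normal_tail_shift Bochner_Integration.integrable_add integrable_mult_right X X2)
    fix \<omega>
    show "normal_tail (w - X \<omega>) \<le> 4 / w\<^sup>2 * (X \<omega>)\<^sup>2 + 4 / w\<^sup>2"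
    proof (cases "X \<omega> \<ge> w / 2")
      case True
      then have "(w/2)\<^sup>2 \<le> (X \<omega>)\<^sup>2" using assms by (intro power_mono) auto
      then have "1 \<le> 4 / w\<^sup>2 * (X \<omega>)\<^sup>2" using assms by (auto simp: field_simps)
      moreover have "0 \<le> 4 / w\<^sup>2" by simp
      ultimately show ?thesis using normal_tail_le_1[of "w - X \<omega>"] by linarith
    next
      case False
      then have "normal_tail (w - X \<omega>) \<le> normal_tail (w / 2)"
        by (intro normal_tail_antimono) auto
      also have "\<dots> \<le> 1 / (w/2)\<^sup>2" using assms by (intro normal_tail_chebyshev) auto
      also have "\<dots> = 4 / w\<^sup>2" by (simp add: field_simps)
      also have "\<dots> \<le> 4 / w\<^sup>2 * (X \<omega>)\<^sup>2 + 4 / w\<^sup>2" by simp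
      finally show ?thesis .
    qed
  qed auto
  also have "\<dots> = 4 * (expectation (\<lambda>\<omega>. (X \<omega>)\<^sup>2) + 1) / w\<^sup>2"
    using X2 by (simp add: prob_space add_divide_distrib distrib_left)
  finally show ?thesis .
qed

lemma smooth_tail_chernoff:
  assumes X [measurable]: "X \<in> borel_measurable M" and int: "integrable M (\<lambda>\<omega>. exp (s * X \<omega>))" and "0 \<le> s"
  shows "smooth_tail M X u \<le> exp (- s * u + s\<^sup>2 / 2) * expectation (\<lambda>\<omega>. exp (s * X \<omega>))"
proof -
  have "smooth_tail M X u \<le> expectation (\<lambda>\<omega>. exp (- s * u + s\<^sup>2 / 2) * exp (s * X \<omega>))"
    unfolding smooth_tail_def
  proof (intro integral_mono integrable_normal_tail_shift integrable_mult_right X int)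
    fix \<omega>
    show "normal_tail (u - X \<omega>) \<le> exp (- s * u + s\<^sup>2 / 2) * exp (s * X \<omega>)"
      using normal_tail_chernoff[OF \<open>0 \<le> s\<close>, of "u - X \<omega>"]
      by (simp add: exp_add[symmetric] algebra_simps)
  qed
  then show ?thesis by simp
qed

end

lemma std_normal_outside_le:
  "(\<integral>\<tau>. indicator {\<tau>. \<bar>\<tau>\<bar> > A} \<tau> \<partial>std_normal_distribution) \<le> 2 * exp (- A\<^sup>2 / 4)" if "0 \<le> A"
proof -
  have "(\<integral>\<tau>. indicator {\<tau>. \<bar>\<tau>\<bar> > A} \<tau> \<partial>std_normal_distribution) =
    (\<integral>\<tau>. \<phi> \<tau> * indicator {\<tau>. \<bar>\<tau>\<bar> > A} \<tau> \<partial>lborel)"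
    by (subst integral_density) auto
  also have "\<dots> \<le> (\<integral>\<tau>. exp (- A\<^sup>2 / 4) * (\<phi> \<tau> * exp (- (-1/2) * \<tau>\<^sup>2 / 2)) \<partial>lborel)"
  proof (rule integral_mono)
    show "integrable lborel (\<lambda>\<tau>. \<phi> \<tau> * indicator {\<tau>. \<bar>\<tau>\<bar> > A} \<tau>)"
      using integrable_mult_indicator[of "{\<tau>. \<bar>\<tau>\<bar> > A}" lborel \<phi>]
      by (simp add: mult.commute)
    show "integrable lborel (\<lambda>\<tau>. exp (- A\<^sup>2 / 4) * (\<phi> \<tau> * exp (- (-1/2) * \<tau>\<^sup>2 / 2)))"
      by (intro integrable_mult_right integrable_std_normal_times_gaussian) simp
    fix \<tau>
    have "1 \<le> exp (- A\<^sup>2 / 4 + \<tau>\<^sup>2 / 4)" if "\<bar>\<tau>\<bar> > A"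
      using power_mono[of A "\<bar>\<tau>\<bar>" 2] \<open>0 \<le> A\<close> that by simp
    then have "\<phi> \<tau> * indicator {\<tau>. \<bar>\<tau>\<bar> > A} \<tau> \<le> \<phi> \<tau> * exp (- A\<^sup>2 / 4 + \<tau>\<^sup>2 / 4)"
      by (intro mult_left_mono) (auto simp: indicator_def)
    then show "\<phi> \<tau> * indicator {\<tau>. \<bar>\<tau>\<bar> > A} \<tau>
        \<le> exp (- A\<^sup>2 / 4) * (\<phi> \<tau> * exp (- (-1/2) * \<tau>\<^sup>2 / 2))"
      unfolding exp_add by (simp add: mult_ac)
  qed
  also have "\<dots> = exp (- A\<^sup>2 / 4) * (1 / sqrt (1 + - 1/2))"
    unfolding integral_mult_right_zero by (subst integral_std_normal_times_gaussian) auto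
  also have "\<dots> \<le> exp (- A\<^sup>2 / 4) * 2"
    using real_sqrt_le_mono[of "1/4" "1/2"] by (intro mult_left_mono) (auto simp: real_sqrt_divide field_simps)
  finally show ?thesis by simp
qed

text \<open>Agreement of the characteristic functions at the frequencies up to \<open>A\<close> suffices, because the
  normal factor in the inversion formula damps the others.\<close>

lemma smooth_density_close:
  assumes "prob_space M" "prob_space M'"
    and X [measurable]: "X \<in> borel_measurable M" and Y [measurable]: "Y \<in> borel_measurable M'"
    and "0 \<le> A" "0 \<le> \<delta>"
    and close: "\<And>\<tau>. \<bar>\<tau>\<bar> \<le> A \<Longrightarrow> cmod ((CLINT \<omega>|M. iexp (\<tau> * X \<omega>)) - (CLINT \<omega>|M'. iexp (\<tau> * Y \<omega>))) \<le> \<delta>"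
  shows "\<bar>smooth_density M X u - smooth_density M' Y u\<bar> \<le> \<delta> + 4 * exp (- A\<^sup>2 / 4)"
proof -
  interpret M: prob_space M by fact
  interpret M': prob_space M' by fact
  interpret N: real_distribution std_normal_distribution by (rule real_dist_normal_dist)
  let ?a = "\<lambda>\<tau>. CLINT \<omega>|M. iexp (\<tau> * (u - X \<omega>))"
  let ?b = "\<lambda>\<tau>. CLINT \<omega>|M'. iexp (\<tau> * (u - Y \<omega>))"
  let ?N = std_normal_distribution
  have shift: "(CLINT \<omega>|M. iexp (\<tau> * (u - X \<omega>))) = iexp (\<tau> * u) * (CLINT \<omega>|M. iexp ((- \<tau>) * X \<omega>))"
    for \<tau> and M :: "'z measure" and X
    unfolding integral_mult_right_zero[symmetric]
    by (intro Bochner_Integration.integral_cong) (auto simp: exp_add[symmetric] algebra_simps)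
  have le1: "cmod (?a \<tau>) \<le> 1" "cmod (?b \<tau>) \<le> 1" for \<tau>
    by (rule order_trans[OF integral_norm_bound], simp add: M.prob_space M'.prob_space)+
  have bound: "cmod (?a \<tau> - ?b \<tau>) \<le> \<delta> + 2 * indicator {\<tau>. \<bar>\<tau>\<bar> > A} \<tau>" for \<tau>
  proof (cases "\<bar>\<tau>\<bar> \<le> A")
    case True
    then show ?thesis
      using close[of "- \<tau>"] unfolding shift right_diff_distrib[symmetric] norm_mult by simp
  next
    case False
    then show ?thesis
      using norm_triangle_ineq4[of "?a \<tau>" "?b \<tau>"] le1[of \<tau>] \<open>0 \<le> \<delta>\<close> by simp
  qed
  have meas [measurable]: "?a \<in> borel_measurable borel" "?b \<in> borel_measurable borel"
    by measurable
  have inta: "integrable ?N ?a" "integrable ?N ?b"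
    by (rule N.integrable_const_bound[where B = 1], use le1 in auto)+
  have intind: "integrable ?N (indicat_real {\<tau>. \<bar>\<tau>\<bar> > A})"
    by (rule N.integrable_const_bound[where B = 1]) auto
  have "complex_of_real (smooth_density M X u - smooth_density M' Y u) = 1 / sqrt (2 * pi) * (CLINT \<tau>|?N. ?a \<tau> - ?b \<tau>)"
    using inta by (simp add: M.smooth_density_fourier[OF X] M'.smooth_density_fourier[OF Y] diff_divide_distrib)
  then have "\<bar>smooth_density M X u - smooth_density M' Y u\<bar> = cmod (1 / sqrt (2 * pi) * (CLINT \<tau>|?N. ?a \<tau> - ?b \<tau>))"
    by (metis norm_of_real)
  also have "\<dots> = 1 / sqrt (2 * pi) * cmod (CLINT \<tau>|?N. ?a \<tau> - ?b \<tau>)"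
    by (simp add: norm_mult norm_divide)
  also have "\<dots> \<le> 1 * cmod (CLINT \<tau>|?N. ?a \<tau> - ?b \<tau>)"
    using pi_gt3 by (intro mult_right_mono) auto
  also have "\<dots> \<le> 1 * (LINT \<tau>|?N. cmod (?a \<tau> - ?b \<tau>))"
    by (intro mult_left_mono integral_norm_bound) auto
  also have "\<dots> \<le> 1 * (LINT \<tau>|?N. \<delta> + 2 * indicator {\<tau>. \<bar>\<tau>\<bar> > A} \<tau>)"
    using inta intind by (intro mult_left_mono integral_mono bound) auto
  also have "\<dots> = \<delta> + 2 * (LINT \<tau>|?N. indicator {\<tau>. \<bar>\<tau>\<bar> > A} \<tau>)"
    using intind N.prob_space by simp
  also have "\<dots> \<le> \<delta> + 2 * (2 * exp (- A\<^sup>2 / 4))"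
    using std_normal_outside_le[OF \<open>0 \<le> A\<close>] by simp
  finally show ?thesis by simp
qed

text \<open>Closeness of densities is integrated only up to \<open>w\<close>; beyond \<open>w\<close> Chebyshev's inequality
  suffices, as \<open>w\<close> may be chosen exponentially large in \<open>loglog T\<close>.\<close>

lemma smooth_tail_close:
  assumes "prob_space M" "prob_space M'"
    and X [measurable]: "X \<in> borel_measurable M" and Y [measurable]: "Y \<in> borel_measurable M'"
    and X2: "integrable M (\<lambda>\<omega>. (X \<omega>)\<^sup>2)" and Y2: "integrable M' (\<lambda>\<omega>. (Y \<omega>)\<^sup>2)"
    and vw: "v \<le> w" "0 < w"
    and close: "\<And>u. \<bar>smooth_density M X u - smooth_density M' Y u\<bar> \<le> \<delta>"
  shows "\<bar>smooth_tail M X v - smooth_tail M' Y v\<bar> \<le> (w - v) * \<delta> +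
     4 * ((\<integral>\<omega>. (X \<omega>)\<^sup>2 \<partial>M) + (\<integral>\<omega>. (Y \<omega>)\<^sup>2 \<partial>M') + 2) / w\<^sup>2"
proof -
  interpret M: prob_space M by fact
  interpret M': prob_space M' by fact
  note X = M.smooth_tail_diff[OF X vw(1)] and Y = M'.smooth_tail_diff[OF Y vw(1)]
  have "\<bar>(smooth_tail M X v - smooth_tail M X w) - (smooth_tail M' Y v - smooth_tail M' Y w)\<bar>
     = \<bar>LBINT u:{v..<w}. smooth_density M X u - smooth_density M' Y u\<bar>"
    unfolding X(1) Y(1) using X(2) Y(2) by (subst set_integral_diff) auto
  also have "\<dots> \<le> (LBINT u:{v..<w}. \<bar>smooth_density M X u - smooth_density M' Y u\<bar>)"
    using set_integral_diff(1)[OF X(2) Y(2)] by (intro set_integral_norm_bound[where 'a = real, simplified]) auto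
  also have "\<dots> \<le> (LBINT u:{v..<w}. \<delta>)"
    using set_integral_diff(1)[OF X(2) Y(2)] close
    by (intro set_integral_mono set_integrable_abs set_integrable_const_Ico) auto
  also have "\<dots> = (w - v) * \<delta>" using vw by (simp add: set_lebesgue_integral_def)
  finally have 1: "\<bar>(smooth_tail M X v - smooth_tail M X w) - (smooth_tail M' Y v - smooth_tail M' Y w)\<bar> \<le> (w - v) * \<delta>" .
  have "0 \<le> smooth_tail M X w" "0 \<le> smooth_tail M' Y w"
    by (auto simp: smooth_tail_def normal_tail_nonneg)
  moreover note M.smooth_tail_chebyshev[OF assms(3) X2 vw(2)] M'.smooth_tail_chebyshev[OF assms(4) Y2 vw(2)]
  ultimately show ?thesis using 1 by (simp add: field_simps add_divide_distrib abs_if split: if_splits)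
qed

section \<open>A uniform angle and the Bessel function of order zero\<close>

lemma uniform_interval_integral:
  fixes f :: "real \<Rightarrow> complex"
  assumes "a < b" and [measurable]: "f \<in> borel_measurable borel"
  shows "integral\<^sup>L (uniform_measure lborel {a..b}) f = (1 / (b - a)) *\<^sub>R (LBINT x:{a..b}. f x)"
proof -
  have "uniform_measure lborel {a..b} = density lborel (\<lambda>x. ennreal (1 / (b - a) * indicator {a..b} x))"
    unfolding uniform_measure_def using assms
    by (intro density_cong) (auto simp: indicator_def divide_ennreal[symmetric] ennreal_1[symmetric] simp del: ennreal_1)
  then have "integral\<^sup>L (uniform_measure lborel {a..b}) f = (LINT x|lborel. (1 / (b - a) * indicator {a..b} x) *\<^sub>R f x)"
    using assms by (simp only:) (subst integral_density, auto)
  also have "\<dots> = (1 / (b - a)) *\<^sub>R (LBINT x:{a..b}. f x)"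
    unfolding set_lebesgue_integral_def integral_scaleR_right[symmetric] by (simp add: mult_ac)
  finally show ?thesis .
qed

definition angle :: "real measure" where
  "angle = uniform_measure lborel {0..2 * pi}"

lemma prob_space_angle: "prob_space angle"
  unfolding angle_def by (rule prob_space_uniform_measure) auto

lemma sets_angle [measurable_cong, simp]: "sets angle = sets borel"
  by (simp add: angle_def)

lemma space_angle [simp]: "space angle = UNIV"
  by (simp add: angle_def)

interpretation angle: prob_space angle by (rule prob_space_angle)

lemma angle_integral:
  fixes f :: "real \<Rightarrow> complex"
  assumes "continuous_on UNIV f"
  shows "integral\<^sup>L angle f = (1 / (2 * pi)) *\<^sub>R (LBINT x:{0..2*pi}. f x)"
  using uniform_interval_integral[of 0 "2 * pi" f] borel_measurable_continuous_onI[OF assms]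
  by (simp add: angle_def)

lemma angle_iexp: "(CLINT x|angle. iexp (of_int m * x)) = (if m = 0 then 1 else 0)"
proof (cases "m = 0")
  case False
  let ?F = "\<lambda>x. exp (\<i> * (of_int m * complex_of_real x)) / (\<i> * of_int m)"
  have "(LBINT x=ereal 0..ereal (2*pi). exp (\<i> * (of_int m * complex_of_real x))) = ?F (2*pi) - ?F 0"
  proof (rule interval_integral_FTC_finite)
    fix x
    have "((\<lambda>z. exp (\<i> * (of_int m * z)) / (\<i> * of_int m)) has_field_derivative exp (\<i> * (of_int m * complex_of_real x)))
        (at (complex_of_real x))"
      using False by (auto intro!: derivative_eq_intros simp: mult.commute[of _ \<i>])
    then show "(?F has_vector_derivative exp (\<i> * (of_int m * complex_of_real x))) (at x within {min 0 (2*pi)..max 0 (2*pi)})"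
      by (intro has_vector_derivative_real_field)
  qed (auto intro!: continuous_intros)
  also have "\<dots> = 0"
    using exp_integer_2pi[of "of_int m"] by (simp add: mult_ac)
  finally show ?thesis using False
    by (subst angle_integral)
      (auto intro!: continuous_intros simp: interval_integral_Icc zero_ereal_def)
qed (simp add: angle.prob_space[simplified])

text \<open>The modified Bessel function of the first kind and order zero.\<close>

definition bessel_I0 :: "complex \<Rightarrow> complex" where
  "bessel_I0 z = (CLINT x|angle. exp (z * complex_of_real (cos x)))"

lemma integrable_angle_bounded:
  fixes f :: "real \<Rightarrow> 'b :: {banach, second_countable_topology}"
  assumes "f \<in> borel_measurable borel" "\<And>x. norm (f x) \<le> B"
  shows "integrable angle f"
  by (rule angle.integrable_const_bound[where B = B]) (use assms in auto)

lemma cos_le_exp_abs: "exp (s * cos x) \<le> exp \<bar>s :: real\<bar>"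
  using mult_mono[of "\<bar>s\<bar>" "\<bar>s\<bar>" "\<bar>cos x\<bar>" 1] abs_le_D1[of "s * cos x"] by (simp add: abs_mult)

lemma integrable_exp_cos: "integrable angle (\<lambda>x. exp (z * complex_of_real (cos x)))"
  using cos_le_exp_abs by (intro integrable_angle_bounded[where B = "exp \<bar>Re z\<bar>"]) auto

lemma integrable_exp_cos_real: "integrable angle (\<lambda>x. exp (s * cos x))"
  using cos_le_exp_abs by (intro integrable_angle_bounded[where B = "exp \<bar>s\<bar>"]) auto

lemma angle_cos_moments:
  "(LINT x|angle. cos x) = 0" "(LINT x|angle. (cos x)^2) = 1/2" "(LINT x|angle. (cos x)^3) = 0"
proof -
  define E where "E m x = iexp (of_int m * x)" for m x
  have i: "integrable angle (E m)" for m
    unfolding E_def by (intro integrable_angle_bounded[where B = 1]) auto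
  have I: "(CLINT x|angle. E m x) = (if m = 0 then 1 else 0)" for m
    unfolding E_def by (rule angle_iexp)
  have mult: "E m x * E n x = E (m + n) x" for m n x
    by (simp add: E_def exp_add[symmetric] algebra_simps)
  have c: "complex_of_real (cos x) = (E 1 x + E (-1) x) / 2" for x
    by (simp add: E_def cos_exp_eq cos_of_real[symmetric] del: cos_of_real)
  have c2: "complex_of_real ((cos x)^2) = E 2 x / 4 + E (-2) x / 4 + E 0 x / 2" for x
    unfolding of_real_power c by (simp add: power2_eq_square mult field_simps)
  have c3: "complex_of_real ((cos x)^3) = E 3 x / 8 + E (-3) x / 8 + 3/8 * E 1 x + 3/8 * E (-1) x" for x
    unfolding of_real_power c
    by (simp add: power3_eq_cube mult distrib_left distrib_right add_divide_distrib)
  have "complex_of_real (LINT x|angle. cos x) = 0"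
    unfolding integral_complex_of_real[symmetric] c using i by (simp add: I)
  then show "(LINT x|angle. cos x) = 0" by simp
  have "complex_of_real (LINT x|angle. (cos x)^2) = 1/2"
    unfolding integral_complex_of_real[symmetric] c2 using i by (simp add: I)
  then have "complex_of_real (LINT x|angle. (cos x)^2) = complex_of_real (1/2)" by simp
  then show "(LINT x|angle. (cos x)^2) = 1/2" unfolding of_real_eq_iff .
  have "complex_of_real (LINT x|angle. (cos x)^3) = 0"
    unfolding integral_complex_of_real[symmetric] c3 using i by (simp add: I)
  then show "(LINT x|angle. (cos x)^3) = 0" by simp
qed

lemma exp_taylor4: "norm (exp w - (1 + w + w^2/2 + w^3/6)) \<le> norm w ^ 4" if "norm w \<le> 1" for w :: complex
proof -
  have "exp (norm w) \<le> exp 1" using that by simp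
  also have "\<dots> \<le> (6 :: real)" using exp_le by simp
  finally have "exp (norm w) * norm w ^ 4 \<le> 6 * norm w ^ 4" by (intro mult_right_mono) auto
  moreover have "norm (exp w - (1 + w + w^2/2 + w^3/6)) \<le> exp (norm w) * norm w ^ 4 / 6"
    using Taylor_exp_field[of w 3] by (simp add: eval_nat_numeral mult_ac)
  ultimately show ?thesis by simp
qed

lemma bessel_I0_taylor: "norm (bessel_I0 w - (1 + w^2/4)) \<le> norm w ^ 4" if "norm w \<le> 1"
proof -
  let ?T = "\<lambda>x. 1 + w * complex_of_real (cos x) + w^2/2 * complex_of_real ((cos x)^2) + w^3/6 * complex_of_real ((cos x)^3)"
  have i: "integrable angle (\<lambda>x. complex_of_real ((cos x)^k))" for k
    by (intro integrable_angle_bounded[where B = 1]) (auto simp: norm_power power_le_one)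
  have iT: "integrable angle ?T"
    using i[of 1] i[of 2] i[of 3] by (intro Bochner_Integration.integrable_add integrable_mult_right) auto
  have T: "(CLINT x|angle. ?T x) = 1 + w^2/4"
    using i[of 1] i[of 2] i[of 3]
    by (simp add: angle_cos_moments angle.prob_space[simplified] del: of_real_power)
  have "bessel_I0 w - (1 + w^2/4) = (CLINT x|angle. exp (w * complex_of_real (cos x)) - ?T x)"
    unfolding bessel_I0_def T[symmetric] using integrable_exp_cos iT by simp
  then have "norm (bessel_I0 w - (1 + w^2/4)) \<le> (LINT x|angle. norm (exp (w * complex_of_real (cos x)) - ?T x))"
    using integral_norm_bound by (simp only:)
  also have "\<dots> \<le> (LINT x|angle. norm w ^ 4)"
  proof (rule integral_mono)
    show "integrable angle (\<lambda>x. norm (exp (w * complex_of_real (cos x)) - ?T x))"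
      by (rule integrable_norm[OF Bochner_Integration.integrable_diff[OF integrable_exp_cos iT]])
    show "integrable angle (\<lambda>x. norm w ^ 4)" by simp
    fix x
    have "norm (w * complex_of_real (cos x)) \<le> norm w"
      by (simp add: norm_mult mult_left_le)
    then have "norm (exp (w * complex_of_real (cos x)) - ?T x) \<le> norm (w * complex_of_real (cos x)) ^ 4"
      using exp_taylor4[of "w * complex_of_real (cos x)"] that by (simp add: power_mult_distrib)
    also have "\<dots> \<le> norm w ^ 4"
      using \<open>norm (w * complex_of_real (cos x)) \<le> norm w\<close> by (intro power_mono) auto
    finally show "norm (exp (w * complex_of_real (cos x)) - ?T x) \<le> norm w ^ 4" .
  qed
  also have "\<dots> = norm w ^ 4" by (simp add: angle.prob_space[simplified])
  finally show ?thesis .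
qed

text \<open>The odd moments of a cosine vanish and its second moment is \<open>1/2\<close>, so that \<open>bessel_I0 w\<close> and
  \<open>exp (w\<^sup>2 / 4)\<close> have the same Taylor polynomial of degree 3.\<close>

lemma bessel_I0_gaussian: "norm (bessel_I0 w * exp (- (w^2/4)) - 1) \<le> 4 * norm w ^ 4" if "norm w \<le> 1"
proof -
  let ?n = "norm w ^ 4" and ?g = "exp (- (w^2/4))"
  define r where "r = bessel_I0 w - (1 + w^2/4)"
  define q where "q = ?g - (1 - w^2/4)"
  have w2: "norm (w^2/4) \<le> 1/4"
    using that by (simp add: norm_divide norm_power power_le_one)
  have ring: "J * g - 1 = (J - (1 + a)) * g + (1 + a) * (g - (1 - a)) - a^2" for J g a :: complex
    by (simp add: algebra_simps power2_eq_square)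
  have "(w^2/4)^2 = w^4/16" by (simp add: power_divide flip: power_mult)
  then have "bessel_I0 w * ?g - 1 = r * ?g + (1 + w^2/4) * q - w^4/16"
    unfolding r_def q_def using ring[of "bessel_I0 w" ?g "w^2/4"] by (simp only:)
  also have "norm \<dots> \<le> norm r * norm ?g + norm (1 + w^2/4) * norm q + norm (w^4/16)"
    using norm_triangle_ineq4[of "r * ?g + (1 + w^2/4) * q" "w^4/16"]
      norm_triangle_ineq[of "r * ?g" "(1 + w^2/4) * q"] unfolding norm_mult by linarith
  also have "\<dots> \<le> ?n * 2 + (5/4) * (?n / 2) + ?n / 16"
  proof (intro add_mono mult_mono)
    show "norm r \<le> ?n" unfolding r_def using bessel_I0_taylor[OF that] .
    have e2: "exp (norm (- (w^2/4))) \<le> 2"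
    proof -
      have "exp (norm (- (w^2/4))) \<le> exp (1/4)" using w2 by (simp only: norm_minus_cancel exp_le_cancel_iff)
      also have "\<dots> \<le> 2" by (rule order_trans[OF exp_bound]) (auto simp: power2_eq_square)
      finally show ?thesis .
    qed
    show "norm ?g \<le> 2" using norm_exp[of "- (w^2/4)"] e2 by linarith
    have "norm q \<le> exp (norm (- (w^2/4))) * norm (- (w^2/4)) ^ 2"
      unfolding q_def using Taylor_exp_field[of "- (w^2/4)" 1] by (simp add: power2_eq_square)
    also have "\<dots> \<le> 2 * norm (- (w^2/4)) ^ 2"
      using e2 by (intro mult_right_mono) auto
    also have "\<dots> = ?n / 8"
      by (simp add: norm_divide norm_power power_divide flip: power_mult)
    also have "\<dots> \<le> ?n / 2" by simp
    finally show "norm q \<le> ?n / 2" .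
    show "norm (1 + w^2/4) \<le> 5/4"
      using norm_triangle_ineq[of 1 "w^2/4"] w2 by simp
  qed (auto simp: norm_divide norm_power)
  also have "\<dots> \<le> 4 * ?n" by simp
  finally show ?thesis .
qed

text \<open>Hoeffding's lemma for a centred variable with values in \<open>[-1, 1]\<close>.\<close>

lemma angle_mgf_le: "(LINT x|angle. exp (s * cos x)) \<le> exp (s\<^sup>2 / 2)"
proof (cases "s = 0")
  case True
  then show ?thesis by (simp add: angle.prob_space[simplified])
next
  case False
  interpret interval_bounded_random_variable angle "\<lambda>x. sgn s * cos x" "-1" 1
    by unfold_locales (use False in \<open>auto simp: sgn_if\<close>)
  have eq: "\<bar>s\<bar> * (sgn s * cos x) = s * cos x" for x
    by (auto simp: abs_if sgn_if)
  have "(\<integral>\<^sup>+x. ennreal (exp (s * cos x)) \<partial>angle) \<le> ennreal (exp (\<bar>s\<bar>\<^sup>2 * (1 - (-1))\<^sup>2 / 8))"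
    using Hoeffdings_lemma_nn_integral_0[of "\<bar>s\<bar>"] False unfolding eq by (simp add: angle_cos_moments)
  then have "ennreal (LINT x|angle. exp (s * cos x)) \<le> ennreal (exp (s\<^sup>2 / 2))"
    by (subst (asm) nn_integral_eq_integral[OF integrable_exp_cos_real]) auto
  then show ?thesis by (subst (asm) ennreal_le_iff) auto
qed

lemma norm_bessel_I0_le: "norm (bessel_I0 z) \<le> (LINT x|angle. exp (Re z * cos x))"
  using integral_norm_bound[of angle "\<lambda>x. exp (z * complex_of_real (cos x))"]
  unfolding bessel_I0_def norm_exp_eq_Re by (simp del: cos_of_real)

section \<open>Random phases and the moments of the prime sum\<close>

definition cos_sum :: "nat set \<Rightarrow> (nat \<Rightarrow> real) \<Rightarrow> real" where
  "cos_sum S a = (\<Sum>p\<in>S. cos (a p) / sqrt (real p))"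

lemma Re_prime_dirichlet_poly:
  "Re (prime_dirichlet_poly x t) = cos_sum (primes_upto x) (\<lambda>p. t * ln (real p))"
proof -
  have "Re (1 / (of_nat p :: complex) powr (1/2 + \<i> * complex_of_real t)) = cos (t * ln (real p)) / sqrt (real p)"
    if "p \<in> primes_upto x" for p
  proof -
    have p: "0 < p" using that by (auto simp: primes_upto_def prime_gt_0_nat)
    then have Ln: "Ln (of_nat p) = complex_of_real (ln (real p))"
      by (metis Ln_of_real of_nat_0_less_iff of_real_of_nat_eq)
    have "1 / (of_nat p :: complex) powr (1/2 + \<i> * complex_of_real t) =
        exp (- ((1/2 + \<i> * complex_of_real t) * complex_of_real (ln (real p))))"
      using p by (simp add: powr_def Ln exp_minus inverse_eq_divide)
    also have "Re \<dots> = exp (- (ln (real p) / 2)) * cos (t * ln (real p))"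
      by (simp add: Re_exp)
    also have "exp (- (ln (real p) / 2)) = 1 / sqrt (real p)"
      using p by (simp add: exp_minus inverse_eq_divide powr_half_sqrt[symmetric] powr_def)
    finally show ?thesis by simp
  qed
  then show ?thesis by (simp add: prime_dirichlet_poly_def cos_sum_def)
qed

text \<open>Independent uniform angles, one for each element of \<open>S\<close>.\<close>

definition random_phases :: "nat set \<Rightarrow> (nat \<Rightarrow> real) measure" where
  "random_phases S = PiM S (\<lambda>_. angle)"

interpretation angles: product_prob_space "\<lambda>_::nat. angle" UNIV
  by unfold_locales

lemma prob_space_random_phases: "prob_space (random_phases S)"
  unfolding random_phases_def by (rule prob_space_PiM) (rule prob_space_angle)

lemma random_phases_component:
  "p \<in> S \<Longrightarrow> (\<lambda>\<theta>. \<theta> p) \<in> borel_measurable (random_phases S)"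
  unfolding random_phases_def using measurable_component_singleton[of p S "\<lambda>_. angle"]
  by (simp add: measurable_def)

lemma cos_sum_measurable [measurable]: "cos_sum S \<in> borel_measurable (random_phases S)"
proof -
  note random_phases_component [measurable]
  have "(\<lambda>\<theta>. \<Sum>p\<in>S. cos (\<theta> p) / sqrt (real p)) \<in> borel_measurable (random_phases S)"
    by (intro borel_measurable_sum) measurable
  then show ?thesis by (simp add: cos_sum_def[abs_def])
qed

lemma abs_cos_sum_le: "\<bar>cos_sum S a\<bar> \<le> (\<Sum>p\<in>S. 1 / sqrt (real p))"
  unfolding cos_sum_def by (rule order_trans[OF sum_abs]) (auto intro!: sum_mono divide_right_mono)

lemma random_phases_integral_prod:
  fixes f :: "nat \<Rightarrow> real \<Rightarrow> 'b :: {real_normed_field, banach, second_countable_topology}"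
  assumes "finite S" "\<And>p. p \<in> S \<Longrightarrow> integrable angle (f p)"
  shows "(\<integral>\<theta>. (\<Prod>p\<in>S. f p (\<theta> p)) \<partial>random_phases S) = (\<Prod>p\<in>S. integral\<^sup>L angle (f p))"
  unfolding random_phases_def by (rule angles.product_integral_prod) (use assms in auto)

lemma random_phases_mgf:
  assumes "finite S"
  shows "(CLINT \<theta>|random_phases S. exp (z * complex_of_real (cos_sum S \<theta>))) = (\<Prod>p\<in>S. bessel_I0 (z / sqrt (real p)))"
proof -
  have "(CLINT \<theta>|random_phases S. exp (z * complex_of_real (cos_sum S \<theta>))) =
     (CLINT \<theta>|random_phases S. (\<Prod>p\<in>S. exp (z / sqrt (real p) * complex_of_real (cos (\<theta> p)))))"
    using assms by (simp add: cos_sum_def exp_sum[symmetric] sum_distrib_left del: cos_of_real)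
  also have "\<dots> = (\<Prod>p\<in>S. bessel_I0 (z / sqrt (real p)))"
    unfolding bessel_I0_def by (rule random_phases_integral_prod[OF assms integrable_exp_cos])
  finally show ?thesis .
qed

lemma random_phases_mgf_real:
  assumes "finite S"
  shows "(LINT \<theta>|random_phases S. exp (s * cos_sum S \<theta>)) =
     (\<Prod>p\<in>S. LINT x|angle. exp (s / sqrt (real p) * cos x))"
proof -
  have "(LINT \<theta>|random_phases S. exp (s * cos_sum S \<theta>)) =
     (LINT \<theta>|random_phases S. (\<Prod>p\<in>S. exp (s / sqrt (real p) * (cos (\<theta> p)))))"
    using assms by (simp add: cos_sum_def exp_sum[symmetric] sum_distrib_left)
  also have "\<dots> = (\<Prod>p\<in>S. LINT x|angle. exp (s / sqrt (real p) * cos x))"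
    by (rule random_phases_integral_prod[OF assms integrable_exp_cos_real])
  finally show ?thesis .
qed

lemma random_phases_mgf_le:
  assumes "finite S"
  shows "(LINT \<theta>|random_phases S. exp (s * cos_sum S \<theta>)) \<le> exp (s\<^sup>2 / 2 * (\<Sum>p\<in>S. 1 / real p))"
proof -
  have "(LINT \<theta>|random_phases S. exp (s * cos_sum S \<theta>)) \<le> (\<Prod>p\<in>S. exp ((s / sqrt (real p))\<^sup>2 / 2))"
    unfolding random_phases_mgf_real[OF assms]
    by (intro prod_mono conjI angle_mgf_le integral_nonneg_AE) auto
  also have "\<dots> = exp (s\<^sup>2 / 2 * (\<Sum>p\<in>S. 1 / real p))"
    using assms by (simp add: exp_sum[symmetric] sum_distrib_left power_divide mult.commute)
  finally show ?thesis .
qed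

lemma random_phases_iexp:
  assumes "finite S"
  shows "(CLINT \<theta>|random_phases S. iexp (\<Sum>p\<in>S. of_int (m p) * \<theta> p)) = (if \<forall>p\<in>S. m p = 0 then 1 else 0)"
proof -
  have "(CLINT \<theta>|random_phases S. iexp (\<Sum>p\<in>S. of_int (m p) * \<theta> p)) =
     (CLINT \<theta>|random_phases S. (\<Prod>p\<in>S. iexp (of_int (m p) * \<theta> p)))"
    using assms by (simp add: exp_sum[symmetric] sum_distrib_left)
  also have "\<dots> = (\<Prod>p\<in>S. CLINT x|angle. iexp (of_int (m p) * x))"
    by (rule random_phases_integral_prod) (use assms in \<open>auto intro!: integrable_angle_bounded[where B = 1]\<close>)
  also have "\<dots> = (if \<forall>p\<in>S. m p = 0 then 1 else 0)"
    unfolding angle_iexp using assms by auto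
  finally show ?thesis .
qed

text \<open>A word of length \<open>k\<close> lists the choices made when expanding
  \<open>(\<Sum> (exp (i a\<^sub>p) + exp (- i a\<^sub>p)) / (2 sqrt p)) ^ k\<close>: the letter \<open>(p, e)\<close>, with \<open>e = \<plusminus>1\<close>, stands for
  \<open>exp (i e a\<^sub>p)\<close>.  For \<open>a\<^sub>p = t ln p\<close> the word represents the \<open>it\<close>-th power of the rational number
  \<open>\<Prod> p powr e\<close>, and \<open>word_exponent\<close> gives the exponent of \<open>p\<close> in this number.\<close>

definition words :: "nat \<Rightarrow> nat set \<Rightarrow> (nat \<Rightarrow> nat \<times> int) set" where
  "words k S = PiE {..<k} (\<lambda>_. S \<times> {1, -1})"

definition word_weight :: "nat \<Rightarrow> (nat \<Rightarrow> nat \<times> int) \<Rightarrow> real" where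
  "word_weight k g = (\<Prod>i<k. 1 / (2 * sqrt (real (fst (g i)))))"

definition word_exponent :: "nat \<Rightarrow> (nat \<Rightarrow> nat \<times> int) \<Rightarrow> nat \<Rightarrow> int" where
  "word_exponent k g p = (\<Sum>i\<in>{i. i < k \<and> fst (g i) = p}. snd (g i))"

lemma word_exponent_sum:
  fixes a :: "nat \<Rightarrow> real"
  assumes "finite S" "g \<in> words k S"
  shows "(\<Sum>i<k. of_int (snd (g i)) * a (fst (g i))) = (\<Sum>p\<in>S. of_int (word_exponent k g p) * a p)"
proof -
  have "(\<Sum>p\<in>S. \<Sum>i\<in>{i \<in> {..<k}. fst (g i) = p}. of_int (snd (g i)) * a (fst (g i))) =
      (\<Sum>i<k. of_int (snd (g i)) * a (fst (g i)))"
    by (rule sum.group) (use assms in \<open>force simp: words_def PiE_def Pi_def\<close>)+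
  then show ?thesis
    by (simp add: word_exponent_def sum_distrib_right)
qed

lemma cos_sum_power_expand:
  assumes "finite S"
  shows "complex_of_real (cos_sum S a ^ k) = (\<Sum>g\<in>words k S.
     complex_of_real (word_weight k g) * iexp (\<Sum>p\<in>S. of_int (word_exponent k g p) * a p))"
proof -
  let ?f = "\<lambda>(p, e::int). complex_of_real (1 / (2 * sqrt (real p))) * iexp (of_int e * a p)"
  have "complex_of_real (cos (a p) / sqrt (real p)) = (\<Sum>e\<in>{1, -1}. ?f (p, e))" for p
    by (simp add: cos_exp_eq cos_of_real[symmetric] add_divide_distrib mult.commute del: cos_of_real)
  then have "complex_of_real (cos_sum S a) = (\<Sum>p\<in>S. \<Sum>e\<in>{1,-1}. ?f (p, e))"
    unfolding cos_sum_def of_real_sum by (intro sum.cong refl)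
  also have "\<dots> = (\<Sum>x\<in>S \<times> {1, -1}. ?f x)"
    by (simp only: sum.cartesian_product) (simp add: case_prod_unfold)
  finally have "complex_of_real (cos_sum S a ^ k) = (\<Prod>i<k. \<Sum>x\<in>S \<times> {1, -1}. ?f x)"
    by simp
  also have "\<dots> = (\<Sum>g\<in>words k S. \<Prod>i<k. ?f (g i))"
    unfolding words_def using assms by (intro prod_sum_PiE) auto
  also have "\<dots> = (\<Sum>g\<in>words k S. complex_of_real (word_weight k g) *
      iexp (\<Sum>i<k. of_int (snd (g i)) * a (fst (g i))))"
    by (intro sum.cong refl)
      (simp add: case_prod_unfold word_weight_def exp_sum sum_distrib_left flip: prod.distrib)
  also have "\<dots> = (\<Sum>g\<in>words k S.
     complex_of_real (word_weight k g) * iexp (\<Sum>p\<in>S. of_int (word_exponent k g p) * a p))"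
    by (intro sum.cong refl) (simp only: word_exponent_sum[OF assms])
  finally show ?thesis .
qed

lemma sum_word_weight:
  assumes "finite S"
  shows "(\<Sum>g\<in>words k S. word_weight k g) = (\<Sum>p\<in>S. 1 / sqrt (real p)) ^ k"
proof -
  have "(\<Sum>p\<in>S. 1 / sqrt (real p)) = (\<Sum>x\<in>S \<times> {1, -1::int}. 1 / (2 * sqrt (real (fst x))))"
  proof -
    have "(\<Sum>x\<in>S \<times> {1, -1::int}. 1 / (2 * sqrt (real (fst x)))) =
        (\<Sum>p\<in>S. \<Sum>e\<in>{1, -1::int}. 1 / (2 * sqrt (real p)))"
      by (simp only: sum.cartesian_product case_prod_unfold)
    then show ?thesis by simp
  qed
  then have "(\<Sum>p\<in>S. 1 / sqrt (real p)) ^ k = (\<Prod>i<k. \<Sum>x\<in>S \<times> {1, -1::int}. 1 / (2 * sqrt (real (fst x))))"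
    by simp
  also have "\<dots> = (\<Sum>g\<in>words k S. word_weight k g)"
    unfolding words_def word_weight_def using assms by (intro prod_sum_PiE) auto
  finally show ?thesis ..
qed

text \<open>The frequency is \<open>ln (a / b)\<close> for positive integers \<open>a, b \<le> x ^ k\<close>, which are distinct by unique
  factorisation unless all exponents vanish.  Distinct integers differ by at least 1, and so \<open>\<bar>ln (a / b)\<bar> \<ge> 1 / x ^ k\<close>.\<close>

lemma word_frequency_lower:
  assumes "g \<in> words k S" "\<And>p. p \<in> S \<Longrightarrow> prime p" "\<And>p. p \<in> S \<Longrightarrow> real p \<le> x" "1 \<le> x" "finite S"
    and "\<exists>p\<in>S. word_exponent k g p \<noteq> 0"
  shows "1 / x ^ k \<le> \<bar>\<Sum>p\<in>S. of_int (word_exponent k g p) * ln (real p)\<bar>"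
proof -
  define I where "I e = {i. i < k \<and> snd (g i) = e}" for e :: int
  define N where "N e = (\<Prod>i\<in>I e. fst (g i))" for e
  have g: "fst (g i) \<in> S" "snd (g i) = 1 \<or> snd (g i) = -1" if "i < k" for i
    using assms(1) that by (auto simp: words_def PiE_def Pi_def mem_Times_iff)
  have finI [simp]: "finite (I e)" for e by (simp add: I_def)
  have prI: "prime (fst (g i))" if "i \<in> I e" for i e
    using g assms(2) that by (auto simp: I_def)
  have Npos: "0 < N e" for e unfolding N_def using prI prime_gt_0_nat by (intro prod_pos) auto
  have split: "{..<k} = I 1 \<union> I (-1)" "I 1 \<inter> I (-1) = {}" using g by (auto simp: I_def)
  have Nle: "real (N e) \<le> x ^ k" for e
  proof -
    have "real (N e) \<le> (\<Prod>i\<in>I e. x)"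
      unfolding N_def of_nat_prod using g assms(3) by (intro prod_mono) (auto simp: I_def)
    also have "\<dots> = x ^ card (I e)" by simp
    also have "\<dots> \<le> x ^ k"
      using assms(4) card_mono[of "{..<k}" "I e"] by (intro power_increasing) (auto simp: I_def)
    finally show ?thesis .
  qed
  have lnN: "ln (real (N e)) = (\<Sum>i\<in>I e. ln (real (fst (g i))))" for e
    unfolding N_def of_nat_prod using prI prime_gt_0_nat by (subst ln_prod) auto
  have "(\<Sum>p\<in>S. of_int (word_exponent k g p) * ln (real p)) = (\<Sum>i<k. of_int (snd (g i)) * ln (real (fst (g i))))"
    by (rule word_exponent_sum[symmetric]) (use assms in auto)
  also have "\<dots> = ln (real (N 1)) - ln (real (N (-1)))"
    unfolding lnN split(1) using split(2) by (subst sum.union_disjoint) (auto simp: I_def sum_negf)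
  finally have eq: "(\<Sum>p\<in>S. of_int (word_exponent k g p) * ln (real p)) = ln (real (N 1)) - ln (real (N (-1)))" .
  have "N 1 \<noteq> N (-1)"
  proof
    assume "N 1 = N (-1)"
    define B where "B e = image_mset (\<lambda>i. fst (g i)) (mset_set (I e))" for e
    have "prime_factorization (N e) = B e" for e
    proof -
      have "prime_factorization (prod_mset (B e)) = B e"
        by (rule prime_factorization_prod_mset_primes) (auto simp: B_def dest: prI)
      then show ?thesis by (simp add: N_def B_def prod_unfold_prod_mset)
    qed
    then have B: "B 1 = B (-1)" using \<open>N 1 = N (-1)\<close> by metis
    have cnt: "count (B e) p = card {i \<in> I e. fst (g i) = p}" for e p
      by (simp add: B_def count_image_mset vimage_def Int_def conj_commute)
    have "word_exponent k g p = 0" for p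
    proof -
      have eq: "{i. i < k \<and> fst (g i) = p} = {i \<in> I 1. fst (g i) = p} \<union> {i \<in> I (-1). fst (g i) = p}"
        using split(1) by (auto simp: I_def)
      have "word_exponent k g p = int (card {i \<in> I 1. fst (g i) = p}) - int (card {i \<in> I (-1). fst (g i) = p})"
      proof -
        have "(\<Sum>i\<in>{i \<in> I e. fst (g i) = p}. snd (g i)) = (\<Sum>i\<in>{i \<in> I e. fst (g i) = p}. e)" for e
          by (intro sum.cong) (auto simp: I_def)
        moreover have "{i \<in> I 1. fst (g i) = p} \<inter> {i \<in> I (-1). fst (g i) = p} = {}"
          using split(2) by auto
        ultimately show ?thesis
          unfolding word_exponent_def eq by (subst sum.union_disjoint) simp_all
      qed
      moreover have "card {i \<in> I 1. fst (g i) = p} = card {i \<in> I (-1). fst (g i) = p}"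
        unfolding cnt[symmetric] B ..
      ultimately show ?thesis by simp
    qed
    then show False using assms by auto
  qed
  moreover have *: "1 / x ^ k \<le> ln (real a) - ln (real b)" if "b < a" "0 < b" "real a \<le> x ^ k" for a b
  proof -
    have "ln (real b / real a) \<le> real b / real a - 1" using that by (intro ln_le_minus_one) auto
    also have "\<dots> = (real b - real a) / real a" using that by (simp add: diff_divide_distrib)
    also have "\<dots> \<le> - 1 / real a" using that by (intro divide_right_mono) auto
    finally have "1 / real a \<le> ln (real a) - ln (real b)" using that by (simp add: ln_div)
    moreover have "1 / x ^ k \<le> 1 / real a" using that by (intro divide_left_mono) auto
    ultimately show ?thesis by linarith
  qed
  moreover have "1 / x ^ k \<le> ln (real (N 1)) - ln (real (N (-1)))" if "N (-1) < N 1"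
    using that Npos Nle * by blast
  moreover have "1 / x ^ k \<le> ln (real (N (-1))) - ln (real (N 1))" if "N 1 < N (-1)"
    using that Npos Nle * by blast
  ultimately show ?thesis unfolding eq by linarith
qed

definition uniform_time :: "real \<Rightarrow> real measure" where
  "uniform_time T = uniform_measure lborel {T..2 * T}"

lemma prob_space_uniform_time: "0 < T \<Longrightarrow> prob_space (uniform_time T)"
  unfolding uniform_time_def by (rule prob_space_uniform_measure) auto

lemma sets_uniform_time [measurable_cong, simp]: "sets (uniform_time T) = sets borel"
  by (simp add: uniform_time_def)

lemma space_uniform_time [simp]: "space (uniform_time T) = UNIV"
  by (simp add: uniform_time_def)

lemma uniform_time_integral:
  fixes f :: "real \<Rightarrow> complex"
  assumes "0 < T" "f \<in> borel_measurable borel"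
  shows "integral\<^sup>L (uniform_time T) f = (1 / T) *\<^sub>R (LBINT x:{T..2*T}. f x)"
  using uniform_interval_integral[of T "2 * T" f] assms by (simp add: uniform_time_def)

lemma uniform_time_iexp:
  assumes "0 < T" "l \<noteq> 0"
  shows "norm (CLINT t|uniform_time T. iexp (t * l)) \<le> 2 / (T * \<bar>l\<bar>)"
proof -
  let ?F = "\<lambda>t. exp (\<i> * (complex_of_real t * complex_of_real l)) / (\<i> * complex_of_real l)"
  have "(LBINT t=ereal T..ereal (2*T). exp (\<i> * (complex_of_real t * complex_of_real l))) = ?F (2*T) - ?F T"
  proof (rule interval_integral_FTC_finite)
    fix t
    have "((\<lambda>z. exp (\<i> * (z * complex_of_real l)) / (\<i> * complex_of_real l)) has_field_derivative
        exp (\<i> * (complex_of_real t * complex_of_real l))) (at (complex_of_real t))"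
      using assms by (auto intro!: derivative_eq_intros simp: mult.commute[of _ \<i>])
    then show "(?F has_vector_derivative exp (\<i> * (complex_of_real t * complex_of_real l))) (at t within {min T (2*T)..max T (2*T)})"
      by (intro has_vector_derivative_real_field)
  qed (auto intro!: continuous_intros)
  then have eq: "(CLINT t|uniform_time T. iexp (t * l)) = (1 / T) *\<^sub>R (?F (2*T) - ?F T)"
    using assms by (subst uniform_time_integral) (auto simp: interval_integral_Icc)
  have nF: "norm (?F t) = 1 / \<bar>l\<bar>" for t
    using norm_exp_i_times[of "t * l"] by (simp add: norm_divide norm_mult)
  have "norm (?F (2*T) - ?F T) \<le> 2 / \<bar>l\<bar>"
    using norm_triangle_ineq4[of "?F (2*T)" "?F T"] nF[of "2*T"] nF[of T] by simp
  then show ?thesis unfolding eq using assms by (simp add: field_simps)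
qed

lemma card_primes_upto_le: "0 \<le> x \<Longrightarrow> real (card (primes_upto x)) \<le> x"
proof -
  assume x: "0 \<le> x"
  have "primes_upto x \<subseteq> {1..nat \<lfloor>x\<rfloor>}"
    using prime_ge_1_nat by (auto simp: primes_upto_def le_nat_floor)
  then have "card (primes_upto x) \<le> nat \<lfloor>x\<rfloor>"
    using card_mono[of "{1..nat \<lfloor>x\<rfloor>}" "primes_upto x"] by simp
  then show ?thesis using x by linarith
qed

lemma sum_inverse_sqrt_primes_le:
  assumes "0 \<le> x" shows "(\<Sum>p\<in>primes_upto x. 1 / sqrt (real p)) \<le> x"
proof -
  have "(\<Sum>p\<in>primes_upto x. 1 / sqrt (real p)) \<le> (\<Sum>p\<in>primes_upto x. 1)"
    using prime_ge_1_nat by (intro sum_mono) (auto simp: primes_upto_def divide_le_eq_1)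
  also have "\<dots> = real (card (primes_upto x))" by simp
  also have "\<dots> \<le> x" by (rule card_primes_upto_le[OF assms])
  finally show ?thesis .
qed

lemma integral_linear_combination:
  fixes f :: "'i \<Rightarrow> 'a \<Rightarrow> complex"
  assumes "\<And>g. integrable M (f g)"
  shows "(CLINT \<omega>|M. (\<Sum>g\<in>I. c g * f g \<omega>)) = (\<Sum>g\<in>I. c g * (CLINT \<omega>|M. f g \<omega>))"
  by (subst Bochner_Integration.integral_sum) (auto intro: integrable_mult_right assms)

text \<open>Word by word: if all exponents vanish, both expectations are 1.  Otherwise the model
  contributes 0, and the mean over \<open>t\<close> is at most \<open>2 / (T \<bar>l\<bar>)\<close>, where \<open>l\<close> is the frequency bounded below in
  \<open>word_frequency_lower\<close>.\<close>

lemma moments_close: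
  assumes "0 < T" "1 \<le> x"
  defines "S \<equiv> primes_upto x"
  shows "\<bar>(LINT t|uniform_time T. cos_sum S (\<lambda>p. t * ln (real p)) ^ k) -
     (LINT \<theta>|random_phases S. cos_sum S \<theta> ^ k)\<bar> \<le> 2 * x ^ (2 * k) / T"
proof -
  interpret U: prob_space "uniform_time T" by (rule prob_space_uniform_time[OF assms(1)])
  interpret R: prob_space "random_phases S" by (rule prob_space_random_phases)
  have fin: "finite S" by (simp add: S_def finite_primes_upto)
  have S: "prime p" "real p \<le> x" if "p \<in> S" for p using that by (auto simp: S_def primes_upto_def)
  let ?m = "\<lambda>g p. of_int (word_exponent k g p) :: real"
  let ?l = "\<lambda>g. \<Sum>p\<in>S. ?m g p * ln (real p)"
  let ?EU = "\<lambda>g. CLINT t|uniform_time T. iexp (t * ?l g)"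
    and ?ER = "\<lambda>g. CLINT \<theta>|random_phases S. iexp (\<Sum>p\<in>S. ?m g p * \<theta> p)"
  let ?MX = "LINT t|uniform_time T. cos_sum S (\<lambda>p. t * ln (real p)) ^ k"
    and ?MR = "LINT \<theta>|random_phases S. cos_sum S \<theta> ^ k"
  have intU: "integrable (uniform_time T) (\<lambda>t. iexp (t * l))" for l
    by (rule U.integrable_const_bound[where B = 1]) (auto simp: norm_exp_i_times)
  have intR: "integrable (random_phases S) (\<lambda>\<theta>. iexp (\<Sum>p\<in>S. ?m g p * \<theta> p))" for g
  proof (rule R.integrable_const_bound[where B = 1])
    have [measurable]: "(\<lambda>\<theta>. \<Sum>p\<in>S. ?m g p * \<theta> p) \<in> borel_measurable (random_phases S)"
      by (intro borel_measurable_sum borel_measurable_times random_phases_component borel_measurable_const)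
    show "(\<lambda>\<theta>. iexp (\<Sum>p\<in>S. ?m g p * \<theta> p)) \<in> borel_measurable (random_phases S)"
      by (rule measurable_compose[where f = "\<lambda>\<theta>. \<Sum>p\<in>S. ?m g p * \<theta> p" and g = "\<lambda>y. iexp y" and N = borel]) measurable
  qed (simp only: norm_exp_i_times, simp)
  have expU: "complex_of_real (cos_sum S (\<lambda>p. t * ln (real p)) ^ k) =
     (\<Sum>g\<in>words k S. complex_of_real (word_weight k g) * iexp (t * ?l g))" for t
    unfolding cos_sum_power_expand[OF fin] by (simp add: sum_distrib_left mult_ac)
  have "complex_of_real ?MX =
     (\<Sum>g\<in>words k S. complex_of_real (word_weight k g) * ?EU g)"
    unfolding integral_complex_of_real[symmetric] expU by (rule integral_linear_combination[OF intU])
  moreover have "complex_of_real ?MR =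
     (\<Sum>g\<in>words k S. complex_of_real (word_weight k g) * ?ER g)"
    unfolding integral_complex_of_real[symmetric] cos_sum_power_expand[OF fin]
    by (rule integral_linear_combination[OF intR])
  ultimately have eq: "complex_of_real (?MX - ?MR) = (\<Sum>g\<in>words k S. complex_of_real (word_weight k g) *
     (?EU g - ?ER g))"
    by (simp add: sum_subtractf right_diff_distrib)
  have each: "norm (?EU g - ?ER g)
      \<le> 2 * x ^ k / T" if g: "g \<in> words k S" for g
  proof (cases "\<forall>p\<in>S. word_exponent k g p = 0")
    case True
    then have "?l g = 0" by simp
    then have "?EU g = 1"
      by (simp add: U.prob_space[simplified])
    moreover have "?ER g = 1"
      using True by (subst random_phases_iexp[OF fin]) simp
    ultimately show ?thesis
      using assms(1,2) by (simp only:) simp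
  next
    case False
    then have R: "?ER g = 0"
      by (subst random_phases_iexp[OF fin]) auto
    have "1 / x ^ k \<le> \<bar>?l g\<bar>"
      using word_frequency_lower[OF g S assms(2) fin] False by blast
    define L where "L = \<bar>?l g\<bar>"
    have "1 / x ^ k \<le> L"
      unfolding L_def by fact
    moreover have x: "0 < x ^ k" using assms(2) by simp
    moreover from x have "0 < 1 / x ^ k" by simp
    ultimately have L: "0 < L" "1 \<le> L * x ^ k"
      by (linarith, simp only: pos_divide_le_eq)
    have "norm (?EU g) \<le> 2 / (T * L)"
      using L unfolding L_def by (intro uniform_time_iexp assms(1)) auto
    also have "\<dots> = 2 / T * (1 / L)" by simp
    also have "\<dots> \<le> 2 / T * x ^ k"
      using L assms(1) by (intro mult_left_mono) (simp_all add: pos_divide_le_eq mult.commute)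
    finally show ?thesis by (simp only: R) simp
  qed
  have w: "0 \<le> word_weight k g" for g by (simp add: word_weight_def prod_nonneg)
  have "\<bar>?MX - ?MR\<bar> =
     norm (\<Sum>g\<in>words k S. complex_of_real (word_weight k g) *
     (?EU g - ?ER g))"
    unfolding eq[symmetric] norm_of_real ..
  also have "\<dots> \<le> (\<Sum>g\<in>words k S. word_weight k g * (2 * x ^ k / T))"
  proof (rule sum_norm_le)
    fix g assume "g \<in> words k S"
    then show "norm (complex_of_real (word_weight k g) * (?EU g -
        ?ER g)) \<le> word_weight k g * (2 * x ^ k / T)"
      unfolding norm_mult using w[of g] by (intro mult_mono each) auto
  qed
  also have "\<dots> = (\<Sum>p\<in>S. 1 / sqrt (real p)) ^ k * (2 * x ^ k / T)"
    unfolding sum_word_weight[OF fin, symmetric] sum_distrib_right ..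
  also have "\<dots> \<le> x ^ k * (2 * x ^ k / T)"
  proof (intro mult_right_mono power_mono)
    show "(\<Sum>p\<in>S. 1 / sqrt (real p)) \<le> x"
      unfolding S_def using assms(2) by (intro sum_inverse_sqrt_primes_le) simp
  qed (use assms(1,2) in \<open>auto intro: sum_nonneg\<close>)
  also have "\<dots> = 2 * x ^ (2 * k) / T" by (simp add: mult_2[of k] power_add)
  finally show ?thesis .
qed

lemma power_div_fact_le_exp:
  fixes y :: real
  shows "y ^ (2 * n) / fact (2 * n) \<le> exp y + exp (- y)"
proof -
  have "y ^ (2 * n) = \<bar>y\<bar> ^ (2 * n)" by (simp add: power_mult)
  then have "y ^ (2 * n) / fact (2 * n) = \<bar>y\<bar> ^ (2 * n) /\<^sub>R fact (2 * n)"
    by (simp only:) (simp add: divide_inverse mult.commute)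
  also have "\<bar>y\<bar> ^ (2 * n) /\<^sub>R fact (2 * n) \<le> (\<Sum>k<Suc (2 * n). \<bar>y\<bar> ^ k /\<^sub>R fact k)"
    by (rule member_le_sum) auto
  also have "\<dots> \<le> exp \<bar>y\<bar>"
    unfolding exp_def by (intro sum_le_suminf summable_exp_generic) auto
  also have "\<dots> \<le> exp y + exp (- y)" by (simp add: abs_if)
  finally show ?thesis .
qed

lemma random_phases_bounded_integrable:
  assumes "continuous_on UNIV f"
  shows "integrable (random_phases S) (\<lambda>\<theta>. f (cos_sum S \<theta>) :: 'b :: {banach, second_countable_topology})"
proof -
  interpret R: prob_space "random_phases S" by (rule prob_space_random_phases)
  define B where "B = (\<Sum>p\<in>S. 1 / sqrt (real p))"
  have "compact (f ` {- B..B})"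
    using assms by (intro compact_continuous_image continuous_on_subset[OF assms]) auto
  then obtain C where C: "\<And>y. y \<in> {- B..B} \<Longrightarrow> norm (f y) \<le> C"
    using compact_imp_bounded[of "f ` {- B..B}"] unfolding bounded_iff by blast
  have "norm (f (cos_sum S \<theta>)) \<le> C" for \<theta>
    using abs_cos_sum_le[of S \<theta>] by (intro C) (auto simp: B_def abs_le_iff)
  moreover have [measurable]: "f \<in> borel_measurable borel"
    using assms by (rule borel_measurable_continuous_onI)
  ultimately show ?thesis
    by (intro R.integrable_const_bound[where B = C]) auto
qed

text \<open>Both \<open>Y\<close> and \<open>-Y\<close> enter, as \<open>y ^ (2 n) / fact (2 n) \<le> exp y + exp (- y)\<close>.\<close>

lemma random_phases_moment_le:
  assumes "finite S" "0 < l"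
  shows "(LINT \<theta>|random_phases S. cos_sum S \<theta> ^ (2 * n)) / fact (2 * n) \<le>
     2 * exp (l\<^sup>2 / 2 * (\<Sum>p\<in>S. 1 / real p)) / l ^ (2 * n)"
proof -
  have i: "integrable (random_phases S) (\<lambda>\<theta>. exp (s * cos_sum S \<theta>))"
      "integrable (random_phases S) (\<lambda>\<theta>. cos_sum S \<theta> ^ k)" for s k
    by (intro random_phases_bounded_integrable continuous_intros)+
  have "l ^ (2 * n) * ((LINT \<theta>|random_phases S. cos_sum S \<theta> ^ (2 * n)) / fact (2 * n)) =
     (LINT \<theta>|random_phases S. (l * cos_sum S \<theta>) ^ (2 * n) / fact (2 * n))"
    using i by (simp add: power_mult_distrib)
  also have "\<dots> \<le> (LINT \<theta>|random_phases S. exp (l * cos_sum S \<theta>) + exp ((- l) * cos_sum S \<theta>))"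
  proof (rule integral_mono)
    show "integrable (random_phases S) (\<lambda>\<theta>. (l * cos_sum S \<theta>) ^ (2 * n) / fact (2 * n))"
      using i by (simp add: power_mult_distrib)
    show "integrable (random_phases S) (\<lambda>\<theta>. exp (l * cos_sum S \<theta>) + exp ((- l) * cos_sum S \<theta>))"
      by (intro Bochner_Integration.integrable_add i)
    show "(l * cos_sum S \<theta>) ^ (2 * n) / fact (2 * n) \<le> exp (l * cos_sum S \<theta>) + exp ((- l) * cos_sum S \<theta>)" for \<theta>
      using power_div_fact_le_exp[of "l * cos_sum S \<theta>" n] by simp
  qed
  also have "\<dots> = (LINT \<theta>|random_phases S. exp (l * cos_sum S \<theta>)) + (LINT \<theta>|random_phases S. exp ((- l) * cos_sum S \<theta>))"
    by (intro Bochner_Integration.integral_add i)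
  also have "\<dots> \<le> exp (l\<^sup>2 / 2 * (\<Sum>p\<in>S. 1 / real p)) + exp (l\<^sup>2 / 2 * (\<Sum>p\<in>S. 1 / real p))"
    using random_phases_mgf_le[OF assms(1), of l] random_phases_mgf_le[OF assms(1), of "- l"] by simp
  finally show ?thesis using assms by (simp add: field_simps)
qed

text \<open>For real frequencies the Taylor remainder of the exponential is bounded by the next term on the
  whole line, so that moments alone control the characteristic function, also where \<open>X\<close> is large.\<close>

lemma char_taylor:
  assumes "prob_space M" and X [measurable]: "X \<in> borel_measurable M" and int: "\<And>k. integrable M (\<lambda>\<omega>. X \<omega> ^ k)"
  shows "norm ((CLINT \<omega>|M. iexp (\<tau> * X \<omega>)) - (\<Sum>k\<le>2 * n + 1. (\<i> * \<tau>) ^ k / fact k * complex_of_real (LINT \<omega>|M. X \<omega> ^ k)))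
     \<le> \<tau> ^ (2 * n + 2) / fact (2 * n + 2) * (LINT \<omega>|M. X \<omega> ^ (2 * n + 2))"
proof -
  let ?P = "\<lambda>\<omega>. \<Sum>k\<le>2 * n + 1. (\<i> * \<tau>) ^ k / fact k * complex_of_real (X \<omega> ^ k)"
    and ?m = "\<Sum>k\<le>2 * n + 1. (\<i> * \<tau>) ^ k / fact k * complex_of_real (LINT \<omega>|M. X \<omega> ^ k)"
  interpret prob_space M by fact
  have i1: "integrable M (\<lambda>\<omega>. iexp (\<tau> * X \<omega>))"
    by (rule integrable_const_bound[where B = 1]) auto
  have i2: "integrable M (\<lambda>\<omega>. \<Sum>k\<le>2 * n + 1. (\<i> * \<tau>) ^ k / fact k * complex_of_real (X \<omega> ^ k))"
    by (intro Bochner_Integration.integrable_sum integrable_mult_right integrable_of_real int)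
  have "?m =
     (CLINT \<omega>|M. \<Sum>k\<le>2 * n + 1. (\<i> * \<tau>) ^ k / fact k * complex_of_real (X \<omega> ^ k))"
    using int by (subst Bochner_Integration.integral_sum) (auto simp del: of_real_power)
  then have "(CLINT \<omega>|M. iexp (\<tau> * X \<omega>)) - ?m =
     (CLINT \<omega>|M. iexp (\<tau> * X \<omega>) - ?P \<omega>)"
    using Bochner_Integration.integral_diff[OF i1 i2] by (simp only:)
  then have "norm ((CLINT \<omega>|M. iexp (\<tau> * X \<omega>)) - ?m)
     \<le> (LINT \<omega>|M. norm (iexp (\<tau> * X \<omega>) - ?P \<omega>))"
    using integral_norm_bound by (simp only:)
  also have "\<dots> \<le> (LINT \<omega>|M. \<tau> ^ (2 * n + 2) / fact (2 * n + 2) * X \<omega> ^ (2 * n + 2))"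
  proof (rule integral_mono)
    show "integrable M (\<lambda>\<omega>. norm (iexp (\<tau> * X \<omega>) - ?P \<omega>))"
      by (rule integrable_norm[OF Bochner_Integration.integrable_diff[OF i1 i2]])
    show "integrable M (\<lambda>\<omega>. \<tau> ^ (2 * n + 2) / fact (2 * n + 2) * X \<omega> ^ (2 * n + 2))"
      by (intro integrable_mult_right int)
    fix \<omega>
    have e: "\<bar>y\<bar> ^ (2 * n + 2) = y ^ (2 * n + 2)" for y :: real
      using power_even_abs[of "2 * n + 2" y] by simp
    have "norm (iexp (\<tau> * X \<omega>) - (\<Sum>k\<le>2 * n + 1. (\<i> * complex_of_real (\<tau> * X \<omega>)) ^ k / fact k))
       \<le> \<bar>\<tau> * X \<omega>\<bar> ^ (2 * n + 2) / fact (2 * n + 2)"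
      using iexp_approx1[of "\<tau> * X \<omega>" "2 * n + 1"] by simp
    then show "norm (iexp (\<tau> * X \<omega>) - ?P \<omega>)
       \<le> \<tau> ^ (2 * n + 2) / fact (2 * n + 2) * X \<omega> ^ (2 * n + 2)"
      unfolding e by (simp add: power_mult_distrib mult_ac)
  qed
  also have "\<dots> = \<tau> ^ (2 * n + 2) / fact (2 * n + 2) * (LINT \<omega>|M. X \<omega> ^ (2 * n + 2))" by simp
  finally show ?thesis .
qed

text \<open>The Taylor polynomials are compared by means of the moments.  For the remainder the moment of
  order \<open>2 n + 2\<close> of the model is bounded by its moment generating function at \<open>l = e A\<close>; then \<open>(A / l) ^ (2 n + 2)\<close> is
  \<open>exp (- (2 n + 2))\<close>, and the assumption on \<open>n\<close>, with \<open>e\<^sup>2 \<le> 9\<close>, says that the subgaussian factor costs at most \<open>exp (n + 1)\<close>.\<close>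

lemma char_close:
  assumes "0 < T" "1 \<le> x" "0 < A" "\<bar>\<tau>\<bar> \<le> A"
  defines "S \<equiv> primes_upto x"
  assumes n: "9 / 2 * A\<^sup>2 * (\<Sum>p\<in>S. 1 / real p) \<le> real n + 1"
  shows "norm ((CLINT t|uniform_time T. iexp (\<tau> * cos_sum S (\<lambda>p. t * ln (real p)))) -
     (CLINT \<theta>|random_phases S. iexp (\<tau> * cos_sum S \<theta>))) \<le> 2 * exp A * x ^ (4 * n + 4) / T + 4 * exp (- real (n + 1))"
proof -
  interpret U: prob_space "uniform_time T" by (rule prob_space_uniform_time[OF assms(1)])
  interpret R: prob_space "random_phases S" by (rule prob_space_random_phases)
  have fin: "finite S" by (simp add: S_def finite_primes_upto)
  define X where "X t = cos_sum S (\<lambda>p. t * ln (real p))" for t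
  define V where "V = (\<Sum>p\<in>S. 1 / real p)"
  have X [measurable]: "X \<in> borel_measurable borel"
    unfolding X_def cos_sum_def by measurable
  have Xle: "\<bar>X t\<bar> \<le> x" for t
    using abs_cos_sum_le[of S] sum_inverse_sqrt_primes_le[of x] assms(2) unfolding X_def S_def
    by (meson order_trans zero_le_one)
  have intX: "integrable (uniform_time T) (\<lambda>t. X t ^ k)" for k
  proof (rule U.integrable_const_bound[where B = "x ^ k"])
    show "AE t in uniform_time T. norm (X t ^ k) \<le> x ^ k"
      using Xle unfolding real_norm_def power_abs by (intro AE_I2 power_mono) auto
  qed measurable
  have intY: "integrable (random_phases S) (\<lambda>\<theta>. cos_sum S \<theta> ^ k)" for k
    by (intro random_phases_bounded_integrable continuous_intros)
  define a where "a k = (LINT t|uniform_time T. X t ^ k)" for k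
  define b where "b k = (LINT \<theta>|random_phases S. cos_sum S \<theta> ^ k)" for k
  define N where "N = 2 * n + 2"
  define \<epsilon> where "\<epsilon> = 2 * x ^ (4 * n + 4) / T"
  have close: "\<bar>a k - b k\<bar> \<le> \<epsilon>" if "k \<le> N" for k
  proof -
    have "\<bar>a k - b k\<bar> \<le> 2 * x ^ (2 * k) / T"
      using moments_close[OF assms(1,2), of k] by (simp add: a_def b_def X_def S_def)
    also have "\<dots> \<le> \<epsilon>"
      unfolding \<epsilon>_def using assms that by (intro divide_right_mono mult_left_mono power_increasing) (auto simp: N_def)
    finally show ?thesis .
  qed
  let ?A = "CLINT t|uniform_time T. iexp (\<tau> * X t)" and ?B = "CLINT \<theta>|random_phases S. iexp (\<tau> * cos_sum S \<theta>)"
  let ?c = "\<lambda>k. (\<i> * complex_of_real \<tau>) ^ k / fact k"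
  define ca where "ca = (\<Sum>k\<le>2 * n + 1. ?c k * complex_of_real (a k))"
  define cb where "cb = (\<Sum>k\<le>2 * n + 1. ?c k * complex_of_real (b k))"
  have nc: "norm (?c k) = \<bar>\<tau>\<bar> ^ k / fact k" for k
    by (simp add: norm_divide norm_mult norm_power)
  have A: "norm (?A - ca) \<le> \<tau> ^ N / fact N * a N"
    unfolding N_def a_def ca_def by (rule char_taylor[OF U.prob_space_axioms _ intX]) measurable
  have B: "norm (?B - cb) \<le> \<tau> ^ N / fact N * b N"
    unfolding N_def b_def cb_def by (rule char_taylor[OF R.prob_space_axioms _ intY]) measurable
  have "norm (ca - cb) \<le> (\<Sum>k\<le>2 * n + 1. \<bar>\<tau>\<bar> ^ k / fact k * \<epsilon>)"
    unfolding ca_def cb_def sum_subtractf[symmetric] right_diff_distrib[symmetric] of_real_diff[symmetric]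
  proof (rule sum_norm_le)
    fix k assume "k \<in> {..2 * n + 1}"
    then show "norm (?c k * complex_of_real (a k - b k)) \<le> \<bar>\<tau>\<bar> ^ k / fact k * \<epsilon>"
      unfolding norm_mult nc norm_of_real using close[of k] by (intro mult_left_mono) (auto simp: N_def)
  qed
  moreover have "\<tau> ^ N / fact N * a N \<le> \<tau> ^ N / fact N * (b N + \<epsilon>)"
  proof (rule mult_left_mono)
    show "a N \<le> b N + \<epsilon>" using close[of N] by linarith
    show "0 \<le> \<tau> ^ N / fact N" by (intro divide_nonneg_nonneg zero_le_even_power) (auto simp: N_def)
  qed
  moreover have "norm (?A - ?B) \<le> norm (?A - ca) + norm (ca - cb) + norm (?B - cb)"
  proof -
    have "norm (u - v) \<le> norm (u - u') + norm (u' - v') + norm (v - v')" for u v u' v' :: complex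
      using norm_triangle_ineq[of "u - u'" "u' - v"] norm_triangle_ineq[of "u' - v'" "v' - v"]
      by (simp add: norm_minus_commute)
    then show ?thesis .
  qed
  ultimately have "norm (?A - ?B) \<le> (\<Sum>k\<le>2 * n + 1. \<bar>\<tau>\<bar> ^ k / fact k * \<epsilon>) + \<tau> ^ N / fact N * \<epsilon> + 2 * (\<tau> ^ N / fact N * b N)"
    using A B unfolding distrib_left by linarith
  also have "(\<Sum>k\<le>2 * n + 1. \<bar>\<tau>\<bar> ^ k / fact k * \<epsilon>) + \<tau> ^ N / fact N * \<epsilon> = (\<Sum>k\<le>N. \<bar>\<tau>\<bar> ^ k / fact k) * \<epsilon>"
    using power_even_abs[of N \<tau>] by (simp add: N_def sum_distrib_right distrib_right)
  also have "(\<Sum>k\<le>N. \<bar>\<tau>\<bar> ^ k / fact k) * \<epsilon> \<le> exp A * \<epsilon>"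
  proof (rule mult_right_mono)
    have "(\<Sum>k\<le>N. \<bar>\<tau>\<bar> ^ k / fact k) = (\<Sum>k\<le>N. \<bar>\<tau>\<bar> ^ k /\<^sub>R fact k)"
      by (simp add: divide_inverse mult.commute)
    also have "\<dots> \<le> exp \<bar>\<tau>\<bar>"
      unfolding exp_def by (intro sum_le_suminf summable_exp_generic) auto
    also have "\<dots> \<le> exp A" using assms by simp
    finally show "(\<Sum>k\<le>N. \<bar>\<tau>\<bar> ^ k / fact k) \<le> exp A" .
    show "0 \<le> \<epsilon>" using assms by (simp add: \<epsilon>_def)
  qed
  also have "\<tau> ^ N / fact N * b N \<le> 2 * exp (- real (n + 1))"
  proof -
    have tN: "\<tau> ^ N \<le> A ^ N"
      using power_mono[of "\<bar>\<tau>\<bar>" A N] assms power_even_abs[of N \<tau>] by (simp add: N_def)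
    have b0: "0 \<le> b N / fact N"
      unfolding b_def N_def by (intro divide_nonneg_nonneg integral_nonneg_AE AE_I2 zero_le_even_power) auto
    define l where "l = exp 1 * A"
    have "0 < l" using assms by (simp add: l_def)
    have "\<tau> ^ N / fact N * b N = \<tau> ^ N * (b N / fact N)" by simp
    also have "\<dots> \<le> A ^ N * (b N / fact N)"
      using tN b0 by (intro mult_right_mono)
    also have "\<dots> \<le> A ^ N * (2 * exp (l\<^sup>2 / 2 * V) / l ^ N)"
      using random_phases_moment_le[OF fin \<open>0 < l\<close>, of "n + 1"] assms
      by (intro mult_left_mono) (auto simp: N_def b_def V_def)
    also have "\<dots> = 2 * exp (l\<^sup>2 / 2 * V) / exp 1 ^ N"
      using assms by (simp add: l_def power_mult_distrib)
    also have "\<dots> = 2 * exp (l\<^sup>2 / 2 * V - real N)"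
      by (simp add: exp_diff exp_of_nat_mult[symmetric])
    also have "\<dots> \<le> 2 * exp (- real (n + 1))"
    proof -
      have "(exp 1)\<^sup>2 \<le> (3::real)\<^sup>2" using exp_le by (intro power_mono) auto
      then have "(exp 1)\<^sup>2 * (A\<^sup>2 / 2 * V) \<le> 9 * (A\<^sup>2 / 2 * V)"
        by (intro mult_right_mono) (auto simp: V_def intro!: sum_nonneg mult_nonneg_nonneg)
      then have "l\<^sup>2 / 2 * V \<le> real n + 1"
        using n by (simp add: l_def V_def power_mult_distrib)
      then show ?thesis by (simp add: N_def)
    qed
    finally show ?thesis .
  qed
  finally show ?thesis by (simp add: \<epsilon>_def X_def mult_ac)
qed

section \<open>The saddle point for the random model\<close>

text \<open>The quotient \<open>H\<close> of the moment generating function of the model by that of a centred normal variable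
  with the same variance.\<close>

definition gaussian_ratio :: "nat set \<Rightarrow> complex \<Rightarrow> complex" where
  "gaussian_ratio S z = (\<Prod>p\<in>S. bessel_I0 (z / sqrt (real p)) * exp (- ((z / sqrt (real p))\<^sup>2 / 4)))"

abbreviation model_variance :: "nat set \<Rightarrow> real" where
  "model_variance S \<equiv> 1/2 * (\<Sum>p\<in>S. 1 / real p)"

lemma mgf_eq_gaussian_ratio:
  fixes z :: complex
  assumes "finite S"
  shows "(\<Prod>p\<in>S. bessel_I0 (z / sqrt (real p))) = exp (z\<^sup>2 / 2 * complex_of_real (model_variance S)) * gaussian_ratio S z"
proof -
  have "(\<Sum>p\<in>S. (z / sqrt (real p))\<^sup>2 / 4) = z\<^sup>2 / 2 * complex_of_real (model_variance S)"
    by (simp add: sum_distrib_left power_divide mult.commute flip: of_real_power)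
  then have "exp (z\<^sup>2 / 2 * complex_of_real (model_variance S)) = (\<Prod>p\<in>S. exp ((z / sqrt (real p))\<^sup>2 / 4))"
    by (simp only: exp_sum[OF assms, symmetric])
  then have "exp (z\<^sup>2 / 2 * complex_of_real (model_variance S)) * gaussian_ratio S z =
     (\<Prod>p\<in>S. exp ((z / sqrt (real p))\<^sup>2 / 4) * (bessel_I0 (z / sqrt (real p)) * exp (- ((z / sqrt (real p))\<^sup>2 / 4))))"
    unfolding gaussian_ratio_def by (simp only: prod.distrib)
  also have "\<dots> = (\<Prod>p\<in>S. bessel_I0 (z / sqrt (real p)))"
    by (intro prod.cong refl) (simp add: exp_minus)
  finally show ?thesis ..
qed

lemma gaussian_ratio_near_1:
  assumes "norm z \<le> 1"
  shows "norm (gaussian_ratio (primes_upto x) z - 1) \<le> 8 * exp 8 * (norm z)\<^sup>2"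
proof -
  let ?S = "primes_upto x"
  let ?f = "\<lambda>p. bessel_I0 (z / sqrt (real p)) * exp (- ((z / sqrt (real p))\<^sup>2 / 4)) - 1"
  have f: "norm (?f p) \<le> 4 * norm z ^ 4 * (1 / (real p)\<^sup>2)" if "p \<in> ?S" for p
  proof -
    have p: "1 \<le> p" using that prime_ge_1_nat by (auto simp: primes_upto_def)
    have n: "norm (z / sqrt (real p)) = norm z / sqrt (real p)" by (simp add: norm_divide)
    also have "\<dots> \<le> norm z" using p by (simp add: field_simps mult_le_cancel_left1)
    finally have "norm (z / sqrt (real p)) \<le> 1" using assms by simp
    then have "norm (?f p) \<le> 4 * norm (z / sqrt (real p)) ^ 4" by (rule bessel_I0_gaussian)
    also have "\<dots> = 4 * norm z ^ 4 * (1 / (real p)\<^sup>2)"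
    proof -
      have "sqrt (real p) ^ 4 = (real p)\<^sup>2" using power_mult[of "sqrt (real p)" 2 2] by simp
      then show ?thesis unfolding n by (simp add: power_divide)
    qed
    finally show ?thesis .
  qed
  have sq: "(\<Sum>p\<in>?S. 1 / (real p)\<^sup>2) \<le> 2"
  proof -
    have "?S \<subseteq> {1..nat \<lfloor>x\<rfloor>}"
      using prime_ge_1_nat by (auto simp: primes_upto_def le_nat_floor)
    then have "(\<Sum>p\<in>?S. 1 / (real p)\<^sup>2) \<le> (\<Sum>n=1..nat \<lfloor>x\<rfloor>. 1 / (real n)\<^sup>2)"
      by (intro sum_mono2) auto
    then show ?thesis using sum_all_inverse_squares_le[of "nat \<lfloor>x\<rfloor>"] by linarith
  qed
  have z4: "norm z ^ 4 \<le> (norm z)\<^sup>2" using assms by (intro power_decreasing) auto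
  have "norm (gaussian_ratio ?S z - 1) = norm ((\<Prod>p\<in>?S. 1 + ?f p) - 1)"
    by (simp add: gaussian_ratio_def)
  also have "\<dots> \<le> (\<Prod>p\<in>?S. 1 + norm (?f p)) - 1"
    by (rule norm_prod_minus1_le_prod_minus1)
  also have "\<dots> \<le> (\<Prod>p\<in>?S. exp (4 * norm z ^ 4 * (1 / (real p)\<^sup>2))) - 1"
    using f by (intro diff_right_mono prod_mono) (auto intro: order_trans[OF _ exp_ge_add_one_self] add_left_mono)
  also have "\<dots> = exp (4 * norm z ^ 4 * (\<Sum>p\<in>?S. 1 / (real p)\<^sup>2)) - 1"
    by (simp only: exp_sum[OF finite_primes_upto, symmetric] sum_distrib_left)
  also have "\<dots> \<le> exp (4 * norm z ^ 4 * 2) - 1"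
    using mult_left_mono[OF sq, of "4 * norm z ^ 4"] by simp
  also have "\<dots> \<le> (4 * norm z ^ 4 * 2) * exp (4 * norm z ^ 4 * 2)"
  proof -
    have "exp y - 1 \<le> y * exp y" for y :: real
    proof -
      have "exp y * (1 - y) \<le> exp y * exp (- y)"
        using exp_ge_add_one_self[of "- y"] by (intro mult_left_mono) auto
      also have "exp y * exp (- y) = 1" by (simp add: exp_minus)
      finally show ?thesis by (simp add: algebra_simps)
    qed
    then show ?thesis .
  qed
  also have "\<dots> \<le> (8 * (norm z)\<^sup>2) * exp 8"
    using z4 assms power_le_one[of "norm z" 4] by (intro mult_mono[of "4 * norm z ^ 4 * 2"]) auto
  finally show ?thesis by (simp add: mult_ac)
qed

lemma norm_gaussian_ratio_le:
  assumes "norm z \<le> 1"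
  shows "norm (gaussian_ratio (primes_upto x) z) \<le> 1 + 8 * exp 8"
proof -
  have "(norm z)\<^sup>2 \<le> 1" using assms by (simp add: power_le_one)
  then have "8 * exp 8 * (norm z)\<^sup>2 \<le> 8 * exp 8 * 1" by (intro mult_left_mono) auto
  moreover have "norm (gaussian_ratio (primes_upto x) z) \<le> norm (gaussian_ratio (primes_upto x) z - 1) + 1"
    using norm_triangle_ineq[of "gaussian_ratio (primes_upto x) z - 1" 1] by simp
  ultimately show ?thesis
    using gaussian_ratio_near_1[OF assms, of x] by linarith
qed

lemma random_phases_mgf_small:
  fixes s x :: real
  assumes "\<bar>s\<bar> \<le> 1"
  defines "S \<equiv> primes_upto x"
  shows "(LINT \<theta>|random_phases S. exp (s * cos_sum S \<theta>)) \<le> (1 + 8 * exp 8) * exp (s\<^sup>2 / 2 * model_variance S)"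
proof -
  have fin: "finite S" by (simp add: S_def finite_primes_upto)
  have "complex_of_real (LINT \<theta>|random_phases S. exp (s * cos_sum S \<theta>)) =
     (CLINT \<theta>|random_phases S. exp (complex_of_real s * complex_of_real (cos_sum S \<theta>)))"
    unfolding integral_complex_of_real[symmetric] by (simp only: exp_of_real[symmetric] of_real_mult)
  also have "\<dots> = exp ((complex_of_real s)\<^sup>2 / 2 * complex_of_real (model_variance S)) * gaussian_ratio S s"
    by (simp only: random_phases_mgf[OF fin] mgf_eq_gaussian_ratio[OF fin])
  also have "(complex_of_real s)\<^sup>2 / 2 * complex_of_real (model_variance S) = complex_of_real (s\<^sup>2 / 2 * model_variance S)"
    by simp
  finally have "\<bar>LINT \<theta>|random_phases S. exp (s * cos_sum S \<theta>)\<bar> =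
     exp (s\<^sup>2 / 2 * model_variance S) * norm (gaussian_ratio S s)"
    by (metis norm_of_real norm_mult norm_exp_eq_Re Re_complex_of_real)
  also have "\<dots> \<le> exp (s\<^sup>2 / 2 * model_variance S) * (1 + 8 * exp 8)"
    unfolding S_def using assms by (intro mult_left_mono norm_gaussian_ratio_le) auto
  finally show ?thesis by (simp add: mult.commute)
qed

lemma norm_mgf_le_real:
  fixes z :: complex
  assumes "finite S"
  shows "norm (\<Prod>p\<in>S. bessel_I0 (z / sqrt (real p))) \<le> (LINT \<theta>|random_phases S. exp (Re z * cos_sum S \<theta>))"
  unfolding random_phases_mgf_real[OF assms] prod_norm[symmetric]
proof (intro prod_mono conjI norm_ge_zero)
  show "norm (bessel_I0 (z / sqrt (real p))) \<le> (LINT x|angle. exp (Re z / sqrt (real p) * cos x))" for p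
    using norm_bessel_I0_le[of "z / sqrt (real p)"] by simp
qed

text \<open>The primes up to \<open>y\<close> are estimated as if \<open>t\<close> were 0.  For a prime beyond \<open>y\<close> the
  argument of the Bessel function is at most 1, and the factor is close to \<open>exp ((s\<^sup>2 - t\<^sup>2) / (4 p))\<close>, which yields a
  saving because \<open>\<bar>t\<bar>\<close> is bounded below.\<close>

lemma norm_mgf_off_axis:
  fixes s t x y :: real
  assumes "2 \<le> y" "\<bar>s\<bar> \<le> 1/2" "1/2 \<le> \<bar>t\<bar>" "t ^ 4 \<le> y"
  defines "S \<equiv> primes_upto x"
  shows "norm (\<Prod>p\<in>S. bessel_I0 (Complex s t / sqrt (real p))) \<le>
    exp (s\<^sup>2 / 2 * model_variance S) * exp (33 + ln y / 8 - (\<Sum>p\<in>S. 1 / real p) / 16)"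
proof -
  have fin: "finite S" by (simp add: S_def finite_primes_upto)
  define z where "z = Complex s t"
  define A where "A = {p\<in>S. real p \<le> y}"
  define B where "B = {p\<in>S. y < real p}"
  have AB: "S = A \<union> B" "A \<inter> B = {}" "finite A" "finite B"
    using fin by (auto simp: A_def B_def)
  have pos: "0 < p" if "p \<in> S" for p using that prime_gt_0_nat by (auto simp: S_def primes_upto_def)
  have s2: "s\<^sup>2 \<le> 1/4" using power_mono[of "\<bar>s\<bar>" "1/2" 2] assms by (simp add: power_divide)
  have t2: "1/4 \<le> t\<^sup>2" using power_mono[of "1/2" "\<bar>t\<bar>" 2] assms by (simp add: power_divide)
  have "t\<^sup>2 \<le> sqrt y" using assms by (intro real_le_rsqrt) (simp flip: power_mult)
  have nz2: "(norm z)\<^sup>2 = s\<^sup>2 + t\<^sup>2" by (simp add: z_def cmod_power2)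
  have "2 * sqrt y \<le> sqrt y * sqrt y + 1" using sum_squares_bound[of "sqrt y" 1] by (simp add: power2_eq_square)
  then have "2 * sqrt y \<le> y + 1" using assms by simp
  then have z2y: "(norm z)\<^sup>2 \<le> y" unfolding nz2 using \<open>t\<^sup>2 \<le> sqrt y\<close> s2 assms by linarith
  have "s ^ 4 \<le> 1" using power_le_one[of "\<bar>s\<bar>" 4] assms by simp
  have "norm z ^ 4 = (s\<^sup>2 + t\<^sup>2)\<^sup>2" unfolding nz2[symmetric] by (simp flip: power_mult)
  also have "\<dots> \<le> 2 * s ^ 4 + 2 * t ^ 4"
    using sum_squares_bound[of "s\<^sup>2" "t\<^sup>2"] by (simp add: power2_sum flip: power_mult)
  also have "\<dots> \<le> 4 * y" using \<open>s ^ 4 \<le> 1\<close> assms by linarith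
  finally have z4: "norm z ^ 4 \<le> 4 * y" .
  have a: "norm (bessel_I0 (z / sqrt (real p))) \<le> exp (s\<^sup>2 / 2 * (1 / real p))" if "p \<in> A" for p
  proof -
    have "norm (bessel_I0 (z / sqrt (real p))) \<le> exp ((s / sqrt (real p))\<^sup>2 / 2)"
      using norm_bessel_I0_le[of "z / sqrt (real p)"] angle_mgf_le[of "s / sqrt (real p)"]
      by (simp add: z_def)
    then show ?thesis by (simp add: power_divide mult.commute)
  qed
  have b: "norm (bessel_I0 (z / sqrt (real p))) \<le> exp ((s\<^sup>2 - t\<^sup>2) / 4 * (1 / real p) + 16 * y * (1 / (real p)\<^sup>2))"
    if "p \<in> B" for p
  proof -
    define w where "w = z / sqrt (real p)"
    have p: "0 < p" "y < real p" using that pos by (auto simp: B_def)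
    have w2: "(norm w)\<^sup>2 = (norm z)\<^sup>2 / real p" by (simp add: w_def norm_divide power_divide)
    have "(norm w)\<^sup>2 \<le> 1" unfolding w2 using p z2y by simp
    then have w1: "norm w \<le> 1" by (simp add: power_le_one_iff abs_square_le_1)
    have w4: "norm w ^ 4 \<le> 4 * y * (1 / (real p)\<^sup>2)"
    proof -
      have "norm w ^ 4 = ((norm w)\<^sup>2)\<^sup>2" by (simp flip: power_mult)
      also have "\<dots> = norm z ^ 4 * (1 / (real p)\<^sup>2)" unfolding w2 by (simp add: power_divide flip: power_mult)
      also have "\<dots> \<le> 4 * y * (1 / (real p)\<^sup>2)" using z4 by (intro mult_right_mono) auto
      finally show ?thesis .
    qed
    have rew: "Re (w\<^sup>2 / 4) = (s\<^sup>2 - t\<^sup>2) / 4 * (1 / real p)"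
      unfolding w_def z_def by (simp add: power2_eq_square power_divide diff_divide_distrib)
    have "bessel_I0 w = exp (w\<^sup>2 / 4) * (1 + (bessel_I0 w * exp (- (w\<^sup>2 / 4)) - 1))"
      by (simp add: exp_minus)
    then have "norm (bessel_I0 w) = exp (Re (w\<^sup>2 / 4)) * norm (1 + (bessel_I0 w * exp (- (w\<^sup>2 / 4)) - 1))"
      by (metis norm_mult norm_exp_eq_Re)
    also have "\<dots> \<le> exp (Re (w\<^sup>2 / 4)) * exp (16 * y * (1 / (real p)\<^sup>2))"
    proof (rule mult_left_mono)
      have "norm (1 + (bessel_I0 w * exp (- (w\<^sup>2 / 4)) - 1)) \<le> 1 + 4 * norm w ^ 4"
        using norm_triangle_ineq[of 1 "bessel_I0 w * exp (- (w\<^sup>2 / 4)) - 1"] bessel_I0_gaussian[OF w1] by simp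
      also have "\<dots> \<le> 1 + 16 * y * (1 / (real p)\<^sup>2)" using w4 by simp
      also have "\<dots> \<le> exp (16 * y * (1 / (real p)\<^sup>2))" by (rule exp_ge_add_one_self)
      finally show "norm (1 + (bessel_I0 w * exp (- (w\<^sup>2 / 4)) - 1)) \<le> exp (16 * y * (1 / (real p)\<^sup>2))" .
    qed simp
    finally show ?thesis unfolding rew exp_add[symmetric] unfolding w_def .
  qed
  define VA where "VA = (\<Sum>p\<in>A. 1 / real p)"
  define VB where "VB = (\<Sum>p\<in>B. 1 / real p)"
  have V: "(\<Sum>p\<in>S. 1 / real p) = VA + VB"
    unfolding VA_def VB_def AB(1) using AB by (intro sum.union_disjoint) auto
  have VAle: "VA \<le> 1 + ln y" unfolding VA_def A_def S_def using assms by (intro prime_harmonic_initial) auto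
  have VB0: "0 \<le> VB" unfolding VB_def by (intro sum_nonneg) auto
  have VA0: "0 \<le> VA" unfolding VA_def by (intro sum_nonneg) auto
  have B2: "(\<Sum>p\<in>B. 1 / (real p)\<^sup>2) \<le> 2 / y"
    unfolding B_def S_def using assms by (intro sum_inverse_prime_squares_tail) auto
  have "norm (\<Prod>p\<in>S. bessel_I0 (z / sqrt (real p))) =
     (\<Prod>p\<in>A. norm (bessel_I0 (z / sqrt (real p)))) * (\<Prod>p\<in>B. norm (bessel_I0 (z / sqrt (real p))))"
    unfolding AB(1) using AB by (simp add: prod.union_disjoint prod_norm norm_mult)
  also have "\<dots> \<le> (\<Prod>p\<in>A. exp (s\<^sup>2 / 2 * (1 / real p))) *
     (\<Prod>p\<in>B. exp ((s\<^sup>2 - t\<^sup>2) / 4 * (1 / real p) + 16 * y * (1 / (real p)\<^sup>2)))"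
    using a b by (intro mult_mono prod_mono prod_nonneg) auto
  also have "\<dots> = exp (s\<^sup>2 / 2 * VA + (s\<^sup>2 - t\<^sup>2) / 4 * VB + 16 * y * (\<Sum>p\<in>B. 1 / (real p)\<^sup>2))"
    unfolding VA_def VB_def sum_distrib_left exp_sum[OF AB(3), symmetric] exp_sum[OF AB(4), symmetric] sum.distrib
    by (simp only: exp_add[symmetric] add.assoc)
  also have "\<dots> \<le> exp (s\<^sup>2 / 2 * model_variance S + (33 + ln y / 8 - (\<Sum>p\<in>S. 1 / real p) / 16))"
  proof -
    have "16 * y * (\<Sum>p\<in>B. 1 / (real p)\<^sup>2) \<le> 16 * y * (2 / y)"
      using B2 assms by (intro mult_left_mono) auto
    then have 1: "16 * y * (\<Sum>p\<in>B. 1 / (real p)\<^sup>2) \<le> 32" using assms by simp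
    have 2: "s\<^sup>2 * VA \<le> 1/4 * VA" using s2 VA0 by (rule mult_right_mono)
    have 3: "1/4 * VB \<le> t\<^sup>2 * VB" using t2 VB0 by (rule mult_right_mono)
    \<comment> \<open>The constant 33 covers \<open>16 y (2 / y) = 32\<close> and the 1 in the bound \<open>1 + ln y\<close>.\<close>
    have gen: "a + r \<le> q + (33 + l / 8 - (VA + VB) / 16)"
      if "a = q + p1 / 4 - p2 / 4" "r \<le> 32" "p1 \<le> 1/4 * VA" "1/4 * VB \<le> p2" "VA \<le> 1 + l" for a r q p1 p2 l :: real
      using that by (simp add: field_simps)
    have "s\<^sup>2 / 2 * VA + (s\<^sup>2 - t\<^sup>2) / 4 * VB = s\<^sup>2 / 2 * (1/2 * (VA + VB)) + (s\<^sup>2 * VA) / 4 - (t\<^sup>2 * VB) / 4"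
      by (simp add: field_simps)
    then show ?thesis unfolding V exp_le_cancel_iff by (rule gen[OF _ 1 2 3 VAle])
  qed
  finally show ?thesis by (simp add: z_def exp_add)
qed

text \<open>Write \<open>\<phi>(u - y) = exp (- s u + s\<^sup>2 / 2) exp (s y) \<phi>(u - s - y)\<close> and apply Fourier inversion with the weight
  \<open>exp (s Y)\<close>.  For the point \<open>u = s (1 + c)\<close> the oscillating factor \<open>exp (i \<tau> s c)\<close> cancels against the one in
  \<open>exp ((s - i \<tau>)\<^sup>2 c / 2)\<close>.\<close>

lemma smooth_density_saddle:
  fixes s x :: real
  defines "S \<equiv> primes_upto x"
  defines "c \<equiv> model_variance S"
  shows "complex_of_real (smooth_density (random_phases S) (cos_sum S) (s * (1 + c))) =
    exp (- s\<^sup>2 * (1 + c) / 2) / sqrt (2 * pi) *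
    (CLINT \<tau>|std_normal_distribution. exp (- c * \<tau>\<^sup>2 / 2) * gaussian_ratio S (Complex s (- \<tau>)))"
proof -
  have fin: "finite S" by (simp add: S_def finite_primes_upto)
  interpret R: prob_space "random_phases S" by (rule prob_space_random_phases)
  define u where "u = s * (1 + c)"
  let ?Y = "cos_sum S" and ?M = "random_phases S"
  define B where "B = exp (\<bar>s\<bar> * (\<Sum>p\<in>S. 1 / sqrt (real p)))"
  have W: "\<bar>exp (s * ?Y \<theta>)\<bar> \<le> B" for \<theta>
  proof -
    have "s * ?Y \<theta> \<le> \<bar>s\<bar> * \<bar>?Y \<theta>\<bar>" by (simp flip: abs_mult)
    also have "\<dots> \<le> \<bar>s\<bar> * (\<Sum>p\<in>S. 1 / sqrt (real p))"
      by (intro mult_left_mono abs_cos_sum_le) auto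
    finally show ?thesis by (simp add: B_def)
  qed
  have tilt: "\<phi> (u - y) = exp (- s * u + s\<^sup>2 / 2) * (exp (s * y) * \<phi> ((u - s) - y))" for y
  proof -
    have "- (u - y)\<^sup>2 / 2 = (- s * u + s\<^sup>2 / 2) + (s * y + - ((u - s) - y)\<^sup>2 / 2)"
      by (simp add: power2_eq_square field_simps)
    then have "exp (- (u - y)\<^sup>2 / 2) = exp (- s * u + s\<^sup>2 / 2) * (exp (s * y) * exp (- ((u - s) - y)\<^sup>2 / 2))"
      by (simp only: exp_add)
    then show ?thesis by (simp add: std_normal_density_def)
  qed
  have inner: "(CLINT \<theta>|?M. exp (s * ?Y \<theta>) * iexp (\<tau> * ((u - s) - ?Y \<theta>))) =
      exp (s\<^sup>2 * c / 2) * (exp (- c * \<tau>\<^sup>2 / 2) * gaussian_ratio S (Complex s (- \<tau>)))" for \<tau>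
  proof -
    let ?z = "Complex s (- \<tau>)"
    have "complex_of_real (exp (s * y)) * iexp (\<tau> * ((u - s) - y)) = iexp (\<tau> * (u - s)) * exp (?z * complex_of_real y)" for y
      unfolding exp_of_real[symmetric] exp_add[symmetric] by (simp add: complex_eq_iff Complex_eq algebra_simps)
    then have "(CLINT \<theta>|?M. exp (s * ?Y \<theta>) * iexp (\<tau> * ((u - s) - ?Y \<theta>))) =
        iexp (\<tau> * (u - s)) * (CLINT \<theta>|?M. exp (?z * complex_of_real (?Y \<theta>)))"
      by (simp only: integral_mult_right_zero)
    also have "\<dots> = iexp (\<tau> * (u - s)) * (exp (?z\<^sup>2 / 2 * complex_of_real c) * gaussian_ratio S ?z)"
      by (simp only: random_phases_mgf[OF fin] mgf_eq_gaussian_ratio[OF fin] c_def)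
    also have "\<dots> = (iexp (\<tau> * (u - s)) * exp (?z\<^sup>2 / 2 * complex_of_real c)) * gaussian_ratio S ?z"
      by simp
    also have "iexp (\<tau> * (u - s)) * exp (?z\<^sup>2 / 2 * complex_of_real c) = exp (complex_of_real (s\<^sup>2 * c / 2 + - c * \<tau>\<^sup>2 / 2))"
      unfolding exp_add[symmetric]
      by (rule arg_cong[where f = exp]) (simp add: complex_eq_iff u_def power2_eq_square field_simps)
    also have "\<dots> = complex_of_real (exp (s\<^sup>2 * c / 2)) * complex_of_real (exp (- c * \<tau>\<^sup>2 / 2))"
      unfolding exp_of_real exp_add of_real_mult ..
    finally show ?thesis by simp
  qed
  define I where "I = (\<integral>\<theta>. exp (s * ?Y \<theta>) * \<phi> ((u - s) - ?Y \<theta>) \<partial>?M)"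
  have "complex_of_real I = 1 / sqrt (2 * pi) * (CLINT \<tau>|std_normal_distribution. (CLINT \<theta>|?M. exp (s * ?Y \<theta>) * iexp (\<tau> * ((u - s) - ?Y \<theta>))))"
    unfolding I_def by (rule R.weighted_smooth_density_fourier[OF _ _ W]) measurable
  then have I: "complex_of_real I = 1 / sqrt (2 * pi) * (exp (s\<^sup>2 * c / 2) *
      (CLINT \<tau>|std_normal_distribution. exp (- c * \<tau>\<^sup>2 / 2) * gaussian_ratio S (Complex s (- \<tau>))))"
    unfolding inner by (simp only: integral_mult_right_zero)
  have "smooth_density ?M ?Y u = exp (- s * u + s\<^sup>2 / 2) * I"
    unfolding smooth_density_def tilt I_def by simp
  then have "complex_of_real (smooth_density ?M ?Y u) = complex_of_real (exp (- s * u + s\<^sup>2 / 2)) * complex_of_real I"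
    by (simp only: of_real_mult)
  also have "\<dots> = (complex_of_real (exp (- s * u + s\<^sup>2 / 2)) * complex_of_real (exp (s\<^sup>2 * c / 2))) * (1 / sqrt (2 * pi) *
      (CLINT \<tau>|std_normal_distribution. exp (- c * \<tau>\<^sup>2 / 2) * gaussian_ratio S (Complex s (- \<tau>))))"
    unfolding I by simp
  also have "complex_of_real (exp (- s * u + s\<^sup>2 / 2)) * complex_of_real (exp (s\<^sup>2 * c / 2)) =
     complex_of_real (exp (- s\<^sup>2 * (1 + c) / 2))"
  proof -
    have "(- s * u + s\<^sup>2 / 2) + s\<^sup>2 * c / 2 = - s\<^sup>2 * (1 + c) / 2"
      by (simp add: u_def power2_eq_square field_simps)
    then show ?thesis unfolding of_real_mult[symmetric] exp_add[symmetric] by simp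
  qed
  finally show ?thesis by (simp add: u_def)
qed

text \<open>For \<open>\<bar>\<tau>\<bar> \<le> 1/2\<close> the ratio is close to 1.  For larger \<open>\<bar>\<tau>\<bar>\<close> up to \<open>A\<close> the generating
  function is small by \<open>norm_mgf_off_axis\<close>, and beyond \<open>A\<close> it is bounded by its value on the real axis, which is enough
  because the normal law gives very little mass to \<open>\<bar>\<tau>\<bar> > A\<close>.\<close>

lemma saddle_integrand_bound:
  fixes s \<tau> x :: real
  defines "S \<equiv> primes_upto x"
  defines "c \<equiv> model_variance S"
  assumes s: "\<bar>s\<bar> \<le> 1/2" and c: "2 \<le> c"
  defines "A \<equiv> exp (c / 8)"
  shows "norm (exp (- c * \<tau>\<^sup>2 / 2) * gaussian_ratio S (Complex s (- \<tau>)) - exp (- c * \<tau>\<^sup>2 / 2)) \<le>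
     8 * exp 8 * s\<^sup>2 * exp (- c * \<tau>\<^sup>2 / 2) + 8 * exp 8 * (exp (- c * \<tau>\<^sup>2 / 2) * \<tau>\<^sup>2) +
     (exp 33 + 1) * exp (- c / 16) + (1 + 8 * exp 8) * indicator {\<tau>. \<bar>\<tau>\<bar> > A} \<tau>"
proof -
  have fin: "finite S" by (simp add: S_def finite_primes_upto)
  let ?z = "Complex s (- \<tau>)" and ?e = "exp (- c * \<tau>\<^sup>2 / 2)" and ?I = "indicat_real {\<tau>. \<bar>\<tau>\<bar> > A} \<tau>"
  have nn: "0 \<le> 8 * exp 8 * s\<^sup>2 * ?e" "0 \<le> 8 * exp 8 * (?e * \<tau>\<^sup>2)" "0 \<le> (exp 33 + 1) * exp (- c / 16)"
    "0 \<le> (1 + 8 * exp 8) * ?I"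
    by auto
  show ?thesis
  proof (cases "\<bar>\<tau>\<bar> \<le> 1/2")
    case True
    have "s\<^sup>2 \<le> 1/4" "\<tau>\<^sup>2 \<le> 1/4"
      using power_mono[of "\<bar>s\<bar>" "1/2" 2] power_mono[of "\<bar>\<tau>\<bar>" "1/2" 2] s True by (simp_all add: power_divide)
    moreover have nz: "(norm ?z)\<^sup>2 = s\<^sup>2 + \<tau>\<^sup>2" by (simp add: cmod_power2)
    ultimately have "(norm ?z)\<^sup>2 \<le> 1" by simp
    then have "norm ?z \<le> 1" by (simp add: abs_square_le_1)
    have "norm (?e * gaussian_ratio S ?z - ?e) = ?e * norm (gaussian_ratio S ?z - 1)"
      by (simp add: norm_mult flip: right_diff_distrib' norm_exp_eq_Re) (metis mult.right_neutral norm_mult norm_of_real abs_exp_cancel right_diff_distrib')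
    also have "\<dots> \<le> ?e * (8 * exp 8 * (norm ?z)\<^sup>2)"
      unfolding S_def by (intro mult_left_mono gaussian_ratio_near_1 \<open>norm ?z \<le> 1\<close>) auto
    also have "\<dots> = 8 * exp 8 * s\<^sup>2 * ?e + 8 * exp 8 * (?e * \<tau>\<^sup>2)"
      unfolding nz by (simp add: algebra_simps)
    finally show ?thesis using nn by linarith
  next
    case False
    then have t: "1/2 \<le> \<bar>- \<tau>\<bar>" by simp
    have t2: "1/4 \<le> \<tau>\<^sup>2" using power_mono[of "1/2" "\<bar>\<tau>\<bar>" 2] t by (simp add: power_divide)
    have "c / 16 \<le> c * \<tau>\<^sup>2 / 2" using mult_left_mono[OF t2, of c] c by simp
    then have e: "?e \<le> exp (- c / 16)" by simp
    have eq: "?e * norm (gaussian_ratio S ?z) = exp (- (s\<^sup>2 / 2 * c)) * norm (\<Prod>p\<in>S. bessel_I0 (?z / sqrt (real p)))"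
    proof -
      have "norm (\<Prod>p\<in>S. bessel_I0 (?z / sqrt (real p))) = exp (Re (?z\<^sup>2 / 2 * complex_of_real c)) * norm (gaussian_ratio S ?z)"
        unfolding mgf_eq_gaussian_ratio[OF fin] norm_mult norm_exp_eq_Re c_def ..
      moreover have "Re (?z\<^sup>2 / 2 * complex_of_real c) = s\<^sup>2 / 2 * c + - c * \<tau>\<^sup>2 / 2"
        by (simp add: power2_eq_square field_simps)
      ultimately show ?thesis by (simp only: exp_add) (simp add: exp_minus)
    qed
    have out: "?e * norm (gaussian_ratio S ?z) \<le> exp 33 * exp (- c / 16) + (1 + 8 * exp 8) * ?I"
    proof (cases "\<bar>\<tau>\<bar> > A")
      case True
      have "norm (\<Prod>p\<in>S. bessel_I0 (?z / sqrt (real p))) \<le> (1 + 8 * exp 8) * exp (s\<^sup>2 / 2 * c)"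
        using norm_mgf_le_real[OF fin, of ?z] random_phases_mgf_small[of s x] s by (simp add: S_def c_def)
      then have "?e * norm (gaussian_ratio S ?z) \<le> exp (- (s\<^sup>2 / 2 * c)) * ((1 + 8 * exp 8) * exp (s\<^sup>2 / 2 * c))"
        unfolding eq by (intro mult_left_mono) auto
      also have "\<dots> = 1 + 8 * exp 8" by (simp add: exp_minus)
      finally show ?thesis using True by (simp add: add_increasing)
    next
      case False
      \<comment> \<open>The threshold for which \<open>A ^ 4 = y\<close>; as \<open>\<Sum> 1/p = 2 c\<close>, it gives \<open>ln y / 8 = c / 16\<close>, half of what
         the primes save.\<close>
      define y where "y = exp (c / 2)"
      have "1 + c / 2 \<le> y" unfolding y_def by (rule exp_ge_add_one_self)
      then have y2: "2 \<le> y" using c by simp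
      have "\<bar>\<tau>\<bar> ^ 4 \<le> A ^ 4" using False by (intro power_mono) auto
      also have "A ^ 4 = y" by (simp add: A_def y_def flip: exp_of_nat_mult)
      finally have t4: "(- \<tau>) ^ 4 \<le> y" by simp
      have "norm (\<Prod>p\<in>S. bessel_I0 (?z / sqrt (real p))) \<le> exp (s\<^sup>2 / 2 * c) * exp (33 + ln y / 8 - (2 * c) / 16)"
        using norm_mgf_off_axis[OF y2 s t t4, of x] by (simp add: S_def c_def)
      also have "33 + ln y / 8 - (2 * c) / 16 = 33 + - c / 16" by (simp add: y_def)
      finally have "?e * norm (gaussian_ratio S ?z) \<le> exp (- (s\<^sup>2 / 2 * c)) * (exp (s\<^sup>2 / 2 * c) * exp (33 + - c / 16))"
        unfolding eq by (intro mult_left_mono) auto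
      also have "\<dots> = exp 33 * exp (- c / 16)" unfolding exp_add by (simp add: exp_minus)
      finally show ?thesis using nn(4) by linarith
    qed
    have "norm (?e * gaussian_ratio S ?z - ?e) \<le> ?e * norm (gaussian_ratio S ?z) + ?e"
      by (rule order_trans[OF norm_triangle_ineq4]) (simp add: norm_mult)
    moreover have "(exp 33 + 1) * exp (- c / 16) = exp 33 * exp (- c / 16) + exp (- c / 16)"
      by (simp add: distrib_right)
    ultimately show ?thesis using out e nn(1,2) by linarith
  qed
qed

lemma std_normal_integral:
  fixes f :: "real \<Rightarrow> real"
  assumes "f \<in> borel_measurable borel"
  shows "(LINT \<tau>|std_normal_distribution. f \<tau>) = (LINT \<tau>|lborel. \<phi> \<tau> * f \<tau>)"
    and "integrable std_normal_distribution f \<longleftrightarrow> integrable lborel (\<lambda>\<tau>. \<phi> \<tau> * f \<tau>)"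
  using assms by (simp_all add: integral_density integrable_density)

lemma gaussian_ratio_measurable: "(\<lambda>\<tau>. gaussian_ratio S (Complex s (- \<tau>))) \<in> borel_measurable borel"
  unfolding gaussian_ratio_def bessel_I0_def Complex_eq by measurable

text \<open>Collects the constants of \<open>saddle_integrand_bound\<close>; all that matters is that it depends neither on
  the set of primes nor on the point of evaluation.\<close>

definition saddle_const :: real where
  "saddle_const = 8 * exp 8 + 1024 * (exp 33 + 1 + 2 * (1 + 8 * exp 8))"

lemma exp_minus_le_inverse_power:
  fixes c :: real
  assumes "0 \<le> c"
  shows "exp (- c / 16) \<le> 1024 * (1 / sqrt (1 + c) / (1 + c))"
proof -
  have "(1 + c) / 32 \<le> 1 + c / 32" by simp
  also have "\<dots> \<le> exp (c / 32)" by (rule exp_ge_add_one_self)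
  finally have "((1 + c) / 32)\<^sup>2 \<le> (exp (c / 32))\<^sup>2" using assms by (intro power_mono) auto
  also have "(exp (c / 32))\<^sup>2 = exp (c / 16)" by (simp flip: exp_of_nat_mult)
  finally have 1: "((1 + c) / 32)\<^sup>2 \<le> exp (c / 16)" .
  have "exp (- c / 16) = 1 / exp (c / 16)" by (simp add: exp_minus inverse_eq_divide)
  also have "\<dots> \<le> 1 / ((1 + c) / 32)\<^sup>2"
    using 1 assms by (intro divide_left_mono) auto
  also have "\<dots> = 1024 * (1 / (1 + c) / (1 + c))" by (simp add: power2_eq_square)
  also have "\<dots> \<le> 1024 * (1 / sqrt (1 + c) / (1 + c))"
  proof -
    have "sqrt (1 + c) \<le> 1 + c" using assms by (simp add: real_sqrt_le_iff' sqrt_le_D real_le_lsqrt power2_eq_square algebra_simps)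
    then have "1 / (1 + c) \<le> 1 / sqrt (1 + c)" using assms by (intro divide_left_mono) auto
    then show ?thesis using assms by (intro mult_left_mono divide_right_mono) auto
  qed
  finally show ?thesis .
qed

text \<open>Integrate \<open>saddle_integrand_bound\<close> against the normal law: the terms with \<open>s\<^sup>2\<close> and \<open>\<tau>\<^sup>2\<close> give the
  relative errors \<open>s\<^sup>2\<close> and \<open>1 / (1 + c)\<close>, and the exponentially small terms are absorbed into the latter.\<close>

lemma smooth_density_gaussian:
  fixes s x :: real
  defines "S \<equiv> primes_upto x"
  defines "c \<equiv> model_variance S"
  assumes s: "\<bar>s\<bar> \<le> 1/2" and c: "2 \<le> c"
  shows "\<bar>smooth_density (random_phases S) (cos_sum S) (s * (1 + c)) - \<phi> (s * sqrt (1 + c)) / sqrt (1 + c)\<bar>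
    \<le> saddle_const * (s\<^sup>2 + 1 / (1 + c)) * (\<phi> (s * sqrt (1 + c)) / sqrt (1 + c))"
proof -
  let ?N = std_normal_distribution
  define e where "e \<tau> = exp (- c * \<tau>\<^sup>2 / 2)" for \<tau>
  define G where "G \<tau> = gaussian_ratio S (Complex s (- \<tau>))" for \<tau>
  define A where "A = exp (c / 8)"
  define J where "J \<tau> = indicat_real {\<tau>. \<bar>\<tau>\<bar> > A} \<tau>" for \<tau>
  define b where "b \<tau> = 8 * exp 8 * s\<^sup>2 * e \<tau> + 8 * exp 8 * (e \<tau> * \<tau>\<^sup>2) + (exp 33 + 1) * exp (- c / 16) + (1 + 8 * exp 8) * J \<tau>" for \<tau>
  interpret N: real_distribution ?N by (rule real_dist_normal_dist)
  have [measurable]: "e \<in> borel_measurable borel" "G \<in> borel_measurable borel" "J \<in> borel_measurable borel"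
    unfolding e_def G_def J_def using gaussian_ratio_measurable by measurable
  have c1: "- 1 < c" using c by simp
  have ie: "integrable ?N e" "(LINT \<tau>|?N. e \<tau>) = 1 / sqrt (1 + c)"
    using integrable_std_normal_times_gaussian[OF c1] integral_std_normal_times_gaussian[OF c1]
    by (simp_all add: std_normal_integral e_def)
  have ie2: "integrable ?N (\<lambda>\<tau>. e \<tau> * \<tau>\<^sup>2)" "(LINT \<tau>|?N. e \<tau> * \<tau>\<^sup>2) = 1 / sqrt (1 + c) / (1 + c)"
    using second_moment_std_normal_times_gaussian[OF c1]
    by (simp_all add: std_normal_integral e_def has_bochner_integral_iff mult.assoc)
  have iJ: "integrable ?N J" unfolding J_def by (rule N.integrable_const_bound[where B = 1]) auto
  have ib: "integrable ?N b"
    unfolding b_def using ie(1) ie2(1) iJ by (intro Bochner_Integration.integrable_add integrable_mult_right) auto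
  have diff_le: "norm (e \<tau> * G \<tau> - e \<tau>) \<le> b \<tau>" for \<tau>
    using saddle_integrand_bound[of s x \<tau>] s c unfolding b_def e_def G_def J_def A_def S_def c_def by simp
  have idiff: "integrable ?N (\<lambda>\<tau>. e \<tau> * G \<tau> - e \<tau>)"
    by (rule Bochner_Integration.integrable_bound[OF ib]) (use diff_le in \<open>auto intro: order_trans[OF _ abs_ge_self]\<close>)
  have ie': "integrable ?N (\<lambda>\<tau>. complex_of_real (e \<tau>))" using ie(1) by simp
  let ?r = "1 / sqrt (1 + c)" and ?k = "8 * exp 8 :: real" and ?I = "CLINT \<tau>|?N. e \<tau> * G \<tau>"
  have "norm (?I - ?r) = norm (CLINT \<tau>|?N. e \<tau> * G \<tau> - e \<tau>)"
  proof -
    have "?I = (CLINT \<tau>|?N. (e \<tau> * G \<tau> - e \<tau>) + e \<tau>)" by simp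
    also have "\<dots> = (CLINT \<tau>|?N. e \<tau> * G \<tau> - e \<tau>) + (CLINT \<tau>|?N. e \<tau>)"
      by (rule Bochner_Integration.integral_add[OF idiff ie'])
    also have "(CLINT \<tau>|?N. e \<tau>) = complex_of_real ?r"
      unfolding integral_complex_of_real ie(2) ..
    finally show ?thesis by simp
  qed
  also have "\<dots> \<le> (LINT \<tau>|?N. norm (e \<tau> * G \<tau> - e \<tau>))" by (rule integral_norm_bound)
  also have "\<dots> \<le> (LINT \<tau>|?N. b \<tau>)"
    using idiff ib diff_le by (intro integral_mono) auto
  also have "\<dots> = ?k * s\<^sup>2 * ?r + ?k * (?r / (1 + c)) +
      (exp 33 + 1) * exp (- c / 16) + (1 + ?k) * (LINT \<tau>|?N. J \<tau>)"
    unfolding b_def using ie ie2 iJ N.prob_space by simp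
  also have "\<dots> \<le> ?k * s\<^sup>2 * ?r + ?k * (?r / (1 + c)) +
      (exp 33 + 1) * exp (- c / 16) + (1 + ?k) * (2 * exp (- c / 16))"
  proof (intro add_left_mono mult_left_mono)
    have "c / 4 \<le> exp (c / 4)" using exp_ge_add_one_self[of "c / 4"] by linarith
    also have "exp (c / 4) = A\<^sup>2" by (simp add: A_def flip: exp_of_nat_mult)
    finally have "exp (- A\<^sup>2 / 4) \<le> exp (- c / 16)" by simp
    then have "2 * exp (- A\<^sup>2 / 4) \<le> 2 * exp (- c / 16)" by linarith
    moreover have "0 \<le> A" by (simp add: A_def)
    ultimately show "(LINT \<tau>|?N. J \<tau>) \<le> 2 * exp (- c / 16)"
      unfolding J_def by (intro order_trans[OF std_normal_outside_le])
  qed simp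
  also have "\<dots> =
     ?k * (s\<^sup>2 + 1 / (1 + c)) * ?r + (exp 33 + 1 + 2 * (1 + ?k)) * exp (- c / 16)"
  proof -
    have "a * q * r + a * (r / d) + p * E + k * (2 * E) = a * (q + 1 / d) * r + (p + 2 * k) * E" for a q r d p k E :: real
      by (simp add: distrib_left distrib_right)
    then show ?thesis .
  qed
  also have "\<dots> \<le> ?k * (s\<^sup>2 + 1 / (1 + c)) * ?r +
      (exp 33 + 1 + 2 * (1 + ?k)) * (1024 * (?r / (1 + c)))"
    using c by (intro add_left_mono mult_left_mono exp_minus_le_inverse_power) auto
  also have "\<dots> \<le> ?k * (s\<^sup>2 + 1 / (1 + c)) * ?r +
      (exp 33 + 1 + 2 * (1 + ?k)) * (1024 * ((s\<^sup>2 + 1 / (1 + c)) * ?r))"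
  proof -
    have "1 / (1 + c) * ?r \<le> (s\<^sup>2 + 1 / (1 + c)) * ?r"
      using c by (intro mult_right_mono) auto
    moreover have "1 / (1 + c) * ?r = ?r / (1 + c)" by simp
    ultimately have "?r / (1 + c) \<le> (s\<^sup>2 + 1 / (1 + c)) * ?r" by (simp only:)
    then show ?thesis by (intro add_left_mono mult_left_mono) (auto simp del: divide_divide_eq_left)
  qed
  also have "\<dots> = saddle_const * (s\<^sup>2 + 1 / (1 + c)) * ?r"
  proof -
    have "a * q * r + m * (1024 * (q * r)) = (a + 1024 * m) * q * r" for a q r m :: real
      by (simp add: distrib_right)
    then show ?thesis unfolding saddle_const_def .
  qed
  finally have main: "norm (?I - ?r) \<le> saddle_const * (s\<^sup>2 + 1 / (1 + c)) * ?r" .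
  define g where "g = \<phi> (s * sqrt (1 + c))"
  have g: "g = exp (- s\<^sup>2 * (1 + c) / 2) / sqrt (2 * pi)"
    using c by (simp add: g_def std_normal_density_def power_mult_distrib)
  have "complex_of_real (smooth_density (random_phases S) (cos_sum S) (s * (1 + c)) - g / sqrt (1 + c)) =
     complex_of_real g * ((CLINT \<tau>|?N. e \<tau> * G \<tau>) - 1 / sqrt (1 + c))"
  proof -
    have "complex_of_real (smooth_density (random_phases S) (cos_sum S) (s * (1 + c))) = complex_of_real g * (CLINT \<tau>|?N. e \<tau> * G \<tau>)"
      using smooth_density_saddle[of x s] unfolding g e_def G_def S_def c_def by (simp only: of_real_divide)
    then show ?thesis by (simp add: right_diff_distrib)
  qed
  then have "norm (complex_of_real (smooth_density (random_phases S) (cos_sum S) (s * (1 + c)) - g / sqrt (1 + c))) =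
     norm (complex_of_real g) * norm ((CLINT \<tau>|?N. e \<tau> * G \<tau>) - 1 / sqrt (1 + c))"
    by (simp only: norm_mult)
  then have "\<bar>smooth_density (random_phases S) (cos_sum S) (s * (1 + c)) - g / sqrt (1 + c)\<bar> =
     \<bar>g\<bar> * norm ((CLINT \<tau>|?N. e \<tau> * G \<tau>) - 1 / sqrt (1 + c))"
    by (simp only: norm_of_real)
  also have "\<dots> \<le> \<bar>g\<bar> * (saddle_const * (s\<^sup>2 + 1 / (1 + c)) * (1 / sqrt (1 + c)))"
    by (intro mult_left_mono main) simp
  also have "\<bar>g\<bar> = g" by (simp add: g_def)
  finally show ?thesis by (simp add: g_def mult_ac)
qed

lemma normal_tail_interval_scaled:
  assumes "0 < \<sigma>" "v \<le> w"
  shows "(LBINT u:{v..<w}. \<phi> (u / \<sigma>) / \<sigma>) = normal_tail (v / \<sigma>) - normal_tail (w / \<sigma>)"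
    and "set_integrable lborel {v..<w} (\<lambda>u. \<phi> (u / \<sigma>) / \<sigma>)"
proof -
  let ?f = "\<lambda>u. indicat_real {v..<w} u *\<^sub>R (\<phi> (u / \<sigma>) / \<sigma>)"
  have "(LBINT u:{v..<w}. \<phi> (u / \<sigma>) / \<sigma>) = \<bar>\<sigma>\<bar> *\<^sub>R (\<integral>u. ?f (0 + \<sigma> * u) \<partial>lborel)"
    unfolding set_lebesgue_integral_def using assms by (intro lborel_integral_real_affine) auto
  also have "\<dots> = (\<integral>u. \<sigma> * ?f (0 + \<sigma> * u) \<partial>lborel)" using assms by simp
  also have "\<dots> = (LBINT u:{v / \<sigma>..<w / \<sigma>}. \<phi> u)"
    unfolding set_lebesgue_integral_def using assms
    by (intro Bochner_Integration.integral_cong refl) (auto simp: indicator_def field_simps)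
  also have "\<dots> = normal_tail (v / \<sigma>) - normal_tail (w / \<sigma>)"
    using assms by (intro normal_tail_diff[symmetric] divide_right_mono) auto
  finally show "(LBINT u:{v..<w}. \<phi> (u / \<sigma>) / \<sigma>) = normal_tail (v / \<sigma>) - normal_tail (w / \<sigma>)" .
  have "continuous_on {v..w} (\<lambda>u. \<phi> (u / \<sigma>) / \<sigma>)"
    unfolding std_normal_density_def using assms by (intro continuous_intros) auto
  then have "set_integrable lborel {v..w} (\<lambda>u. \<phi> (u / \<sigma>) / \<sigma>)"
    by (rule borel_integrable_atLeastAtMost')
  then show "set_integrable lborel {v..<w} (\<lambda>u. \<phi> (u / \<sigma>) / \<sigma>)"
    by (rule set_integrable_subset) auto
qed

text \<open>The density is integrated up to \<open>\<theta> (1 + c)\<close>, where the saddle point reaches \<open>\<theta>\<close>; the Chernoff bound at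
  \<open>\<theta>\<close> takes care of the rest.\<close>

lemma smooth_tail_gaussian:
  fixes v x \<theta> :: real
  defines "S \<equiv> primes_upto x"
  defines "c \<equiv> model_variance S"
  assumes th: "0 < \<theta>" "\<theta> \<le> 1/2" and v: "\<bar>v\<bar> \<le> \<theta> * (1 + c)" and c: "2 \<le> c"
  shows "\<bar>smooth_tail (random_phases S) (cos_sum S) v - normal_tail (v / sqrt (1 + c))\<bar> \<le>
    saddle_const * (\<theta>\<^sup>2 + 1 / (1 + c)) * normal_tail (v / sqrt (1 + c)) + (2 + 8 * exp 8) * exp (- \<theta>\<^sup>2 * (1 + c) / 2)"
proof -
  let ?M = "random_phases S" and ?Y = "cos_sum S"
  interpret R: prob_space ?M by (rule prob_space_random_phases)
  define \<sigma> where "\<sigma> = sqrt (1 + c)"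
  have \<sigma>: "0 < \<sigma>" "\<sigma> * \<sigma> = 1 + c" using c by (auto simp: \<sigma>_def)
  define U where "U = \<theta> * (1 + c)"
  define \<rho> where "\<rho> = saddle_const * (\<theta>\<^sup>2 + 1 / (1 + c))"
  have K0: "0 \<le> saddle_const" by (simp add: saddle_const_def)
  have vU: "v \<le> U" using v by (simp add: U_def)
  let ?g = "\<lambda>u. \<phi> (u / \<sigma>) / \<sigma>"
  note D = R.smooth_tail_diff[OF cos_sum_measurable vU]
  note G = normal_tail_interval_scaled[OF \<sigma>(1) vU]
  have pt: "\<bar>smooth_density ?M ?Y u - ?g u\<bar> \<le> \<rho> * ?g u" if "u \<in> {v..<U}" for u
  proof -
    define s where "s = u / (1 + c)"
    have "\<bar>u\<bar> \<le> \<theta> * (1 + c)" using that v by (auto simp: U_def)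
    then have s: "\<bar>s\<bar> \<le> \<theta>" using c by (simp add: s_def abs_divide pos_divide_le_eq)
    have u: "u = s * (1 + c)" using c by (simp add: s_def)
    have us: "u / \<sigma> = s * \<sigma>" using \<sigma>(1) unfolding u \<sigma>(2)[symmetric] by simp
    have "\<bar>smooth_density ?M ?Y (s * (1 + c)) - \<phi> (s * sqrt (1 + c)) / sqrt (1 + c)\<bar> \<le>
        saddle_const * (s\<^sup>2 + 1 / (1 + c)) * (\<phi> (s * sqrt (1 + c)) / sqrt (1 + c))"
      using s th c unfolding S_def c_def by (intro smooth_density_gaussian) auto
    then have "\<bar>smooth_density ?M ?Y u - ?g u\<bar> \<le> saddle_const * (s\<^sup>2 + 1 / (1 + c)) * ?g u"
      unfolding us \<sigma>_def[symmetric] u[symmetric] .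
    also have "\<dots> \<le> \<rho> * ?g u"
      unfolding \<rho>_def using s K0 \<sigma> power_mono[of "\<bar>s\<bar>" \<theta> 2]
      by (intro mult_right_mono mult_left_mono add_right_mono) auto
    finally show ?thesis .
  qed
  have "\<bar>(smooth_tail ?M ?Y v - smooth_tail ?M ?Y U) - (normal_tail (v / \<sigma>) - normal_tail (U / \<sigma>))\<bar>
     = \<bar>LBINT u:{v..<U}. smooth_density ?M ?Y u - ?g u\<bar>"
    unfolding D(1) G(1)[symmetric] using D(2) G(2) by (subst set_integral_diff) auto
  also have "\<dots> \<le> (LBINT u:{v..<U}. \<bar>smooth_density ?M ?Y u - ?g u\<bar>)"
    using set_integral_diff(1)[OF D(2) G(2)] by (intro set_integral_norm_bound[where 'a = real, simplified]) auto
  also have "\<dots> \<le> (LBINT u:{v..<U}. \<rho> * ?g u)"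
    using set_integral_diff(1)[OF D(2) G(2)] pt G(2)
    by (intro set_integral_mono set_integrable_abs set_integrable_mult_right) auto
  also have "\<dots> = \<rho> * (normal_tail (v / \<sigma>) - normal_tail (U / \<sigma>))"
    unfolding G(1)[symmetric] by simp
  also have "\<dots> \<le> \<rho> * normal_tail (v / \<sigma>)"
    using K0 c normal_tail_nonneg[of "U / \<sigma>"] by (intro mult_left_mono) (auto simp: \<rho>_def)
  finally have 1: "\<bar>(smooth_tail ?M ?Y v - smooth_tail ?M ?Y U) - (normal_tail (v / \<sigma>) - normal_tail (U / \<sigma>))\<bar> \<le> \<rho> * normal_tail (v / \<sigma>)" .
  define E where "E = exp (- \<theta>\<^sup>2 * (1 + c) / 2)"
  have "U / \<sigma> = \<theta> * (\<sigma> * \<sigma>) / \<sigma>" by (simp only: U_def \<sigma>(2))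
  then have Us: "U / \<sigma> = \<theta> * \<sigma>" using \<sigma>(1) by simp
  have "normal_tail (U / \<sigma>) \<le> exp (- (U / \<sigma>) * (U / \<sigma>) + (U / \<sigma>)\<^sup>2 / 2)"
    unfolding Us using th \<sigma> by (intro normal_tail_chernoff) auto
  also have "- (U / \<sigma>) * (U / \<sigma>) + (U / \<sigma>)\<^sup>2 / 2 = - \<theta>\<^sup>2 * (1 + c) / 2"
    unfolding Us \<sigma>(2)[symmetric] by (simp add: power2_eq_square)
  finally have 2: "normal_tail (U / \<sigma>) \<le> E" by (simp add: E_def)
  have "smooth_tail ?M ?Y U \<le> exp (- \<theta> * U + \<theta>\<^sup>2 / 2) * (LINT \<omega>|?M. exp (\<theta> * ?Y \<omega>))"
    using th by (intro R.smooth_tail_chernoff cos_sum_measurable random_phases_bounded_integrable continuous_intros) auto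
  also have "\<dots> \<le> exp (- \<theta> * U + \<theta>\<^sup>2 / 2) * ((1 + 8 * exp 8) * exp (\<theta>\<^sup>2 / 2 * c))"
    using random_phases_mgf_small[of \<theta> x] th by (intro mult_left_mono) (auto simp: S_def c_def)
  also have "\<dots> = (1 + 8 * exp 8) * (exp (- \<theta> * U + \<theta>\<^sup>2 / 2) * exp (\<theta>\<^sup>2 / 2 * c))" by simp
  also have "exp (- \<theta> * U + \<theta>\<^sup>2 / 2) * exp (\<theta>\<^sup>2 / 2 * c) = E"
    unfolding exp_add[symmetric] E_def by (rule arg_cong[where f = exp]) (simp add: U_def power2_eq_square field_simps)
  finally have 3: "smooth_tail ?M ?Y U \<le> (1 + 8 * exp 8) * E" .
  have 4: "0 \<le> smooth_tail ?M ?Y U" by (simp add: smooth_tail_def normal_tail_nonneg)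
  have 5: "0 \<le> normal_tail (U / \<sigma>)" by (rule normal_tail_nonneg)
  have "(2 + 8 * exp 8) * E = (1 + 8 * exp 8) * E + E" by (simp add: distrib_right)
  then show ?thesis
    using 1 2 3 4 5 unfolding \<sigma>_def[symmetric] \<rho>_def[symmetric] E_def[symmetric] by linarith
qed

section \<open>Large deviations of the Dirichlet polynomial\<close>

lemma uniform_time_prob:
  assumes "0 < T" "A \<in> sets borel"
  shows "measure (uniform_time T) A = 1 / T * measure lebesgue ({T..2 * T} \<inter> A)"
proof -
  have "measure (uniform_time T) A = measure lborel ({T..2 * T} \<inter> A) / measure lborel {T..2 * T}"
    unfolding uniform_time_def using assms by (intro measure_uniform_measure) auto
  also have "measure lborel ({T..2 * T} \<inter> A) = measure lebesgue ({T..2 * T} \<inter> A)"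
    using assms by (intro measure_completion[symmetric]) auto
  finally show ?thesis using assms by simp
qed

abbreviation loglog :: "real \<Rightarrow> real" where
  "loglog T \<equiv> ln (ln T)"

lemma filterlim_loglog: "filterlim loglog at_top at_top"
  by real_asymp

lemma eventually_loglog:
  assumes "eventually P at_top"
  shows "eventually (\<lambda>T. P (loglog T)) at_top"
  using assms filterlim_loglog by (rule eventually_compose_filterlim)

lemma cutoff_bounds:
  "\<forall>\<^sub>F T in at_top. exp 1 \<le> cutoff T \<and> cutoff T = exp (exp (loglog T) / (loglog T)\<^sup>2) \<and> T = exp (exp (loglog T)) \<and>
     loglog T / 2 \<le> (\<Sum>p\<in>primes_upto (cutoff T). 1 / real p) \<and>
     (\<Sum>p\<in>primes_upto (cutoff T). 1 / real p) \<le> 7 * loglog T"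
proof -
  have 1: "\<forall>\<^sub>F L::real in at_top. 1 \<le> exp L / L\<^sup>2" by real_asymp
  have 2: "\<forall>\<^sub>F L::real in at_top. L / 2 \<le> ln (exp L / L\<^sup>2) - ln 2" by real_asymp
  have 3: "\<forall>\<^sub>F L::real in at_top. 6 * ln (1 + exp L / L\<^sup>2) \<le> 7 * L" by real_asymp
  show ?thesis
    using eventually_loglog[OF 1] eventually_loglog[OF 2] eventually_loglog[OF 3] eventually_gt_at_top[of "exp 1"]
  proof eventually_elim
    case (elim T)
    define L where "L = loglog T"
    have T0: "0 < T" by (rule less_trans[OF exp_gt_zero elim(4)])
    then have "1 < ln T" using elim(4) by (metis exp_less_cancel_iff exp_ln)
    then have eL: "exp L = ln T" by (simp add: L_def)
    have x: "cutoff T = exp (exp L / L\<^sup>2)"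
      unfolding eL using T0 by (simp add: cutoff_def powr_def L_def)
    have e1: "exp 1 \<le> cutoff T" unfolding x using elim(1) by (simp add: L_def)
    have lnx: "ln (cutoff T) = exp L / L\<^sup>2" by (simp add: x)
    show ?case
      using e1 x eL T0 prime_harmonic_lower[OF e1] prime_harmonic_upper[OF e1] elim(2,3)
      unfolding lnx L_def by auto
  qed
qed

definition re_poly :: "real \<Rightarrow> real \<Rightarrow> real" where
  "re_poly T t = Re (prime_dirichlet_poly (cutoff T) t)"

lemma re_poly_eq: "re_poly T t = cos_sum (primes_upto (cutoff T)) (\<lambda>p. t * ln (real p))"
  by (simp add: re_poly_def Re_prime_dirichlet_poly)

lemma re_poly_measurable [measurable]: "re_poly T \<in> borel_measurable borel"
  unfolding re_poly_eq[abs_def] cos_sum_def by measurable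

abbreviation phases :: "real \<Rightarrow> (nat \<Rightarrow> real) measure" where
  "phases T \<equiv> random_phases (primes_upto (cutoff T))"

abbreviation model :: "real \<Rightarrow> (nat \<Rightarrow> real) \<Rightarrow> real" where
  "model T \<equiv> cos_sum (primes_upto (cutoff T))"

text \<open>The bound on even moments at \<open>l = 1 / sqrt (\<Sum> 1/p)\<close>, where its exponential factor is bounded.\<close>

lemma model_second_moment_le:
  assumes "finite S" "0 < (\<Sum>p\<in>S. 1 / real p)"
  shows "(LINT \<theta>|random_phases S. (cos_sum S \<theta>)\<^sup>2) \<le> 8 * (\<Sum>p\<in>S. 1 / real p)"
proof -
  define V where "V = (\<Sum>p\<in>S. 1 / real p)"
  have V: "0 < V" using assms by (simp add: V_def)
  have "(LINT \<theta>|random_phases S. cos_sum S \<theta> ^ (2 * 1)) / fact (2 * 1) \<le>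
     2 * exp ((1 / sqrt V)\<^sup>2 / 2 * (\<Sum>p\<in>S. 1 / real p)) / (1 / sqrt V) ^ (2 * 1)"
    using V by (intro random_phases_moment_le assms(1)) auto
  also have "\<dots> = 2 * exp (1 / 2) * V"
    using V by (simp add: V_def[symmetric] power_divide)
  also have "\<dots> \<le> 2 * 2 * V"
    using V exp_bound_half[of "1/2 :: real"] by (intro mult_right_mono) auto
  finally show ?thesis by (simp add: V_def)
qed

text \<open>The rate 1/10000 is not optimal.  Its only role is that the error is a negative
  power of \<open>ln T\<close>, against which a factor \<open>exp (\<Delta>\<^sup>2)\<close> with \<open>\<Delta>\<^sup>2 = o(loglog T)\<close> is harmless.\<close>

lemma smooth_tail_transfer:
  "\<forall>\<^sub>F T in at_top. \<forall>v. \<bar>v\<bar> \<le> loglog T \<longrightarrow>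
     \<bar>smooth_tail (uniform_time T) (re_poly T) v - smooth_tail (phases T) (model T) v\<bar> \<le> exp (- loglog T / 10000)"
proof -
  define \<delta> where "\<delta> L = 2 * exp (sqrt (L / 504)) * exp (- (exp L / 2)) + 4 * exp (- (L\<^sup>2 / 16)) + 4 * exp (- (L / 504) / 4)" for L :: real
  have 1: "\<forall>\<^sub>F L::real in at_top. 16 \<le> L" by (rule eventually_ge_at_top)
  have 2: "\<forall>\<^sub>F L::real in at_top. (exp (L / 4032) + L) * \<delta> L + 4 * (112 * L + 2 * exp (- (exp L / 2)) + 2) / (exp (L / 4032))\<^sup>2
      \<le> exp (- L / 10000)"
    unfolding \<delta>_def by real_asymp
  have 3: "\<forall>\<^sub>F L::real in at_top. L \<le> exp (L / 4032)" by real_asymp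
  show ?thesis
    using cutoff_bounds eventually_loglog[OF 1] eventually_loglog[OF 2] eventually_loglog[OF 3]
  proof eventually_elim
    case (elim T)
    define L where "L = loglog T"
    define x where "x = cutoff T"
    define S where "S = primes_upto x"
    define V where "V = (\<Sum>p\<in>S. 1 / real p)"
    let ?U = "uniform_time T" and ?X = "re_poly T" and ?R = "random_phases S" and ?Y = "cos_sum S"
    have fin: "finite S" by (simp add: S_def finite_primes_upto)
    have L: "16 \<le> L" using elim(2) by (simp add: L_def)
    have V: "L / 2 \<le> V" "V \<le> 7 * L" and x: "exp 1 \<le> x" "x = exp (exp L / L\<^sup>2)" and T: "T = exp (exp L)"
      using elim(1) by (auto simp: L_def V_def S_def x_def)
    have T0: "0 < T" unfolding T by simp
    have "1 \<le> exp (1::real)" by simp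
    then have x1: "1 \<le> x" using x by linarith
    \<comment> \<open>Smoothing costs \<open>exp (- A\<^sup>2 / 4) = exp (- L / 2016)\<close> below, and \<open>W\<close> is the square root of the inverse: both
       \<open>W exp (- L / 2016)\<close> and the Chebyshev term \<open>1 / W\<^sup>2\<close> are small.\<close>
    define W where "W = exp (L / 4032)"
    \<comment> \<open>Half the order of the highest moment used; \<open>x ^ (4 N) \<le> sqrt T\<close>.\<close>
    define N where "N = nat \<lfloor>L\<^sup>2 / 8\<rfloor>"
    define n where "n = N - 1"
    have "16 * 16 \<le> L\<^sup>2" unfolding power2_eq_square using L by (intro mult_mono) auto
    then have N: "L\<^sup>2 / 16 \<le> real N" "real N \<le> L\<^sup>2 / 8" "1 \<le> N"
      unfolding N_def by linarith+
    have n: "real n + 1 = real N" using N by (simp add: n_def)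
    \<comment> \<open>The highest frequency used: since \<open>\<Sum> 1/p \<le> 7 L\<close>, the quantity \<open>9/2 A\<^sup>2 \<Sum> 1/p\<close> is at most \<open>L\<^sup>2 / 16 \<le> N\<close>.\<close>
    define A where "A = sqrt (L / 504)"
    have A: "0 < A" "A\<^sup>2 = L / 504" using L by (auto simp: A_def)
    have xk: "x ^ k / T \<le> exp (- (exp L / 2))" if "k \<le> 4 * N" for k
    proof -
      have "x ^ k \<le> x ^ (4 * N)" using x1 that by (rule power_increasing[rotated])
      also have "\<dots> = exp (real (4 * N) * (exp L / L\<^sup>2))" unfolding x by (simp only: exp_of_nat_mult)
      also have "\<dots> \<le> exp (L\<^sup>2 / 2 * (exp L / L\<^sup>2))"
        using N by (intro exp_le_cancel_iff[THEN iffD2] mult_right_mono) auto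
      also have "L\<^sup>2 / 2 * (exp L / L\<^sup>2) = exp L / 2" using L by simp
      finally have "x ^ k / T \<le> exp (exp L / 2) / T" using T0 by (intro divide_right_mono) auto
      also have "\<dots> = exp (- (exp L / 2))" unfolding T by (simp add: exp_diff[symmetric])
      finally show ?thesis .
    qed
    have AV: "9 / 2 * A\<^sup>2 * V \<le> real n + 1"
    proof -
      have "9 / 2 * A\<^sup>2 * V \<le> 9 / 2 * A\<^sup>2 * (7 * L)" using V by (intro mult_left_mono) auto
      also have "\<dots> = L\<^sup>2 / 16" unfolding A by (simp add: power2_eq_square)
      finally show ?thesis using N n by linarith
    qed
    have char: "norm ((CLINT t|?U. iexp (\<tau> * re_poly T t)) - (CLINT \<theta>|?R. iexp (\<tau> * cos_sum S \<theta>)))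
       \<le> 2 * exp A * exp (- (exp L / 2)) + 4 * exp (- (L\<^sup>2 / 16))" if "\<bar>\<tau>\<bar> \<le> A" for \<tau>
    proof -
      have "norm ((CLINT t|?U. iexp (\<tau> * re_poly T t)) - (CLINT \<theta>|?R. iexp (\<tau> * cos_sum S \<theta>)))
         \<le> 2 * exp A * x ^ (4 * n + 4) / T + 4 * exp (- real (n + 1))"
        using char_close[OF T0 x1 A(1) that, of n] AV by (simp add: re_poly_eq S_def V_def x_def)
      also have "2 * exp A * x ^ (4 * n + 4) / T = 2 * exp A * (x ^ (4 * n + 4) / T)" by simp
      also have "\<dots> \<le> 2 * exp A * exp (- (exp L / 2))"
        using N by (intro mult_left_mono xk) (auto simp: n_def)
      also have "4 * exp (- real (n + 1)) \<le> 4 * exp (- (L\<^sup>2 / 16))" using N n by simp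
      finally show ?thesis by simp
    qed
    have dens: "\<bar>smooth_density ?U ?X u - smooth_density ?R ?Y u\<bar> \<le> \<delta> L" for u
    proof -
      have "\<bar>smooth_density ?U ?X u - smooth_density ?R ?Y u\<bar> \<le>
          (2 * exp A * exp (- (exp L / 2)) + 4 * exp (- (L\<^sup>2 / 16))) + 4 * exp (- A\<^sup>2 / 4)"
        by (rule smooth_density_close[OF prob_space_uniform_time[OF T0] prob_space_random_phases _ cos_sum_measurable _ _ char])
          (use A in auto)
      then show ?thesis unfolding A(2) by (simp add: \<delta>_def A_def)
    qed
    have d0: "0 \<le> \<delta> L" using dens[of 0] by linarith
    have Xle: "\<bar>re_poly T t\<bar> \<le> x" for t
      using abs_cos_sum_le[of S] sum_inverse_sqrt_primes_le[of x] x1 unfolding re_poly_eq S_def x_def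
      by (meson order_trans zero_le_one)
    interpret U: prob_space "?U" by (rule prob_space_uniform_time[OF T0])
    have X2: "integrable ?U (\<lambda>t. (re_poly T t)\<^sup>2)"
    proof (rule U.integrable_const_bound[where B = "x\<^sup>2"])
      show "AE t in ?U. norm ((re_poly T t)\<^sup>2) \<le> x\<^sup>2"
        using Xle unfolding real_norm_def power_abs by (intro AE_I2 power_mono) auto
    qed measurable
    have Y2: "integrable ?R (\<lambda>\<theta>. (cos_sum S \<theta>)\<^sup>2)"
      by (intro random_phases_bounded_integrable continuous_intros)
    have EY: "(LINT \<theta>|?R. (cos_sum S \<theta>)\<^sup>2) \<le> 56 * L"
      using model_second_moment_le[OF fin] V L unfolding V_def by linarith
    have "\<bar>(LINT t|?U. (re_poly T t)\<^sup>2) - (LINT \<theta>|?R. (cos_sum S \<theta>)\<^sup>2)\<bar> \<le> 2 * x ^ (2 * 2) / T"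
      using moments_close[OF T0 x1, of 2] by (simp add: re_poly_eq S_def x_def)
    also have "\<dots> \<le> 2 * exp (- (exp L / 2))" using xk[of "2 * 2"] N by simp
    finally have EX: "(LINT t|?U. (re_poly T t)\<^sup>2) \<le> 56 * L + 2 * exp (- (exp L / 2))"
      using EY by linarith
    show ?case
    proof (intro allI impI)
      fix v assume "\<bar>v\<bar> \<le> loglog T"
      then have v: "\<bar>v\<bar> \<le> L" by (simp add: L_def)
      have LW: "L \<le> W" using elim(4) by (simp add: L_def W_def)
      have "\<bar>smooth_tail (uniform_time T) (re_poly T) v - smooth_tail (random_phases S) (cos_sum S) v\<bar> \<le> (W - v) * \<delta> L +
         4 * ((\<integral>t. (re_poly T t)\<^sup>2 \<partial>uniform_time T) + (\<integral>\<theta>. (cos_sum S \<theta>)\<^sup>2 \<partial>random_phases S) + 2) / W\<^sup>2"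
        using v LW by (intro smooth_tail_close[OF prob_space_uniform_time[OF T0] prob_space_random_phases _ cos_sum_measurable X2 Y2 _ _ dens])
           (auto simp: W_def)
      also have "\<dots> \<le> (W + L) * \<delta> L + 4 * (112 * L + 2 * exp (- (exp L / 2)) + 2) / W\<^sup>2"
      proof -
        have "(\<integral>t. (re_poly T t)\<^sup>2 \<partial>uniform_time T) + (\<integral>\<theta>. (cos_sum S \<theta>)\<^sup>2 \<partial>random_phases S) + 2 \<le>
            112 * L + 2 * exp (- (exp L / 2)) + 2"
          using EX EY by linarith
        moreover have "W - v \<le> W + L" using v by linarith
        ultimately show ?thesis using d0
          by (intro add_mono[of "(W - v) * \<delta> L"] mult_right_mono divide_right_mono) (simp_all only: mult_left_mono zero_le_numeral zero_le_power2)
      qed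
      also have "\<dots> \<le> exp (- L / 10000)" using elim(3) by (simp add: L_def W_def)
      finally show "\<bar>smooth_tail (uniform_time T) (re_poly T) v - smooth_tail (phases T) (model T) v\<bar> \<le> exp (- loglog T / 10000)"
        by (simp add: S_def x_def L_def)
    qed
  qed
qed

lemma normal_tail_ge_exp: "exp (- 2) / sqrt (2 * pi) * exp (- a\<^sup>2) \<le> normal_tail a"
proof -
  have "1 + \<bar>a\<bar> \<le> exp \<bar>a\<bar>" by (rule exp_ge_add_one_self)
  then have "exp (- \<bar>a\<bar>) \<le> 1 / (1 + \<bar>a\<bar>)"
    by (simp add: exp_minus inverse_eq_divide divide_left_mono)
  moreover have "0 \<le> (\<bar>a\<bar> - 1)\<^sup>2" by simp
  then have "\<bar>a\<bar> \<le> a\<^sup>2 / 2 + 1 / 2" by (simp add: power2_diff)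
  then have "exp (- 2 + - a\<^sup>2) \<le> exp (- (3/2) + - a\<^sup>2 / 2 + - \<bar>a\<bar>)" by simp
  ultimately have "exp (- 2) * exp (- a\<^sup>2) \<le> exp (- (3/2)) * exp (- a\<^sup>2 / 2) * (1 / (1 + \<bar>a\<bar>))"
    unfolding exp_add by (meson mult_left_mono order_trans exp_ge_zero mult_nonneg_nonneg)
  then have "exp (- 2) * exp (- a\<^sup>2) / sqrt (2 * pi) \<le> exp (- (3/2)) * exp (- a\<^sup>2 / 2) * (1 / (1 + \<bar>a\<bar>)) / sqrt (2 * pi)"
    by (rule divide_right_mono) simp
  also have "\<dots> = exp (- 3/2) * \<phi> a / (1 + \<bar>a\<bar>)"
    by (simp add: std_normal_density_def)
  also have "\<dots> \<le> normal_tail a" by (rule normal_tail_ge_density)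
  finally show ?thesis by simp
qed

text \<open>Given \<open>\<epsilon>\<close>, fix \<open>\<theta>\<close> so small that the relative error \<open>\<theta>\<^sup>2\<close> of \<open>smooth_tail_gaussian\<close> is
  acceptable.  All other errors tend to 0: the absolute ones are compared with the lower bound \<open>normal_tail_ge_exp\<close>, and the
  passage from \<open>v / sqrt (1 + c)\<close> to \<open>\<Delta>\<close> is a perturbation as in \<open>normal_tail_perturb\<close>.  The variable \<open>\<kappa>\<close> makes room for the shifts
  by which the smoothing is removed.\<close>

lemma smooth_tail_asymptotics:
  fixes \<Delta> :: "real \<Rightarrow> real" and \<kappa> :: real
  assumes "\<Delta> \<in> o[at_top](\<lambda>T. sqrt (loglog T))"
  defines "v \<equiv> (\<lambda>T. \<Delta> T * sqrt (1/2 * (\<Sum>p\<in>primes_upto (cutoff T). 1 / real p)) + \<kappa>)"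
  shows "((\<lambda>T. smooth_tail (uniform_time T) (re_poly T) (v T) / normal_tail (\<Delta> T)) \<longlongrightarrow> 1) at_top"
proof (rule tendstoI)
  fix \<epsilon> :: real assume "0 < \<epsilon>"
  define c where "c T = 1/2 * (\<Sum>p\<in>primes_upto (cutoff T). 1 / real p)" for T
  define K where "K = saddle_const"
  have K: "0 < K" by (simp add: K_def saddle_const_def add_pos_pos)
  define k where "k = exp (- 2) / sqrt (2 * pi)"
  have k: "0 < k" by (simp add: k_def)
  define \<theta> where "\<theta> = min (1/2) (sqrt (\<epsilon> / (8 * K)))"
  have th: "0 < \<theta>" "\<theta> \<le> 1/2" using \<open>0 < \<epsilon>\<close> K by (auto simp: \<theta>_def)
  have "\<theta>\<^sup>2 \<le> (sqrt (\<epsilon> / (8 * K)))\<^sup>2" using th by (intro power_mono) (auto simp: \<theta>_def)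
  then have thK: "K * \<theta>\<^sup>2 \<le> \<epsilon> / 8" using \<open>0 < \<epsilon>\<close> K by (simp add: field_simps)
  \<comment> \<open>If \<open>\<bar>\<Delta>\<bar> \<le> \<eta> sqrt L\<close>, then \<open>exp (\<Delta>\<^sup>2)\<close> is at most \<open>exp (L / 160000)\<close> and \<open>exp (\<theta>\<^sup>2 L / 64)\<close>, less than the
     gains \<open>exp (L / 10000)\<close> and \<open>exp (\<theta>\<^sup>2 L / 8)\<close> of the two absolute errors.\<close>
  define \<eta> where "\<eta> = min (1/400) (\<theta> / 8)"
  have \<eta>: "0 < \<eta>" "\<eta> \<le> 1/400" "\<eta> \<le> \<theta> / 8" using th by (auto simp: \<eta>_def)
  \<comment> \<open>Bounds \<open>\<bar>v / sqrt (1 + c) - \<Delta>\<bar> (1 + \<bar>\<Delta>\<bar>)\<close> in terms of \<open>e = \<bar>\<Delta>\<bar> / sqrt L\<close>.\<close>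
  define r where "r e L = (4 * e + 2 * \<bar>\<kappa>\<bar>) * (e + 1 / sqrt L)" for e L
  define e where "e T = \<bar>\<Delta> T\<bar> / sqrt (loglog T)" for T
  have "((\<lambda>T. \<Delta> T / sqrt (loglog T)) \<longlongrightarrow> 0) at_top"
    using assms(1) by (rule smalloD_tendsto)
  then have "((\<lambda>T. \<bar>\<Delta> T / sqrt (loglog T)\<bar>) \<longlongrightarrow> 0) at_top"
    by (rule tendsto_rabs_zero)
  moreover have "\<forall>\<^sub>F T in at_top. \<bar>\<Delta> T / sqrt (loglog T)\<bar> = e T"
    using eventually_loglog[OF eventually_gt_at_top[of 0]] by eventually_elim (simp add: e_def abs_divide)
  ultimately have e0: "(e \<longlongrightarrow> 0) at_top"
    by (rule Lim_transform_eventually)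
  have "((\<lambda>L::real. 1 / sqrt L) \<longlongrightarrow> 0) at_top" by real_asymp
  then have "((\<lambda>T. 1 / sqrt (loglog T)) \<longlongrightarrow> 0) at_top"
    by (rule filterlim_compose[OF _ filterlim_loglog])
  then have "((\<lambda>T. exp 3 * r (e T) (loglog T)) \<longlongrightarrow> exp 3 * ((4 * 0 + 2 * \<bar>\<kappa>\<bar>) * (0 + 0))) at_top"
    unfolding r_def using e0 by (intro tendsto_intros)
  then have rlim: "((\<lambda>T. exp 3 * r (e T) (loglog T)) \<longlongrightarrow> 0) at_top" by simp
  have r1: "\<forall>\<^sub>F T in at_top. exp 3 * r (e T) (loglog T) < min 1 (\<epsilon> / 8)"
    using order_tendstoD(2)[OF rlim, of "min 1 (\<epsilon> / 8)"] \<open>0 < \<epsilon>\<close> by simp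
  have e1: "\<forall>\<^sub>F T in at_top. e T < \<eta>"
    using order_tendstoD(2)[OF e0 \<eta>(1)] .
  have a1: "\<forall>\<^sub>F L::real in at_top. exp (- L / 10000 + L / 160000) / k < \<epsilon> / 8"
  proof (rule order_tendstoD(2))
    show "((\<lambda>L::real. exp (- L / 10000 + L / 160000) / k) \<longlongrightarrow> 0) at_top" using k by real_asymp
  qed (use \<open>0 < \<epsilon>\<close> in simp)
  have a2: "\<forall>\<^sub>F L::real in at_top. (2 + 8 * exp 8) * exp (- \<theta>\<^sup>2 * (L / 4) / 2 + \<theta>\<^sup>2 * L / 64) / k < \<epsilon> / 8"
  proof (rule order_tendstoD(2))
    have "0 < \<theta>\<^sup>2" using th by simp
    then have "((\<lambda>L::real. exp (- (7 * \<theta>\<^sup>2 / 64) * L)) \<longlongrightarrow> 0) at_top" by real_asymp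
    then have "((\<lambda>L::real. (2 + 8 * exp 8) * exp (- (7 * \<theta>\<^sup>2 / 64) * L) / k) \<longlongrightarrow> (2 + 8 * exp 8) * 0 / k) at_top"
      using k by (intro tendsto_intros) auto
    then show "((\<lambda>L::real. (2 + 8 * exp 8) * exp (- \<theta>\<^sup>2 * (L / 4) / 2 + \<theta>\<^sup>2 * L / 64) / k) \<longlongrightarrow> 0) at_top"
      by (simp add: field_simps)
  qed (use \<open>0 < \<epsilon>\<close> in simp)
  have a3: "\<forall>\<^sub>F L::real in at_top. K * (1 / (1 + L / 4)) < \<epsilon> / 8"
  proof (rule order_tendstoD(2))
    have "((\<lambda>L::real. 1 / (1 + L / 4)) \<longlongrightarrow> 0) at_top" by real_asymp
    then have "((\<lambda>L::real. K * (1 / (1 + L / 4))) \<longlongrightarrow> K * 0) at_top" by (intro tendsto_intros)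
    then show "((\<lambda>L::real. K * (1 / (1 + L / 4))) \<longlongrightarrow> 0) at_top" by simp
  qed (use \<open>0 < \<epsilon>\<close> in simp)
  have a4: "\<forall>\<^sub>F L::real in at_top. 8 \<le> L" by (rule eventually_ge_at_top)
  have a5: "\<forall>\<^sub>F L::real in at_top. L / 200 + \<bar>\<kappa>\<bar> \<le> L" by real_asymp
  have a6: "\<forall>\<^sub>F L::real in at_top. \<theta> / 4 * (L / 4) + \<bar>\<kappa>\<bar> \<le> \<theta> * (L / 4)"
    using th by real_asymp
  show "\<forall>\<^sub>F T in at_top. dist (smooth_tail (uniform_time T) (re_poly T) (v T) / normal_tail (\<Delta> T)) 1 < \<epsilon>"
    using smooth_tail_transfer cutoff_bounds r1 e1 eventually_loglog[OF a1] eventually_loglog[OF a2]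
      eventually_loglog[OF a3] eventually_loglog[OF a4] eventually_loglog[OF a5] eventually_loglog[OF a6]
  proof eventually_elim
    case (elim T)
    define L where "L = loglog T"
    define C where "C = c T"
    define D where "D = \<Delta> T"
    define w where "w = v T"
    define \<sigma> where "\<sigma> = sqrt (1 + C)"
    define H where "H = normal_tail D"
    have H: "0 < H" unfolding H_def by (rule normal_tail_pos)
    have L: "8 \<le> L" using elim(8) by (simp add: L_def)
    have C: "L / 4 \<le> C" "C \<le> 7 / 2 * L" using elim(2) by (auto simp: C_def c_def L_def)
    have C2: "2 \<le> C" using C L by linarith
    have w: "w = D * sqrt C + \<kappa>" by (simp add: w_def v_def D_def C_def c_def)
    have sL: "0 < sqrt L" using L by simp
    have De: "\<bar>D\<bar> = e T * sqrt L" using sL by (simp add: e_def D_def L_def)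
    have eT: "0 \<le> e T" "e T < \<eta>" using elim(4) sL by (auto simp: e_def L_def)
    have D2: "D\<^sup>2 = (e T)\<^sup>2 * L"
    proof -
      have "D\<^sup>2 = \<bar>D\<bar>\<^sup>2" by simp
      also have "\<dots> = (e T)\<^sup>2 * L" unfolding De using L by (simp add: power_mult_distrib)
      finally show ?thesis .
    qed
    have e2: "(e T)\<^sup>2 \<le> \<eta>\<^sup>2" using eT by (intro power_mono) auto
    have "\<eta>\<^sup>2 \<le> (1/400)\<^sup>2" "\<eta>\<^sup>2 \<le> (\<theta> / 8)\<^sup>2"
      using power_mono[OF \<eta>(2), of 2] power_mono[OF \<eta>(3), of 2] \<eta>(1) by simp_all
    then have "(e T)\<^sup>2 \<le> 1/160000" "(e T)\<^sup>2 \<le> \<theta>\<^sup>2 / 64" using e2 by (auto simp: power_divide)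
    then have D2le: "D\<^sup>2 \<le> L / 160000" "D\<^sup>2 \<le> \<theta>\<^sup>2 * L / 64"
      unfolding D2 using L mult_right_mono[of "(e T)\<^sup>2" "1/160000" L] mult_right_mono[of "(e T)\<^sup>2" "\<theta>\<^sup>2 / 64" L] by auto
    have Dabs: "\<bar>D\<bar> * sqrt C \<le> 2 * e T * L" and DC: "\<bar>D\<bar> * sqrt C \<le> 2 * e T * C"
    proof -
      have "sqrt C \<le> 2 * sqrt L"
        using C L real_sqrt_le_mono[of C "4 * L"] by (simp add: real_sqrt_mult)
      then have "sqrt L * sqrt C \<le> sqrt L * (2 * sqrt L)" using sL by (intro mult_left_mono) auto
      also have "\<dots> = 2 * L" using L by simp
      finally have "sqrt L * sqrt C \<le> 2 * L" .
      then have "e T * (sqrt L * sqrt C) \<le> e T * (2 * L)" using eT L by (intro mult_left_mono) auto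
      then show "\<bar>D\<bar> * sqrt C \<le> 2 * e T * L" by (simp add: De mult_ac)
      have "sqrt L \<le> 2 * sqrt C"
        using C L real_sqrt_le_mono[of L "4 * C"] by (simp add: real_sqrt_mult)
      then have "sqrt L * sqrt C \<le> 2 * sqrt C * sqrt C" using C2 by (intro mult_right_mono) auto
      also have "\<dots> = 2 * C" using C2 by simp
      finally have "sqrt L * sqrt C \<le> 2 * C" .
      then have "e T * (sqrt L * sqrt C) \<le> e T * (2 * C)" using eT C2 by (intro mult_left_mono) auto
      then show "\<bar>D\<bar> * sqrt C \<le> 2 * e T * C" by (simp add: De mult_ac)
    qed
    have wabs: "\<bar>w\<bar> \<le> \<bar>D\<bar> * sqrt C + \<bar>\<kappa>\<bar>"
      unfolding w using C2 by (intro order_trans[OF abs_triangle_ineq]) (simp add: abs_mult)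
    have "2 * e T * L \<le> L / 200" using eT \<eta> L mult_right_mono[of "e T" "1/400" L] by linarith
    then have wL: "\<bar>w\<bar> \<le> L" using wabs Dabs elim(9) by (simp add: L_def)
    have "2 * e T * C \<le> \<theta> / 4 * C" using eT \<eta> C2 by (intro mult_right_mono) auto
    moreover have "\<theta> / 4 * (C - L / 4) \<le> \<theta> * (C - L / 4)" using th C by (intro mult_right_mono) auto
    then have "\<theta> / 4 * C + \<bar>\<kappa>\<bar> \<le> \<theta> * C" using elim(10) by (simp add: L_def right_diff_distrib)
    moreover have "\<theta> * C \<le> \<theta> * (1 + C)" using th by simp
    ultimately have w\<theta>: "\<bar>w\<bar> \<le> \<theta> * (1 + C)" using wabs DC by linarith
    define X where "X = smooth_tail (uniform_time T) (re_poly T) w"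
    define Y where "Y = smooth_tail (phases T) (model T) w"
    have XY: "\<bar>X - Y\<bar> \<le> exp (- L / 10000)"
      using elim(1) wL by (simp add: X_def Y_def L_def)
    have YN: "\<bar>Y - normal_tail (w / \<sigma>)\<bar> \<le> K * (\<theta>\<^sup>2 + 1 / (1 + C)) * normal_tail (w / \<sigma>) + (2 + 8 * exp 8) * exp (- \<theta>\<^sup>2 * (1 + C) / 2)"
      using smooth_tail_gaussian[OF th, of w "cutoff T"] w\<theta> C2 by (simp add: Y_def K_def \<sigma>_def C_def c_def)
    define R where "R = exp 3 * r (e T) L"
    have R: "R < 1" "R < \<epsilon> / 8" using elim(3) by (auto simp: R_def L_def)
    have NH: "\<bar>normal_tail (w / \<sigma>) - H\<bar> \<le> R * H"
    proof -
      have s: "0 < sqrt C" "sqrt C \<le> \<sigma>" "sqrt L \<le> 2 * sqrt C"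
        using C2 C real_sqrt_le_mono[of L "4 * C"] by (auto simp: \<sigma>_def real_sqrt_mult)
      have \<sigma>0: "0 < \<sigma>" using s by linarith
      have dif: "0 \<le> \<sigma> - sqrt C" "\<sigma> - sqrt C \<le> 1 / \<sigma>"
      proof -
        have "\<sigma> * \<sigma> - sqrt C * \<sigma> \<le> \<sigma> * \<sigma> - sqrt C * sqrt C"
          using mult_left_mono[OF s(2), of "sqrt C"] s(1) by simp
        also have "\<dots> = 1" using C2 by (simp add: \<sigma>_def)
        finally show "\<sigma> - sqrt C \<le> 1 / \<sigma>" using \<sigma>0 by (simp add: field_simps)
      qed (use s in simp)
      have eqd: "w / \<sigma> - D = - (D * (\<sigma> - sqrt C)) / \<sigma> + \<kappa> / \<sigma>"
        unfolding w using \<sigma>0 by (simp add: field_simps)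
      have "\<bar>w / \<sigma> - D\<bar> \<le> \<bar>D\<bar> * (\<sigma> - sqrt C) / \<sigma> + \<bar>\<kappa>\<bar> / \<sigma>"
        unfolding eqd using dif \<sigma>0 by (intro order_trans[OF abs_triangle_ineq]) (simp add: abs_mult abs_divide)
      also have "\<dots> \<le> \<bar>D\<bar> * (1 / \<sigma>) / \<sigma> + \<bar>\<kappa>\<bar> / \<sigma>"
        using dif \<sigma>0 by (intro add_right_mono divide_right_mono mult_left_mono) auto
      also have "\<dots> = \<bar>D\<bar> / (\<sigma> * \<sigma>) + \<bar>\<kappa>\<bar> / \<sigma>" by simp
      also have "\<dots> \<le> \<bar>D\<bar> / (L / 4) + \<bar>\<kappa>\<bar> / (sqrt L / 2)"
      proof -
        have "sqrt L / 2 \<le> \<sigma>" using s by linarith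
        moreover have "L / 4 \<le> \<sigma> * \<sigma>" using C C2 by (simp add: \<sigma>_def)
        ultimately show ?thesis using L sL \<sigma>0 by (intro add_mono divide_left_mono mult_pos_pos) simp_all
      qed
      also have "\<dots> = (4 * e T + 2 * \<bar>\<kappa>\<bar>) / sqrt L"
        unfolding De using L sL real_sqrt_mult_self[of L] by (simp add: field_simps)
      finally have h: "\<bar>w / \<sigma> - D\<bar> \<le> (4 * e T + 2 * \<bar>\<kappa>\<bar>) / sqrt L" .
      have r0: "0 \<le> r (e T) L" using eT sL by (simp add: r_def)
      have "\<bar>w / \<sigma> - D\<bar> * (1 + \<bar>D\<bar>) \<le> (4 * e T + 2 * \<bar>\<kappa>\<bar>) / sqrt L * (1 + e T * sqrt L)"
        using h eT De by (intro mult_mono) auto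
      also have "\<dots> = r (e T) L" using sL by (simp add: r_def field_simps)
      finally have hr: "\<bar>w / \<sigma> - D\<bar> * (1 + \<bar>D\<bar>) \<le> r (e T) L" .
      have "1 * r (e T) L \<le> R" unfolding R_def using r0 by (intro mult_right_mono) auto
      then have "\<bar>w / \<sigma> - D\<bar> * (1 + \<bar>D\<bar>) \<le> 1" using hr R by linarith
      then have "\<bar>normal_tail (w / \<sigma>) - H\<bar> \<le> exp 3 * (\<bar>w / \<sigma> - D\<bar> * (1 + \<bar>D\<bar>)) * H"
        unfolding H_def by (rule normal_tail_perturb)
      also have "\<dots> \<le> R * H"
        unfolding R_def using hr H by (intro mult_right_mono mult_left_mono) auto
      finally show ?thesis .
    qed
    have "R * H \<le> 1 * H" using R H by (intro mult_right_mono) auto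
    then have N2: "normal_tail (w / \<sigma>) \<le> 2 * H" using NH by linarith
    have Hk: "k * exp (- D\<^sup>2) \<le> H" unfolding k_def H_def by (rule normal_tail_ge_exp)
    have expH: "exp q \<le> exp (q + D\<^sup>2) / k * H" for q
    proof -
      have "exp q = exp (q + D\<^sup>2) / k * (k * exp (- D\<^sup>2))"
        using k by (simp flip: exp_add)
      also have "\<dots> \<le> exp (q + D\<^sup>2) / k * H" using k by (intro mult_left_mono Hk) auto
      finally show ?thesis .
    qed
    have T1: "exp (- L / 10000) \<le> \<epsilon> / 8 * H"
    proof -
      have "exp (- L / 10000) \<le> exp (- L / 10000 + D\<^sup>2) / k * H" by (rule expH)
      also have "\<dots> \<le> exp (- L / 10000 + L / 160000) / k * H"
        using D2le k H by (intro mult_right_mono divide_right_mono) auto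
      also have "\<dots> \<le> \<epsilon> / 8 * H" using elim(5) H by (intro mult_right_mono) (auto simp: L_def)
      finally show ?thesis .
    qed
    have T2: "(2 + 8 * exp 8) * exp (- \<theta>\<^sup>2 * (1 + C) / 2) \<le> \<epsilon> / 8 * H"
    proof -
      have "\<theta>\<^sup>2 * (L / 4) \<le> \<theta>\<^sup>2 * (1 + C)" using C by (intro mult_left_mono) auto
      then have "- \<theta>\<^sup>2 * (1 + C) / 2 \<le> - \<theta>\<^sup>2 * (L / 4) / 2" by linarith
      then have "exp (- \<theta>\<^sup>2 * (1 + C) / 2) \<le> exp (- \<theta>\<^sup>2 * (L / 4) / 2)" by (rule exp_le_cancel_iff[THEN iffD2])
      also have "\<dots> \<le> exp (- \<theta>\<^sup>2 * (L / 4) / 2 + D\<^sup>2) / k * H" by (rule expH)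
      also have "\<dots> \<le> exp (- \<theta>\<^sup>2 * (L / 4) / 2 + \<theta>\<^sup>2 * L / 64) / k * H"
        using k H by (intro mult_right_mono divide_right_mono exp_le_cancel_iff[THEN iffD2] add_left_mono D2le) simp_all
      finally have "(2 + 8 * exp 8) * exp (- \<theta>\<^sup>2 * (1 + C) / 2) \<le>
          (2 + 8 * exp 8) * (exp (- \<theta>\<^sup>2 * (L / 4) / 2 + \<theta>\<^sup>2 * L / 64) / k * H)"
        by (intro mult_left_mono) auto
      also have "\<dots> = (2 + 8 * exp 8) * exp (- \<theta>\<^sup>2 * (L / 4) / 2 + \<theta>\<^sup>2 * L / 64) / k * H" by simp
      also have "\<dots> \<le> \<epsilon> / 8 * H" using elim(6) H by (intro mult_right_mono) (auto simp: L_def)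
      finally show ?thesis .
    qed
    have T3: "K * (\<theta>\<^sup>2 + 1 / (1 + C)) * normal_tail (w / \<sigma>) \<le> \<epsilon> / 4 * (2 * H)"
    proof (rule mult_mono)
      have "1 / (1 + C) \<le> 1 / (1 + L / 4)" using C L by (intro divide_left_mono) auto
      then have "K * (1 / (1 + C)) \<le> K * (1 / (1 + L / 4))" using K by (intro mult_left_mono) auto
      then show "K * (\<theta>\<^sup>2 + 1 / (1 + C)) \<le> \<epsilon> / 4"
        using thK elim(7) unfolding L_def distrib_left by linarith
    qed (use N2 \<open>0 < \<epsilon>\<close> normal_tail_nonneg in auto)
    have T4: "R * H \<le> \<epsilon> / 8 * H" using R H by (intro mult_right_mono) auto
    have "\<bar>X - H\<bar> \<le> \<bar>X - Y\<bar> + \<bar>Y - normal_tail (w / \<sigma>)\<bar> + \<bar>normal_tail (w / \<sigma>) - H\<bar>" by linarith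
    also have "\<dots> \<le> 7 / 8 * (\<epsilon> * H)" using XY YN NH T1 T2 T3 T4 by linarith
    also have "\<dots> < \<epsilon> * H" using \<open>0 < \<epsilon>\<close> H by simp
    finally have "\<bar>X - H\<bar> / H < \<epsilon>" using H by (simp add: pos_divide_less_eq)
    moreover have "X / H - 1 = (X - H) / H" using H by (simp add: diff_divide_distrib)
    ultimately have "dist (X / H) 1 < \<epsilon>" using H by (simp add: dist_real_def abs_divide)
    then show ?case by (simp add: X_def H_def D_def w_def)
  qed
qed

theorem proposition1:
  fixes \<Delta> :: "real \<Rightarrow> real"
  assumes "\<Delta> \<in> o[at_top](\<lambda>T. sqrt (ln (ln T)))"
  shows "(\<lambda>T. 1 / T * measure lebesgue
              {t \<in> {T..2 * T}.
                 Re (prime_dirichlet_poly (cutoff T) t)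
                   \<ge> \<Delta> T * sqrt (1/2 * (\<Sum>p\<in>primes_upto (cutoff T). 1 / real p))})
         \<sim>[at_top]
         (\<lambda>T. LBINT u:{\<Delta> T..}. exp (- (u\<^sup>2) / 2) / sqrt (2 * pi))"
proof -
  define v where "v T = \<Delta> T * sqrt (1/2 * (\<Sum>p\<in>primes_upto (cutoff T). 1 / real p))" for T
  define P where "P T = 1 / T * measure lebesgue {t \<in> {T..2 * T}. Re (prime_dirichlet_poly (cutoff T) t) \<ge> v T}" for T
  define H where "H T = normal_tail (\<Delta> T)" for T
  have H: "0 < H T" for T by (simp add: H_def normal_tail_pos)
  have rhs: "(LBINT u:{a..}. exp (- (u\<^sup>2) / 2) / sqrt (2 * pi)) = normal_tail a" for a
    by (simp add: normal_tail_def std_normal_density_def)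
  let ?X = "\<lambda>T. smooth_tail (uniform_time T) (re_poly T)"
  have lim: "((\<lambda>T. ?X T (v T + \<kappa>) / H T) \<longlongrightarrow> 1) at_top" for \<kappa>
    unfolding v_def H_def by (rule smooth_tail_asymptotics[OF assms])
  have P: "P T = measure (uniform_time T) {t \<in> space (uniform_time T). re_poly T t \<ge> v T}" if "0 < T" for T
  proof -
    have "{t. re_poly T t \<ge> v T} \<in> sets borel" by measurable
    moreover have "{T..2 * T} \<inter> {t. re_poly T t \<ge> v T} = {t \<in> {T..2 * T}. Re (prime_dirichlet_poly (cutoff T) t) \<ge> v T}"
      by (auto simp: re_poly_def)
    ultimately show ?thesis
      using uniform_time_prob[OF that, of "{t. re_poly T t \<ge> v T}"] unfolding P_def space_uniform_time by (simp only: UNIV_I simp_thms)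
  qed
  have "((\<lambda>T. P T / H T) \<longlongrightarrow> 1) at_top"
  proof (rule tendstoI)
    fix \<epsilon> :: real assume "0 < \<epsilon>"
    \<comment> \<open>Both inequalities below lose a factor of at most \<open>1 \<plusminus> 3 \<delta>\<close>; the upper one uses
       \<open>(1 + \<delta>) / (1 - \<delta>) \<le> 1 + 3 \<delta>\<close>, valid for \<open>\<delta> \<le> 1/3\<close>.\<close>
    define \<delta> where "\<delta> = min (1/4) (\<epsilon> / 4)"
    have \<delta>: "0 < \<delta>" "\<delta> \<le> 1/4" "3 * \<delta> < \<epsilon>" using \<open>0 < \<epsilon>\<close> by (auto simp: \<delta>_def)
    have "((\<lambda>w::real. exp (- w\<^sup>2 / 2)) \<longlongrightarrow> 0) at_top" by real_asymp
    then have "\<forall>\<^sub>F w::real in at_top. exp (- w\<^sup>2 / 2) < \<delta>" using \<delta> by (intro order_tendstoD) auto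
    moreover have "\<forall>\<^sub>F w in at_top. 1 - \<delta> < normal_tail (- w)"
      using normal_tail_minus_tendsto \<delta> by (intro order_tendstoD) auto
    ultimately have "\<forall>\<^sub>F w in at_top. exp (- w\<^sup>2 / 2) < \<delta> \<and> 1 - \<delta> < normal_tail (- w) \<and> 0 \<le> w"
      using eventually_ge_at_top[of 0] by eventually_elim auto
    then obtain w where w: "exp (- w\<^sup>2 / 2) < \<delta>" "1 - \<delta> < normal_tail (- w)" "0 \<le> w"
      unfolding eventually_at_top_linorder by blast
    have near: "\<forall>\<^sub>F T in at_top. \<bar>?X T (v T + \<kappa>) / H T - 1\<bar> < \<delta>" for \<kappa>
      using tendstoD[OF lim \<delta>(1), of \<kappa>] by (simp add: dist_real_def)
    show "\<forall>\<^sub>F T in at_top. dist (P T / H T) 1 < \<epsilon>"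
      using near[of "- w"] near[of 0] near[of w] eventually_gt_at_top[of 0]
    proof eventually_elim
      case (elim T)
      interpret U: prob_space "uniform_time T" by (rule prob_space_uniform_time[OF elim(4)])
      have X: "?X T (v T - w) \<le> (1 + \<delta>) * H T" "?X T (v T) \<le> (1 + \<delta>) * H T" "(1 - \<delta>) * H T \<le> ?X T (v T + w)"
      proof -
        have "a \<le> (1 + \<delta>) * H T \<and> (1 - \<delta>) * H T \<le> a" if "\<bar>a / H T - 1\<bar> < \<delta>" for a
        proof -
          have "a / H T < 1 + \<delta>" "1 - \<delta> < a / H T" using that by linarith+
          then show ?thesis using H[of T] by (simp add: pos_divide_less_eq pos_less_divide_eq)
        qed
        from this[OF elim(1)] this[OF elim(2)] this[OF elim(3)]
        show "?X T (v T - w) \<le> (1 + \<delta>) * H T" "?X T (v T) \<le> (1 + \<delta>) * H T" "(1 - \<delta>) * H T \<le> ?X T (v T + w)"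
          by simp_all
      qed
      have P0: "0 \<le> P T" using elim(4) by (simp add: P_def)
      have "P T * (1 - \<delta>) \<le> P T * normal_tail (- w)" using w P0 by (intro mult_left_mono) auto
      also have "\<dots> \<le> ?X T (v T - w)" unfolding P[OF elim(4)] by (rule U.prob_le_smooth_tail) measurable
      also have "\<dots> \<le> (1 + \<delta>) * H T" by (rule X)
      also have "\<dots> \<le> (1 - \<delta>) * (1 + 3 * \<delta>) * H T"
      proof (rule mult_right_mono)
        have "\<delta> * \<delta> \<le> 1/4 * \<delta>" using \<delta> by (intro mult_right_mono) auto
        then show "1 + \<delta> \<le> (1 - \<delta>) * (1 + 3 * \<delta>)" using \<delta> by (simp add: algebra_simps)
      qed (use H[of T] in simp)
      finally have "(1 - \<delta>) * P T \<le> (1 - \<delta>) * ((1 + 3 * \<delta>) * H T)" by (simp add: mult_ac)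
      then have up: "P T \<le> (1 + 3 * \<delta>) * H T" using \<delta> by (simp add: mult_le_cancel_left_pos)
      have X0: "0 \<le> ?X T (v T)" by (simp add: smooth_tail_def normal_tail_nonneg)
      have "exp (- w\<^sup>2 / 2) * ?X T (v T) \<le> \<delta> * ((1 + \<delta>) * H T)"
        using w X X0 \<delta> by (intro mult_mono) auto
      also have "\<dots> \<le> \<delta> * (2 * H T)" using \<delta> H[of T] by (intro mult_left_mono mult_right_mono) auto
      finally have "(1 - 3 * \<delta>) * H T \<le> ?X T (v T + w) - exp (- w\<^sup>2 / 2) * ?X T (v T)"
        using X(3) by (simp add: algebra_simps)
      also have "\<dots> \<le> P T" unfolding P[OF elim(4)] by (rule U.smooth_tail_le_prob) (use w in auto)
      finally have lo: "(1 - 3 * \<delta>) * H T \<le> P T" .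
      have "\<bar>P T / H T - 1\<bar> \<le> 3 * \<delta>"
        using up lo H[of T] by (simp add: abs_le_iff field_simps)
      then show ?case using \<delta>(3) by (simp add: dist_real_def)
    qed
  qed
  then have "P \<sim>[at_top] H" by (rule asymp_equivI')
  then show ?thesis unfolding P_def H_def v_def rhs .
qed

end
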